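(* Let $\mathbb{K}\in\{\mathbb{R},\mathbb{C}\}$ and let $\mathfrak{g}$ be a finite dimensional $\mathbb{K}$-Lie superalgebra of dimension $m|n$, with basis $X_1,\dots,X_{m+n}$, where $X_i$ is even for $i\le m$ and odd for $i>m$. Let $\sigma:S(\mathfrak{g})\to U(\mathfrak{g})$ be the symmetrisation isomorphism. The action $\pi$ of $\mathfrak{g}$ on $S(\mathfrak{g})$ defined by $$\pi(X)Y:=\sigma^{-1}(X\,\sigma(Y))\qquad\text{for all }X\in\mathfrak{g},\ Y\in S(\mathfrak{g}),$$ is given by $$\pi(X)Y=\sum_{K\in\mathbb{N}^{m|n}}\frac{(-1)^{|K|}B_{|K|}}{K!}\,s^K_{\mathfrak{g}}(X)\,\partial^KY .$$
   Context: $\mathbb{N}=\{0,1,2,\dots\}$ and $\mathbb{N}^{m|n}=\mathbb{N}^m\times\{0,1\}^n$; for $K=(k_1,\dots,k_m|k_{m+1},\dots,k_{m+n})$ put $|K|=\sum_{i=1}^{m+n}k_i$ and $K!=k_1!\cdots k_m!$. The partial derivative $\partial^i$ is the unique super derivation of the supersymmetric algebra $S(\mathfrak{g})$ with $\partial^iX_j=\delta_{ij}$ (of parity $|X_i|$), and $\partial^K=(\partial^1)^{k_1}\cdots(\partial^{m+n})^{k_{m+n}}$. Bernoulli numbers: $B_0=1$, $B_1=-1/2$, $B_i=-\sum_{j=0}^{i-1}\binom{i}{j}\frac{B_j}{i-j+1}$ for $i>1$. Symmetrisation: for an associative superalgebra $A$, with product in the supersymmetric algebra $S(A)$ denoted $\bullet$,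 the map $\sigma:S(A)\to A$ is the linear map given, for homogeneous $a_i\in A$ with $a_i$ even for $i\le p$ and odd for $p<i\le p+q$, by $$\sigma(a_1\bullet\cdots\bullet a_{p+q})=\frac{1}{(p+q)!}\sum_{\tau\in S_{p+q}}(-1)^{|\tau|}a_{\tau(1)}\cdots a_{\tau(p+q)},$$ where $|\tau|$ is the number of pairs $(i,j)$ with $p<i<j\le p+q$ and $\tau^{-1}(i)>\tau^{-1}(j)$. Its restriction from $S(U(\mathfrak{g}))$ to $S(\mathfrak{g})$ is a vector space isomorphism $\sigma:S(\mathfrak{g})\to U(\mathfrak{g})$. In $S(\mathfrak{g})$ the product is written by juxtaposition. For $Z\in\mathfrak{g}$ let $\widetilde{\mathrm{ad}}_Z\in\mathrm{End}(\mathfrak{g})$, $\widetilde{\mathrm{ad}}_Z(Y)=[Y,Z]$. The operator $s^K_{\mathfrak{g}}\in\mathrm{End}(\mathfrak{g})$ is $$s^K_{\mathfrak{g}}(X)=\sigma\left(\widetilde{\mathrm{ad}}_{X_1}^{\bullet k_1}\bullet\cdots\bullet\widetilde{\mathrm{ad}}_{X_{m+n}}^{\bullet k_{m+n}}\right)X,$$ with $\sigma$ the symmetrisation map for the associative superalgebra $A=\mathrm{End}(\mathfrak{g})$ (and $s^0_{\mathfrak{g}}=\mathrm{id}$). *)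

theory Defs
  imports
    Complex_Main
    "HOL-Library.Poly_Mapping"
    "HOL-Library.Function_Algebras"
    "HOL-Library.Z2"
    "HOL-Library.FuncSet"
    "HOL-Combinatorics.Permutations"
    "HOL-Algebra.QuotRing"
    "HOL-Algebra.Module"
begin

text \<open>
  Gradings are indexed by the field \<^typ>\<open>bit\<close> with two elements. A super vector space is given
  by a scalar multiplication \<open>scale\<close> on an abelian group type and a family \<open>V\<close> with even part
  \<open>V 0\<close> and odd part \<open>V 1\<close>; the space itself is \<open>super_carrier V\<close>, which may be smaller than the
  ambient type (this is needed for \<open>End(g)\<close>).

  Real and complex scalars are treated together by the class \<^class>\<open>real_normed_field\<close>, whose
  members are, by the Gelfand-Mazur theorem, exactly the fields isomorphic to the reals or the
  complex numbers.
\<close>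

definition koszul :: "bit \<Rightarrow> bit \<Rightarrow> 'k::ring_1" where
  "koszul p q = (if p = 1 \<and> q = 1 then - 1 else 1)"

definition super_carrier :: "(bit \<Rightarrow> 'v::plus set) \<Rightarrow> 'v set" where
  "super_carrier V = {u + v | u v. u \<in> V 0 \<and> v \<in> V 1}"

locale super_vector_space = vector_space scale
  for scale :: "'k::field \<Rightarrow> 'v::ab_group_add \<Rightarrow> 'v" +
  fixes V :: "bit \<Rightarrow> 'v set"
  assumes subspace_part: "subspace (V p)"
    and part_disjoint: "V 0 \<inter> V 1 = {0}"
    and part_total: "super_carrier V = UNIV"

locale lie_superalgebra = super_vector_space scale V
  for scale :: "'k::field_char_0 \<Rightarrow> 'g::ab_group_add \<Rightarrow> 'g" and V +
  fixes bracket :: "'g \<Rightarrow> 'g \<Rightarrow> 'g"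
  assumes bracket_linear_left: "Vector_Spaces.linear scale scale (\<lambda>x. bracket x y)"
    and bracket_linear_right: "Vector_Spaces.linear scale scale (\<lambda>y. bracket x y)"
    and bracket_graded: "x \<in> V p \<Longrightarrow> y \<in> V q \<Longrightarrow> bracket x y \<in> V (p + q)"
    and super_antisymmetry:
      "x \<in> V p \<Longrightarrow> y \<in> V q \<Longrightarrow> bracket x y = - scale (koszul p q) (bracket y x)"
    and super_jacobi:
      "x \<in> V p \<Longrightarrow> y \<in> V q \<Longrightarrow>
        bracket x (bracket y z)
          = bracket (bracket x y) z + scale (koszul p q) (bracket y (bracket x z))"

text \<open>A homogeneous basis of a space of dimension \<open>m|n\<close>, indexed by \<open>{1..m + n}\<close>.\<close>

definition basis_parity :: "nat \<Rightarrow> nat \<Rightarrow> bit" where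
  "basis_parity m i = (if i \<le> m then 0 else 1)"

definition super_basis ::
  "('k::field \<Rightarrow> 'v::ab_group_add \<Rightarrow> 'v) \<Rightarrow> (bit \<Rightarrow> 'v set) \<Rightarrow> nat \<Rightarrow> nat \<Rightarrow> (nat \<Rightarrow> 'v) \<Rightarrow> bool"
where
  "super_basis scale V m n X \<longleftrightarrow>
     inj_on X {1..m + n} \<and>
     \<not> module.dependent scale (X ` {1..m + n}) \<and>
     module.span scale (X ` {1..m + n}) = UNIV \<and>
     (\<forall>i\<in>{1..m + n}. X i \<in> V (basis_parity m i))"


subsection \<open>Algebras given by generators and relations\<close>

text \<open>
  With concatenation of words as (noncommutative) addition, the convolution product of
  \<^typ>\<open>'v list \<Rightarrow>\<^sub>0 'k\<close> is that of the free associative algebra on \<^typ>\<open>'v\<close>.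
\<close>

instantiation list :: (type) monoid_add
begin
definition "0 = []"
definition "xs + ys = xs @ ys"
instance by standard (simp_all add: zero_list_def plus_list_def)
end

type_synonym ('k, 'v) free_alg = "'v list \<Rightarrow>\<^sub>0 'k"

definition word :: "'v list \<Rightarrow> ('k::ring_1, 'v) free_alg" where
  "word w = Poly_Mapping.single w 1"

definition scalar :: "'k::ring_1 \<Rightarrow> ('k, 'v) free_alg" where
  "scalar c = Poly_Mapping.single [] c"

definition free_algebra :: "'v set \<Rightarrow> ('k::ring_1, 'v) free_alg ring" where
  "free_algebra C =
     \<lparr>carrier = {f. \<forall>w\<in>Poly_Mapping.keys f. set w \<subseteq> C}, mult = (*), one = 1, zero = 0, add = (+)\<rparr>"

text \<open>
  Dividing the free algebra on the set \<open>C\<close> by the linearity relations alone gives the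
  tensor algebra of the vector space \<open>C\<close>.
\<close>

definition linearity_relations ::
  "('k::ring_1 \<Rightarrow> 'v::plus \<Rightarrow> 'v) \<Rightarrow> 'v set \<Rightarrow> ('k, 'v) free_alg set"
where
  "linearity_relations scale C =
     {word [u + v] - word [u] - word [v] | u v. u \<in> C \<and> v \<in> C} \<union>
     {word [scale c v] - scalar c * word [v] | c v. v \<in> C}"

definition presented_ideal ::
  "('k::ring_1 \<Rightarrow> 'v::plus \<Rightarrow> 'v) \<Rightarrow> 'v set \<Rightarrow> ('k, 'v) free_alg set \<Rightarrow> ('k, 'v) free_alg set"
where
  "presented_ideal scale C R = genideal (free_algebra C) (linearity_relations scale C \<union> R)"

definition presented_class ::
  "('k::ring_1 \<Rightarrow> 'v::plus \<Rightarrow> 'v) \<Rightarrow> 'v set \<Rightarrow> ('k, 'v) free_alg set \<Rightarrow>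
     ('k, 'v) free_alg \<Rightarrow> ('k, 'v) free_alg set"
where
  "presented_class scale C R f = a_r_coset (free_algebra C) (presented_ideal scale C R) f"

definition presented_algebra ::
  "('k::ring_1 \<Rightarrow> 'v::plus \<Rightarrow> 'v) \<Rightarrow> 'v set \<Rightarrow> ('k, 'v) free_alg set \<Rightarrow>
     ('k, ('k, 'v) free_alg set) module"
where
  "presented_algebra scale C R =
     (let Q = free_algebra C Quot presented_ideal scale C R in
       \<lparr>carrier = carrier Q, mult = mult Q, one = one Q, zero = zero Q, add = add Q,
        smult = (\<lambda>c a. presented_class scale C R (scalar c) \<otimes>\<^bsub>Q\<^esub> a)\<rparr>)"


subsection \<open>The supersymmetric algebra\<close>

definition sym_relations ::
  "(bit \<Rightarrow> 'v set) \<Rightarrow> ('k::ring_1, 'v) free_alg set"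
where
  "sym_relations V =
     {word [u] * word [v] - scalar (koszul p q) * (word [v] * word [u]) | u v p q.
        u \<in> V p \<and> v \<in> V q}"

abbreviation Sym ::
  "('k::ring_1 \<Rightarrow> 'v::plus \<Rightarrow> 'v) \<Rightarrow> (bit \<Rightarrow> 'v set) \<Rightarrow> ('k, ('k, 'v) free_alg set) module"
where
  "Sym scale V \<equiv> presented_algebra scale (super_carrier V) (sym_relations V)"

definition sym_gen ::
  "('k::ring_1 \<Rightarrow> 'v::plus \<Rightarrow> 'v) \<Rightarrow> (bit \<Rightarrow> 'v set) \<Rightarrow> 'v \<Rightarrow> ('k, 'v) free_alg set"
where
  "sym_gen scale V v = presented_class scale (super_carrier V) (sym_relations V) (word [v])"

definition sym_part ::
  "('k::ring_1 \<Rightarrow> 'v::plus \<Rightarrow> 'v) \<Rightarrow> (bit \<Rightarrow> 'v set) \<Rightarrow> bit \<Rightarrow> ('k, 'v) free_alg set set"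
where
  "sym_part scale V p =
     presented_class scale (super_carrier V) (sym_relations V) `
       {f. \<forall>w\<in>Poly_Mapping.keys f. \<exists>ps. list_all2 (\<lambda>v q. v \<in> V q) w ps \<and> sum_list ps = p}"


subsection \<open>The universal enveloping algebra\<close>

definition env_relations ::
  "(bit \<Rightarrow> 'g set) \<Rightarrow> ('g \<Rightarrow> 'g \<Rightarrow> 'g) \<Rightarrow> ('k::ring_1, 'g) free_alg set"
where
  "env_relations V bracket =
     {word [x] * word [y] - scalar (koszul p q) * (word [y] * word [x]) - word [bracket x y]
        | x y p q. x \<in> V p \<and> y \<in> V q}"

abbreviation Env ::
  "('k::ring_1 \<Rightarrow> 'g::plus \<Rightarrow> 'g) \<Rightarrow> (bit \<Rightarrow> 'g set) \<Rightarrow> ('g \<Rightarrow> 'g \<Rightarrow> 'g) \<Rightarrow>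
     ('k, ('k, 'g) free_alg set) module"
where
  "Env scale V bracket \<equiv> presented_algebra scale (super_carrier V) (env_relations V bracket)"

definition env_gen ::
  "('k::ring_1 \<Rightarrow> 'g::plus \<Rightarrow> 'g) \<Rightarrow> (bit \<Rightarrow> 'g set) \<Rightarrow> ('g \<Rightarrow> 'g \<Rightarrow> 'g) \<Rightarrow> 'g \<Rightarrow>
     ('k, 'g) free_alg set"
where
  "env_gen scale V bracket x =
     presented_class scale (super_carrier V) (env_relations V bracket) (word [x])"


subsection \<open>The superalgebra of endomorphisms\<close>

definition end_scale :: "('k \<Rightarrow> 'g \<Rightarrow> 'g) \<Rightarrow> 'k \<Rightarrow> ('g \<Rightarrow> 'g) \<Rightarrow> 'g \<Rightarrow> 'g" where
  "end_scale scale c f = (\<lambda>x. scale c (f x))"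

definition end_part ::
  "('k::field \<Rightarrow> 'g::ab_group_add \<Rightarrow> 'g) \<Rightarrow> (bit \<Rightarrow> 'g set) \<Rightarrow> bit \<Rightarrow> ('g \<Rightarrow> 'g) set"
where
  "end_part scale V p =
     {f. Vector_Spaces.linear scale scale f \<and> (\<forall>q. f ` V q \<subseteq> V (p + q))}"

definition end_algebra ::
  "('k::field \<Rightarrow> 'g::ab_group_add \<Rightarrow> 'g) \<Rightarrow> ('k, 'g \<Rightarrow> 'g) module"
where
  "end_algebra scale =
     \<lparr>carrier = {f. Vector_Spaces.linear scale scale f}, mult = (\<circ>), one = id,
      zero = 0, add = (+), smult = end_scale scale\<rparr>"


subsection \<open>Symmetrisation\<close>

definition alg_linear ::
  "('k, 'a, 'r) module_scheme \<Rightarrow> ('k, 'b, 's) module_scheme \<Rightarrow> ('a \<Rightarrow> 'b) \<Rightarrow> bool"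
where
  "alg_linear A B f \<longleftrightarrow>
     f \<in> carrier A \<rightarrow> carrier B \<and>
     (\<forall>x\<in>carrier A. \<forall>y\<in>carrier A. f (x \<oplus>\<^bsub>A\<^esub> y) = f x \<oplus>\<^bsub>B\<^esub> f y) \<and>
     (\<forall>c. \<forall>x\<in>carrier A. f (c \<odot>\<^bsub>A\<^esub> x) = c \<odot>\<^bsub>B\<^esub> f x)"

definition list_prod :: "('a, 'r) monoid_scheme \<Rightarrow> 'a list \<Rightarrow> 'a" where
  "list_prod A as = foldr (\<lambda>a b. a \<otimes>\<^bsub>A\<^esub> b) as \<one>\<^bsub>A\<^esub>"

text \<open>The letters \<open>0, \<dots>, p - 1\<close> are even and the letters \<open>p, \<dots>, r - 1\<close> are odd.\<close>

definition odd_inversions :: "nat \<Rightarrow> nat \<Rightarrow> (nat \<Rightarrow> nat) \<Rightarrow> nat" where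
  "odd_inversions p r \<tau> = card {(i, j). p \<le> i \<and> i < j \<and> j < r \<and> inv_into UNIV \<tau> i > inv_into UNIV \<tau> j}"

text \<open>
  The symmetrisation map \<open>S(A) \<rightarrow> A\<close>, restricted along an even linear map \<open>\<iota> : V \<rightarrow> A\<close>. For
  \<open>V = A\<close> and \<open>\<iota>\<close> the identity it is the symmetrisation map of \<open>A\<close>; for \<open>V = g\<close>, \<open>A = U(g)\<close> and \<open>\<iota>\<close>
  the canonical map it is the restriction to \<open>S(g)\<close> of the symmetrisation map of \<open>U(g)\<close>.
\<close>

definition symmetrisation ::
  "('k::field_char_0 \<Rightarrow> 'v::plus \<Rightarrow> 'v) \<Rightarrow> (bit \<Rightarrow> 'v set) \<Rightarrow> ('k, 'a) module \<Rightarrow> ('v \<Rightarrow> 'a) \<Rightarrow>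
     ('k, 'v) free_alg set \<Rightarrow> 'a"
where
  "symmetrisation scale V A \<iota> =
     (THE \<sigma>. \<sigma> \<in> extensional (carrier (Sym scale V)) \<and> alg_linear (Sym scale V) A \<sigma> \<and>
       (\<forall>as bs. set as \<subseteq> V 0 \<and> set bs \<subseteq> V 1 \<longrightarrow>
         (let p = length as; r = length as + length bs in
           \<sigma> (list_prod (Sym scale V) (map (sym_gen scale V) (as @ bs))) =
             (1 / fact r) \<odot>\<^bsub>A\<^esub>
               (\<Oplus>\<^bsub>A\<^esub>\<tau>\<in>{\<tau>. \<tau> permutes {..<r}}.
                  (- 1) ^ odd_inversions p r \<tau> \<odot>\<^bsub>A\<^esub>
                    list_prod A (map (\<lambda>i. \<iota> ((as @ bs) ! \<tau> i)) [0..<r])))))"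

definition lie_symmetrisation ::
  "('k::field_char_0 \<Rightarrow> 'g::plus \<Rightarrow> 'g) \<Rightarrow> (bit \<Rightarrow> 'g set) \<Rightarrow> ('g \<Rightarrow> 'g \<Rightarrow> 'g) \<Rightarrow>
     ('k, 'g) free_alg set \<Rightarrow> ('k, 'g) free_alg set"
where
  "lie_symmetrisation scale V bracket =
     symmetrisation scale V (Env scale V bracket) (env_gen scale V bracket)"

definition end_symmetrisation ::
  "('k::field_char_0 \<Rightarrow> 'g::ab_group_add \<Rightarrow> 'g) \<Rightarrow> (bit \<Rightarrow> 'g set) \<Rightarrow>
     ('k, 'g \<Rightarrow> 'g) free_alg set \<Rightarrow> 'g \<Rightarrow> 'g"
where
  "end_symmetrisation scale V =
     symmetrisation (end_scale scale) (end_part scale V) (end_algebra scale) id"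

definition sym_action ::
  "('k::field_char_0 \<Rightarrow> 'g::plus \<Rightarrow> 'g) \<Rightarrow> (bit \<Rightarrow> 'g set) \<Rightarrow> ('g \<Rightarrow> 'g \<Rightarrow> 'g) \<Rightarrow>
     'g \<Rightarrow> ('k, 'g) free_alg set \<Rightarrow> ('k, 'g) free_alg set"
where
  "sym_action scale V bracket Z Y =
     inv_into (carrier (Sym scale V)) (lie_symmetrisation scale V bracket)
       (env_gen scale V bracket Z \<otimes>\<^bsub>Env scale V bracket\<^esub> lie_symmetrisation scale V bracket Y)"


subsection \<open>Multi-indices, partial derivatives and the operators \<open>s\<^sup>K\<close>\<close>

definition multi_indices :: "nat \<Rightarrow> nat \<Rightarrow> (nat \<Rightarrow> nat) set" where
  "multi_indices m n =
     {K. (\<forall>i. i \<notin> {1..m + n} \<longrightarrow> K i = 0) \<and> (\<forall>i\<in>{m + 1..m + n}. K i \<in> {0, 1})}"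

definition mi_size :: "nat \<Rightarrow> nat \<Rightarrow> (nat \<Rightarrow> nat) \<Rightarrow> nat" where
  "mi_size m n K = (\<Sum>i = 1..m + n. K i)"

definition mi_fact :: "nat \<Rightarrow> (nat \<Rightarrow> nat) \<Rightarrow> 'k::field_char_0" where
  "mi_fact m K = (\<Prod>i = 1..m. fact (K i))"

definition superderivation ::
  "('k::field \<Rightarrow> 'v::plus \<Rightarrow> 'v) \<Rightarrow> (bit \<Rightarrow> 'v set) \<Rightarrow> bit \<Rightarrow>
     (('k, 'v) free_alg set \<Rightarrow> ('k, 'v) free_alg set) \<Rightarrow> bool"
where
  "superderivation scale V q D \<longleftrightarrow>
     alg_linear (Sym scale V) (Sym scale V) D \<and>
     (\<forall>p. D ` sym_part scale V p \<subseteq> sym_part scale V (q + p)) \<and>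
     (\<forall>p. \<forall>a\<in>sym_part scale V p. \<forall>b\<in>carrier (Sym scale V).
        D (a \<otimes>\<^bsub>Sym scale V\<^esub> b) =
          (D a \<otimes>\<^bsub>Sym scale V\<^esub> b) \<oplus>\<^bsub>Sym scale V\<^esub>
          (koszul q p \<odot>\<^bsub>Sym scale V\<^esub> (a \<otimes>\<^bsub>Sym scale V\<^esub> D b)))"

definition partial ::
  "('k::field \<Rightarrow> 'v::plus \<Rightarrow> 'v) \<Rightarrow> (bit \<Rightarrow> 'v set) \<Rightarrow> nat \<Rightarrow> nat \<Rightarrow> (nat \<Rightarrow> 'v) \<Rightarrow> nat \<Rightarrow>
     ('k, 'v) free_alg set \<Rightarrow> ('k, 'v) free_alg set"
where
  "partial scale V m n X i =
     (THE D. D \<in> extensional (carrier (Sym scale V)) \<and>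
        superderivation scale V (basis_parity m i) D \<and>
        (\<forall>j\<in>{1..m + n}. D (sym_gen scale V (X j)) =
           (if i = j then \<one>\<^bsub>Sym scale V\<^esub> else \<zero>\<^bsub>Sym scale V\<^esub>)))"

text \<open>The leftmost factor \<open>\<partial>\<^sup>1\<close> is applied last.\<close>

definition partial_power ::
  "('k::field \<Rightarrow> 'v::plus \<Rightarrow> 'v) \<Rightarrow> (bit \<Rightarrow> 'v set) \<Rightarrow> nat \<Rightarrow> nat \<Rightarrow> (nat \<Rightarrow> 'v) \<Rightarrow>
     (nat \<Rightarrow> nat) \<Rightarrow> ('k, 'v) free_alg set \<Rightarrow> ('k, 'v) free_alg set"
where
  "partial_power scale V m n X K Y =
     foldr (\<lambda>i. partial scale V m n X i ^^ K i) [1..<m + n + 1] Y"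

definition ad_tilde :: "('g \<Rightarrow> 'g \<Rightarrow> 'g) \<Rightarrow> 'g \<Rightarrow> 'g \<Rightarrow> 'g" where
  "ad_tilde bracket Z = (\<lambda>Y. bracket Y Z)"

definition s_operator ::
  "('k::field_char_0 \<Rightarrow> 'g::ab_group_add \<Rightarrow> 'g) \<Rightarrow> (bit \<Rightarrow> 'g set) \<Rightarrow> ('g \<Rightarrow> 'g \<Rightarrow> 'g) \<Rightarrow>
     nat \<Rightarrow> nat \<Rightarrow> (nat \<Rightarrow> 'g) \<Rightarrow> (nat \<Rightarrow> nat) \<Rightarrow> 'g \<Rightarrow> 'g"
where
  "s_operator scale V bracket m n X K =
     (let SE = Sym (end_scale scale) (end_part scale V) in
       end_symmetrisation scale V
         (list_prod SE
           (map (\<lambda>i. sym_gen (end_scale scale) (end_part scale V) (ad_tilde bracket (X i)) [^]\<^bsub>SE\<^esub> K i)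
             [1..<m + n + 1])))"

fun bernoulli :: "nat \<Rightarrow> 'k::field_char_0" where
  "bernoulli 0 = 1"
| "bernoulli (Suc 0) = - 1 / 2"
| "bernoulli i = - (\<Sum>j<i. of_nat (i choose j) * (bernoulli j / of_nat (i - j + 1)))"

definition pi_summand ::
  "('k::field_char_0 \<Rightarrow> 'g::ab_group_add \<Rightarrow> 'g) \<Rightarrow> (bit \<Rightarrow> 'g set) \<Rightarrow> ('g \<Rightarrow> 'g \<Rightarrow> 'g) \<Rightarrow>
     nat \<Rightarrow> nat \<Rightarrow> (nat \<Rightarrow> 'g) \<Rightarrow> 'g \<Rightarrow> ('k, 'g) free_alg set \<Rightarrow> (nat \<Rightarrow> nat) \<Rightarrow>
     ('k, 'g) free_alg set"
where
  "pi_summand scale V bracket m n X Z Y K =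
     ((- 1) ^ mi_size m n K * bernoulli (mi_size m n K) / mi_fact m K) \<odot>\<^bsub>Sym scale V\<^esub>
       (sym_gen scale V (s_operator scale V bracket m n X K Z)
          \<otimes>\<^bsub>Sym scale V\<^esub> partial_power scale V m n X K Y)"

end

theory Submission
  imports Defs "HOL-Combinatorics.Multiset_Permutations"
begin

text \<open>
  Let \<open>T (x \<otimes> Y) = \<Sum>\<^sub>i [x, X\<^sub>i] \<otimes> \<partial>\<^sup>i Y\<close> on \<open>g \<otimes> S(g)\<close>. Euler's formula
  \<open>r \<sigma>(Y) = \<Sum>\<^sub>i X\<^sub>i \<sigma>(\<partial>\<^sup>i Y)\<close> for \<open>Y\<close> of degree \<open>r\<close> gives, by induction on the degree,
  \<open>\<sigma>(x Y) = \<Sum>\<^sub>k a\<^sub>k m(T\<^sup>k (x \<otimes> Y))\<close> with \<open>a\<^sub>k = (-1)\<^sup>k / (k+1)!\<close> and \<open>m(x \<otimes> Y) = x \<sigma>(Y)\<close>. By the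
  recursion for the Bernoulli numbers, the power series \<open>a(t) = \<Sum> a\<^sub>k t\<^sup>k\<close> has the inverse
  \<open>\<Sum> (-1)\<^sup>k B\<^sub>k t\<^sup>k / k!\<close>. Hence \<open>x \<sigma>(Y) = \<sigma>(\<pi>(x) Y)\<close> if \<open>\<pi>(x) Y\<close> is the product in \<open>S(g)\<close> applied to
  \<open>\<Sum> (-1)\<^sup>k B\<^sub>k T\<^sup>k (x \<otimes> Y) / k!\<close>, and sorting the indices turns \<open>T\<^sup>k / k!\<close> into a sum over multi-indices.

  It remains to see that \<open>\<sigma>\<close> is injective (the Poincare-Birkhoff-Witt theorem). Expanding both sides of
  \<open>x (y Y) = \<plusminus> y (x Y)\<close> in \<open>\<pi>\<close> yields \<open>a(T\<^sub>1) a(T\<^sub>2)\<close> applied to the defect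
  \<open>\<pi>(x) \<pi>(y) \<minusplus> \<pi>(y) \<pi>(x) - \<pi>([x, y])\<close>, where \<open>T\<^sub>1\<close> and \<open>T\<^sub>2\<close> contract the two arguments. Since
  \<open>a(T\<^sub>1) a(T\<^sub>2)\<close> is invertible, \<open>\<pi>\<close> is a representation. So \<open>U(g)\<close> acts on \<open>S(g)\<close>, and
  \<open>\<sigma>(Y) \<cdot> 1 = Y\<close>.
\<close>

subsection \<open>Congruences modulo two-sided ideals\<close>

text \<open>The coefficients have closed generating functions. Comparing degrees in Euler's formula,
  where moving \<open>X\<^sub>i\<close> past \<open>x\<close> costs one application of
  \<open>T\<close>, forces \<open>a(t) = (1 - exp(-t)) / t\<close>; its inverse
  \<open>t / (1 - exp(-t))\<close> is the Bernoulli series. The representation property rests on the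
  identity \<open>(a(s+t) - a(s))/t + (a(s+t) - a(t))/s = - a(s) a(t)\<close>, the addition theorem
  of exp in disguise. Two obstacles shape the proof. Elements of the quotient algebras are cosets,
  on which operators are awkward; so the work is done on representatives in the free algebra, with
  congruences modulo ideals, and the operators are chosen so that many identities hold there
  exactly. Moreover, symmetrisation occurs for two algebras: for U(g), where Euler's formula in the
  basis of g is convenient, and for End(g), which does not fill its type and carries no chosen
  basis. A second, basis-free recursion is therefore matched both with the permutation formula and
  with Euler's formula. Symmetrisation and partial derivatives are given by definite descriptions,
  so their uniqueness has to be proved as well.\<close>

locale two_sided_ideal =
  fixes I :: "'r::ring_1 set"
  assumes zero_mem: "0 \<in> I"
    and add_mem: "f \<in> I \<Longrightarrow> g \<in> I \<Longrightarrow> f + g \<in> I"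
    and mult_left_mem: "f \<in> I \<Longrightarrow> g * f \<in> I"
    and mult_right_mem: "f \<in> I \<Longrightarrow> f * g \<in> I"
begin

abbreviation cong :: "'r \<Rightarrow> 'r \<Rightarrow> bool" (infix "\<approx>" 50) where
  "f \<approx> g \<equiv> f - g \<in> I"

lemma neg_mem: "f \<in> I \<Longrightarrow> - f \<in> I"
  using mult_left_mem[of f "-1"] by simp

lemma diff_mem: "f \<in> I \<Longrightarrow> g \<in> I \<Longrightarrow> f - g \<in> I"
  using add_mem[of f "- g"] neg_mem by simp

lemma sum_mem: "(\<And>x. x \<in> A \<Longrightarrow> f x \<in> I) \<Longrightarrow> sum f A \<in> I"
  by (induction A rule: infinite_finite_induct) (auto intro: zero_mem add_mem)

lemma cong_refl [simp]: "f \<approx> f"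
  by (simp add: zero_mem)

lemma cong_sym: "f \<approx> g \<Longrightarrow> g \<approx> f"
  using neg_mem[of "f - g"] by simp

lemma cong_trans [trans]: "f \<approx> g \<Longrightarrow> g \<approx> h \<Longrightarrow> f \<approx> h"
  using add_mem[of "f - g" "g - h"] by simp

lemma cong_eq_trans [trans]: "f \<approx> g \<Longrightarrow> g = h \<Longrightarrow> f \<approx> h"
  by simp

lemma eq_cong_trans [trans]: "f = g \<Longrightarrow> g \<approx> h \<Longrightarrow> f \<approx> h"
  by simp

lemma cong_add: "f \<approx> f' \<Longrightarrow> g \<approx> g' \<Longrightarrow> f + g \<approx> f' + g'"
  using add_mem[of "f - f'" "g - g'"] by (simp add: algebra_simps)

lemma cong_diff: "f \<approx> f' \<Longrightarrow> g \<approx> g' \<Longrightarrow> f - g \<approx> f' - g'"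
  using diff_mem[of "f - f'" "g - g'"] by (simp add: algebra_simps)

lemma cong_mult_left: "f \<approx> f' \<Longrightarrow> g * f \<approx> g * f'"
  using mult_left_mem[of "f - f'" g] by (simp add: algebra_simps)

lemma cong_mult_right: "f \<approx> f' \<Longrightarrow> f * g \<approx> f' * g"
  using mult_right_mem[of "f - f'" g] by (simp add: algebra_simps)

lemma cong_mult: "f \<approx> f' \<Longrightarrow> g \<approx> g' \<Longrightarrow> f * g \<approx> f' * g'"
  using cong_trans[OF cong_mult_left cong_mult_right] by blast

lemma cong_sum: "(\<And>x. x \<in> A \<Longrightarrow> f x \<approx> g x) \<Longrightarrow> sum f A \<approx> sum g A"
  using sum_mem[of A "\<lambda>x. f x - g x"] by (simp add: sum_subtractf)

end

text \<open>An inductive form of the generated ideal, so that stability under linear maps is proved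
  by rule induction over the relations. \<open>I_UNIV\<close> identifies it with
  \<open>genideal\<close>.\<close>

inductive_set gen_ideal :: "'r::ring_1 set \<Rightarrow> 'r set" for R where
  zero: "0 \<in> gen_ideal R"
| gen: "r \<in> R \<Longrightarrow> r \<in> gen_ideal R"
| add: "f \<in> gen_ideal R \<Longrightarrow> g \<in> gen_ideal R \<Longrightarrow> f + g \<in> gen_ideal R"
| mult_left: "f \<in> gen_ideal R \<Longrightarrow> g * f \<in> gen_ideal R"
| mult_right: "f \<in> gen_ideal R \<Longrightarrow> f * g \<in> gen_ideal R"

lemma two_sided_ideal_gen_ideal: "two_sided_ideal (gen_ideal R)"
  by standard (auto intro: gen_ideal.intros)

lemma gen_ideal_mono: "R \<subseteq> R' \<Longrightarrow> gen_ideal R \<subseteq> gen_ideal R'"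
proof
  fix f assume "R \<subseteq> R'" "f \<in> gen_ideal R"
  from this(2,1) show "f \<in> gen_ideal R'"
    by (induction) (auto intro: gen_ideal.intros)
qed


subsection \<open>The free associative algebra\<close>

definition smul :: "'k::field \<Rightarrow> ('k, 'v) free_alg \<Rightarrow> ('k, 'v) free_alg" where
  "smul c f = scalar c * f"

lemma word_Nil: "word [] = 1"
  by (simp add: word_def flip: zero_list_def)

lemma word_mult: "word u * word v = word (u @ v)"
  by (simp add: word_def mult_single plus_list_def)

lemma word_Cons: "word (v # w) = word [v] * word w"
  by (simp add: word_mult)

lemma scalar_mult: "scalar c * scalar d = scalar (c * d)"
  by (simp add: scalar_def mult_single plus_list_def)

lemma scalar_one: "scalar 1 = 1"
  by (simp add: scalar_def flip: zero_list_def)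

lemma scalar_add: "scalar (c + d) = scalar c + scalar d"
  by (simp add: scalar_def single_add)

lemma smul_word: "smul c (word w) = Poly_Mapping.single w c"
  by (simp add: smul_def scalar_def word_def mult_single plus_list_def)

lemma smul_single: "smul c (Poly_Mapping.single w d) = Poly_Mapping.single w (c * d)"
  by (simp add: smul_def scalar_def mult_single plus_list_def)

lemma free_alg_sum: "f = (\<Sum>w\<in>Poly_Mapping.keys f. smul (Poly_Mapping.lookup f w) (word w))"
proof (rule poly_mapping_eqI)
  fix u
  have "Poly_Mapping.lookup (\<Sum>w\<in>A. Poly_Mapping.single w (Poly_Mapping.lookup f w)) u
      = (if u \<in> A then Poly_Mapping.lookup f u else 0)" if "finite A" for A
    using that by (induction A) (auto simp: lookup_add lookup_single when_def)
  then show "Poly_Mapping.lookup f u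
      = Poly_Mapping.lookup (\<Sum>w\<in>Poly_Mapping.keys f. smul (Poly_Mapping.lookup f w) (word w)) u"
    by (simp add: smul_word in_keys_iff)
qed

lemma scalar_commute: "f * scalar c = scalar c * f" for f :: "('k::field, 'v) free_alg"
proof -
  have 1: "Poly_Mapping.single w d * scalar c = scalar c * Poly_Mapping.single w d" for w :: "'v list" and d :: 'k
    by (simp add: scalar_def mult_single plus_list_def mult.commute)
  show ?thesis
    by (subst (1 2) free_alg_sum) (simp add: smul_word sum_distrib_left sum_distrib_right 1)
qed

lemma smul_mult_left: "smul c f * g = smul c (f * g)"
  by (simp add: smul_def mult.assoc)

lemma smul_mult_right: "f * smul c g = smul c (f * g)"
  by (metis smul_def mult.assoc scalar_commute)

interpretation smul: vector_space smul
  by standard (simp_all add: smul_def algebra_simps scalar_add scalar_mult scalar_one flip: mult.assoc)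

lemma smul_minus_one: "smul (-1) f = - f"
  by (metis smul.scale_minus_left smul.scale_one)


lemma two_sided_smul_mem: "two_sided_ideal J \<Longrightarrow> f \<in> J \<Longrightarrow> smul c f \<in> J"
  by (simp add: smul_def two_sided_ideal.mult_left_mem)

lemma two_sided_smul_cong: "two_sided_ideal J \<Longrightarrow> f - g \<in> J \<Longrightarrow> smul c f - smul c g \<in> J"
  by (metis smul.scale_right_diff_distrib two_sided_smul_mem)

lemma free_alg_induct [case_names zero add smul word]:
  assumes "P 0" "\<And>f g. P f \<Longrightarrow> P g \<Longrightarrow> P (f + g)" "\<And>c f. P f \<Longrightarrow> P (smul c f)" "\<And>w. P (word w)"
  shows "P f"
proof -
  have "P (\<Sum>w\<in>A. smul (Poly_Mapping.lookup f w) (word w))" if "finite A" for A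
    using that by (induction A) (auto intro: assms)
  from this[of "Poly_Mapping.keys f"] show ?thesis
    using free_alg_sum[of f] by simp
qed

text \<open>Words are a basis of the free algebra, so linear maps out of it are prescribed on words
  without compatibility conditions. Descent to a quotient is a separate statement about
  ideals.\<close>

definition lin_ext :: "('k::field \<Rightarrow> 'a \<Rightarrow> 'a) \<Rightarrow> ('v list \<Rightarrow> 'a) \<Rightarrow> ('k, 'v) free_alg \<Rightarrow> 'a::ab_group_add" where
  "lin_ext sc \<phi> f = (\<Sum>w\<in>Poly_Mapping.keys f. sc (Poly_Mapping.lookup f w) (\<phi> w))"

lemma lin_ext_word: "vector_space sc \<Longrightarrow> lin_ext sc \<phi> (word w) = \<phi> w"
  by (simp add: lin_ext_def word_def vector_space.vector_space_assms(4))

lemma linear_lin_ext: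
  assumes "vector_space sc"
  shows "Vector_Spaces.linear smul sc (lin_ext sc \<phi>)"
proof -
  interpret vector_space sc by fact
  have sup: "lin_ext sc \<phi> f = (\<Sum>w\<in>A. sc (Poly_Mapping.lookup f w) (\<phi> w))"
    if "finite A" "Poly_Mapping.keys f \<subseteq> A" for f A
    unfolding lin_ext_def using that by (intro sum.mono_neutral_left) (auto simp: in_keys_iff)
  show ?thesis
  proof -
    have "lin_ext sc \<phi> (f + g) = lin_ext sc \<phi> f + lin_ext sc \<phi> g \<and> lin_ext sc \<phi> (smul c f) = sc c (lin_ext sc \<phi> f)" for f g c
    proof
      let ?A = "Poly_Mapping.keys f \<union> Poly_Mapping.keys g"
      have "Poly_Mapping.keys (f + g) \<subseteq> ?A" by (rule keys_add)
      then show "lin_ext sc \<phi> (f + g) = lin_ext sc \<phi> f + lin_ext sc \<phi> g"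
        by (simp add: sup[of ?A] lookup_add scale_left_distrib sum.distrib)
      have lk: "Poly_Mapping.lookup (smul c f) w = c * Poly_Mapping.lookup f w" for w
      proof -
        have "Poly_Mapping.lookup (\<Sum>w\<in>A. smul c (smul (Poly_Mapping.lookup f w) (word w))) w
           = c * Poly_Mapping.lookup (\<Sum>w\<in>A. smul (Poly_Mapping.lookup f w) (word w)) w" for A
          by (induction A rule: infinite_finite_induct)
             (simp_all add: lookup_add algebra_simps smul_word smul_single lookup_single when_def)
        from this[of "Poly_Mapping.keys f"] show ?thesis
          by (metis (no_types, lifting) free_alg_sum smul.scale_sum_right sum.cong)
      qed
      then have "Poly_Mapping.keys (smul c f) \<subseteq> Poly_Mapping.keys f"
        by (auto simp: in_keys_iff)
      then show "lin_ext sc \<phi> (smul c f) = sc c (lin_ext sc \<phi> f)"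
        by (simp add: sup[of "Poly_Mapping.keys f"] lk scale_sum_right)
    qed
    then show ?thesis
      by (simp add: Vector_Spaces.linear_iff vector_space_axioms smul.vector_space_axioms)
  qed
qed


lemmas lin_ext_smul_linear = linear_lin_ext[OF smul.vector_space_axioms]
  and lin_ext_smul_word = lin_ext_word[OF smul.vector_space_axioms]

lemmas lin_ext_add = module_hom.add[OF module_hom_linearI[OF lin_ext_smul_linear]]
  and lin_ext_scale = module_hom.scale[OF module_hom_linearI[OF lin_ext_smul_linear]]
  and lin_ext_zero = module_hom.zero[OF module_hom_linearI[OF lin_ext_smul_linear]]

lemma linear_eq_on_words:
  assumes "Vector_Spaces.linear smul sc L" "Vector_Spaces.linear smul sc L'"
    and "\<And>w. L (word w) = L' (word w)"
  shows "L f = L' f"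
proof -
  interpret L: Vector_Spaces.linear smul sc L by fact
  interpret L': Vector_Spaces.linear smul sc L' by fact
  show ?thesis
    by (induction f rule: free_alg_induct) (simp_all add: L.add L'.add L.scale L'.scale assms(3))
qed


subsection \<open>Coordinates in a Lie superalgebra\<close>

lemma koszul_commute: "koszul p q = koszul q p"
  by (auto simp: koszul_def)

lemma bit_add_cancel [simp]: "(p::bit) + p = 0" "p + (p + q) = q"
  by (cases p; cases q; simp)+

declare add_bit_eq_xor [simp del]

lemma koszul_add_right: "koszul p (q + r) = koszul p q * koszul p r"
  by (cases p; cases q; cases r) (auto simp: koszul_def)

lemma koszul_square [simp]: "koszul p q * koszul p q = 1"
  by (auto simp: koszul_def)

lemma koszul_square_left [simp]: "koszul p q * (koszul p q * x) = x"
  by (simp flip: mult.assoc)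

lemma koszul_one_one [simp]: "koszul 1 1 = - 1"
  by (simp add: koszul_def)

lemma koszul_zero [simp]: "koszul 0 q = 1" "koszul q 0 = 1"
  by (auto simp: koszul_def)

locale based_lie_superalgebra = lie_superalgebra scale V bracket
  for scale :: "'k::field_char_0 \<Rightarrow> 'g::ab_group_add \<Rightarrow> 'g" and V bracket +
  fixes m n :: nat and X :: "nat \<Rightarrow> 'g"
  assumes super_basis: "super_basis scale V m n X"
begin

definition Ix :: "nat set" where "Ix = {1..m + n}"

lemma finite_Ix [simp]: "finite Ix"
  by (simp add: Ix_def)

abbreviation par :: "nat \<Rightarrow> bit" where "par \<equiv> basis_parity m"

definition xi :: "nat \<Rightarrow> 'g \<Rightarrow> 'k" where
  "xi i v = representation (X ` Ix) v (X i)"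

lemma basis_inj: "inj_on X Ix" and basis_independent: "independent (X ` Ix)"
  and basis_span: "span (X ` Ix) = UNIV" and basis_mem: "i \<in> Ix \<Longrightarrow> X i \<in> V (par i)"
  using super_basis by (auto simp: super_basis_def Ix_def)

lemma xi_add [simp]: "xi i (u + v) = xi i u + xi i v"
  by (simp add: xi_def representation_add[OF basis_independent] basis_span)

lemma xi_scale [simp]: "xi i (scale c v) = c * xi i v"
  by (simp add: xi_def representation_scale[OF basis_independent] basis_span)

lemma xi_zero [simp]: "xi i 0 = 0"
  by (simp add: xi_def representation_zero)

lemma xi_diff [simp]: "xi i (u - v) = xi i u - xi i v"
  by (simp add: xi_def representation_diff[OF basis_independent] basis_span)

lemma xi_sum [simp]: "xi i (sum f A) = (\<Sum>x\<in>A. xi i (f x))"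
  by (induction A rule: infinite_finite_induct) auto

lemma xi_basis: "j \<in> Ix \<Longrightarrow> i \<in> Ix \<Longrightarrow> xi i (X j) = (if i = j then 1 else 0)"
  using basis_inj by (auto simp: xi_def representation_basis[OF basis_independent] inj_on_eq_iff)

lemma basis_expansion: "v = (\<Sum>i\<in>Ix. scale (xi i v) (X i))"
proof -
  have "(\<Sum>b\<in>X ` Ix. scale (representation (X ` Ix) v b) b) = v"
    by (rule sum_representation_eq[OF basis_independent]) (auto simp: basis_span)
  then show ?thesis
    by (simp add: sum.reindex[OF basis_inj] xi_def)
qed

lemma eq_if_xi_eq: "(\<And>i. i \<in> Ix \<Longrightarrow> xi i u = xi i v) \<Longrightarrow> u = v"
  by (metis (no_types, lifting) basis_expansion sum.cong)

lemma xi_basis_sum [simp]: "i \<in> Ix \<Longrightarrow> xi i (\<Sum>j\<in>Ix. scale (c j) (X j)) = c i"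
  by (simp add: xi_basis if_distrib[of "\<lambda>x. _ * x"] cong: if_cong)

definition pr :: "bit \<Rightarrow> 'g \<Rightarrow> 'g" where
  "pr q v = (\<Sum>i\<in>Ix. scale (if par i = q then xi i v else 0) (X i))"

text \<open>The Koszul sign as a linear operator: on \<open>V p\<close> it is the scalar
  \<open>koszul q p\<close> (\<open>tw_part\<close>). It makes sense on inhomogeneous vectors, so
  the identities below hold for arbitrary vectors.\<close>

definition tw :: "bit \<Rightarrow> 'g \<Rightarrow> 'g" where
  "tw q v = (\<Sum>i\<in>Ix. scale (koszul q (par i) * xi i v) (X i))"

lemma xi_pr [simp]: "i \<in> Ix \<Longrightarrow> xi i (pr q v) = (if par i = q then xi i v else 0)"
  by (simp add: pr_def del: xi_sum)

lemma xi_tw [simp]: "i \<in> Ix \<Longrightarrow> xi i (tw q v) = koszul q (par i) * xi i v"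
  by (simp add: tw_def del: xi_sum)

lemma pr_add: "pr q (u + v) = pr q u + pr q v" and pr_scale: "pr q (scale c v) = scale c (pr q v)"
  and tw_add: "tw q (u + v) = tw q u + tw q v" and tw_scale: "tw q (scale c v) = scale c (tw q v)"
  by (rule eq_if_xi_eq; simp add: algebra_simps)+

lemma pr_mem: "pr q v \<in> V q"
  unfolding pr_def
proof (rule subspace_sum[OF subspace_part])
  fix i assume i: "i \<in> Ix"
  show "scale (if par i = q then xi i v else 0) (X i) \<in> V q"
    using subspace_scale[OF subspace_part basis_mem[OF i]] subspace_0[OF subspace_part[of q]] by auto
qed

lemma pr_total: "pr 0 v + pr 1 v = v"
proof (rule eq_if_xi_eq)
  fix i assume "i \<in> Ix"
  then show "xi i (pr 0 v + pr 1 v) = xi i v"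
    by (cases "par i") auto
qed

lemma part_inter: "v \<in> V p \<Longrightarrow> v \<in> V q \<Longrightarrow> p \<noteq> q \<Longrightarrow> v = 0"
  using part_disjoint by (cases p; cases q) auto

text \<open>The vector \<open>pr (p + 1) v = v - pr p v\<close> lies in both parts of the grading
  and hence vanishes. This links the projections, defined by coordinates, to the abstract subspaces
  \<open>V p\<close>.\<close>

lemma pr_part: "v \<in> V p \<Longrightarrow> pr q v = (if p = q then v else 0)"
proof -
  assume v: "v \<in> V p"
  have "pr (p + 1) v = v - pr p v"
    using pr_total[of v] by (cases p) (auto simp: algebra_simps)
  also have "\<dots> \<in> V p"
    by (intro subspace_diff subspace_part v pr_mem)
  finally have "pr (p + 1) v = 0"
    using part_inter[OF _ pr_mem, where p = p and q = "p + 1"] by (cases p) auto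
  then show ?thesis
    using pr_total[of v] by (cases p; cases q) auto
qed

lemma xi_part: "v \<in> V p \<Longrightarrow> i \<in> Ix \<Longrightarrow> par i \<noteq> p \<Longrightarrow> xi i v = 0"
  using pr_part[of v p p] xi_pr[of i p v] by auto

lemma tw_part: "v \<in> V p \<Longrightarrow> tw q v = scale (koszul q p) v"
  by (rule eq_if_xi_eq) (auto, metis mult_zero_right xi_part)

lemma linear_eq_on_basis:
  assumes "Vector_Spaces.linear scale sc L" "Vector_Spaces.linear scale sc L'"
    and "\<And>i. i \<in> Ix \<Longrightarrow> L (X i) = L' (X i)"
  shows "L v = L' v"
proof -
  interpret L: Vector_Spaces.linear scale sc L by fact
  interpret L': Vector_Spaces.linear scale sc L' by fact
  show ?thesis
    by (subst (1 2) basis_expansion) (simp add: L.sum L'.sum L.scale L'.scale assms(3))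
qed

lemma linear_scaleI:
  "(\<And>u v. L (u + v) = L u + L v) \<Longrightarrow> (\<And>c u. L (scale c u) = scale c (L u))
    \<Longrightarrow> Vector_Spaces.linear scale scale L"
  by (simp add: Vector_Spaces.linear_iff vector_space_axioms)

lemma bracket_add_left: "bracket (u + v) w = bracket u w + bracket v w"
  and bracket_scale_left: "bracket (scale c u) w = scale c (bracket u w)"
  using bracket_linear_left[of w] by (simp_all add: Vector_Spaces.linear_iff)

lemma bracket_add_right: "bracket w (u + v) = bracket w u + bracket w v"
  and bracket_scale_right: "bracket w (scale c u) = scale c (bracket w u)"
  using bracket_linear_right[of w] by (simp_all add: Vector_Spaces.linear_iff)

lemma bracket_sum_right: "bracket w (sum f A) = (\<Sum>x\<in>A. bracket w (f x))"
proof -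
  interpret R: Vector_Spaces.linear scale scale "bracket w" by (rule bracket_linear_right)
  show ?thesis by (rule R.sum)
qed

lemmas bilinear_simps = bracket_add_left bracket_add_right bracket_scale_left bracket_scale_right
  tw_add tw_scale pr_add pr_scale scale_right_distrib

lemma bracket_expansion: "bracket z u = (\<Sum>i\<in>Ix. scale (xi i u) (bracket z (X i)))"
  by (subst basis_expansion[of u]) (simp add: bracket_sum_right bracket_scale_right)

text \<open>Bracketing with \<open>X j\<close> shifts the parity by \<open>par j\<close>, and
  \<open>koszul\<close> is multiplicative in its second argument.\<close>

lemma bracket_tw:
  assumes "j \<in> Ix"
  shows "bracket (tw q z) (X j) = scale (koszul q (par j)) (tw q (bracket z (X j)))"
proof (rule linear_eq_on_basis[of scale "\<lambda>z. bracket (tw q z) (X j)"])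
  fix i assume i: "i \<in> Ix"
  show "bracket (tw q (X i)) (X j) = scale (koszul q (par j)) (tw q (bracket (X i) (X j)))"
    using assms i
    by (simp add: tw_part[OF basis_mem] tw_part[OF bracket_graded[OF basis_mem basis_mem]]
        bilinear_simps koszul_add_right mult.commute mult.left_commute)
qed (rule linear_scaleI; simp add: bilinear_simps mult.commute)+

text \<open>The Jacobi identity as a Leibniz rule for bracketing with \<open>X k\<close> from the
  right, the sign being carried by \<open>tw\<close>. Both sides are linear in \<open>z\<close> and
  \<open>z'\<close>, so basis vectors suffice.\<close>

lemma jacobi_right:
  assumes "k \<in> Ix"
  shows "bracket (bracket z z') (X k)
    = bracket z (bracket z' (X k)) + bracket (bracket z (X k)) (tw (par k) z')"
proof -
  have "bracket (bracket (X i) z') (X k)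
    = bracket (X i) (bracket z' (X k)) + bracket (bracket (X i) (X k)) (tw (par k) z')"
    if i: "i \<in> Ix" for i
  proof (rule linear_eq_on_basis[of scale "\<lambda>z'. bracket (bracket (X i) z') (X k)"])
    fix j assume j: "j \<in> Ix"
    have "bracket (X j) (bracket (X i) (X k)) =
      - scale (koszul (par j) (par i + par k)) (bracket (bracket (X i) (X k)) (X j))"
      by (intro super_antisymmetry bracket_graded basis_mem assms i j)
    moreover have "bracket (X i) (bracket (X j) (X k)) = bracket (bracket (X i) (X j)) (X k)
        + scale (koszul (par i) (par j)) (bracket (X j) (bracket (X i) (X k)))"
      by (intro super_jacobi basis_mem i j)
    ultimately show "bracket (bracket (X i) (X j)) (X k) = bracket (X i) (bracket (X j) (X k))
        + bracket (bracket (X i) (X k)) (tw (par k) (X j))"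
      by (simp add: tw_part[OF basis_mem[OF j]] bilinear_simps koszul_add_right
          koszul_commute[of "par j"])
  qed (rule linear_scaleI; simp add: bilinear_simps)+
  note basis = this
  show ?thesis
  proof (rule linear_eq_on_basis[of scale "\<lambda>z. bracket (bracket z z') (X k)"])
    show "bracket (bracket (X i) z') (X k)
        = bracket (X i) (bracket z' (X k)) + bracket (bracket (X i) (X k)) (tw (par k) z')"
      if "i \<in> Ix" for i
      using that by (rule basis)
  qed (rule linear_scaleI; simp add: bilinear_simps)+
qed

text \<open>Antisymmetry for inhomogeneous vectors: only the odd part of \<open>z'\<close> puts
  signs on \<open>z\<close>. The same pattern returns in \<open>emb_commute\<close> and
  \<open>super_swap\<close>.\<close>

lemma antisymmetry_pr: "bracket (pr 0 z') z + bracket (pr 1 z') (tw 1 z) = - bracket z z'"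
proof (rule linear_eq_on_basis[of scale "\<lambda>z. bracket (pr 0 z') z + bracket (pr 1 z') (tw 1 z)"])
  fix j assume j: "j \<in> Ix"
  have "bracket (pr q z') (X j) = - scale (koszul q (par j)) (bracket (X j) (pr q z'))" for q
    by (intro super_antisymmetry pr_mem basis_mem j)
  then have "bracket (pr 0 z') (X j) + bracket (pr 1 z') (tw 1 (X j))
      = - (bracket (X j) (pr 0 z') + bracket (X j) (pr 1 z'))"
    by (simp add: tw_part[OF basis_mem[OF j]] bilinear_simps)
  then show "bracket (pr 0 z') (X j) + bracket (pr 1 z') (tw 1 (X j)) = - bracket (X j) z'"
    by (metis bracket_add_right pr_total)
qed (rule linear_scaleI; simp add: bilinear_simps)+

lemma pr_tw: "pr p (tw q v) = scale (koszul q p) (pr p v)"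
  by (rule eq_if_xi_eq) auto

lemma tw_tw: "tw p (tw q v) = tw q (tw p v)"
  by (rule eq_if_xi_eq) (simp add: ac_simps)

lemma tw_mem: "v \<in> V p \<Longrightarrow> tw q v \<in> V p"
  by (simp add: tw_part subspace_scale[OF subspace_part])

lemma tw_zero_parity [simp]: "tw 0 v = v"
  by (rule eq_if_xi_eq) auto


subsection \<open>Partial derivatives on the free algebra\<close>

text \<open>A letter rewritten in basis letters. It agrees with \<open>word [v]\<close> modulo
  linearity relations (\<open>letter_emb\<close>), but is linear in \<open>v\<close> on the
  nose.\<close>

definition emb :: "'g \<Rightarrow> ('k, 'g) free_alg" where
  "emb v = (\<Sum>i\<in>Ix. smul (xi i v) (word [X i]))"

lemma emb_linear: "Vector_Spaces.linear scale smul emb"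
  by (simp add: Vector_Spaces.linear_iff vector_space_axioms smul.vector_space_axioms emb_def
      smul.scale_left_distrib sum.distrib smul.scale_sum_right)

lemmas emb_add = module_hom.add[OF module_hom_linearI[OF emb_linear]]
  and emb_scale = module_hom.scale[OF module_hom_linearI[OF emb_linear]]
  and emb_sum = module_hom.sum[OF module_hom_linearI[OF emb_linear]]

lemma emb_basis: "i \<in> Ix \<Longrightarrow> emb (X i) = word [X i]"
  by (simp add: emb_def xi_basis if_distrib[of "\<lambda>c. smul c _"] cong: if_cong)

text \<open>
  Twisted letters are expanded in the basis, so that the derivatives satisfy the Weyl relations
  already in the free algebra, without passing to a quotient.
\<close>

fun der_word :: "nat \<Rightarrow> 'g list \<Rightarrow> ('k, 'g) free_alg" where
  "der_word i [] = 0"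
| "der_word i (v # w) = smul (xi i v) (word w) + emb (tw (par i) v) * der_word i w"

definition der :: "nat \<Rightarrow> ('k, 'g) free_alg \<Rightarrow> ('k, 'g) free_alg" where
  "der i = lin_ext smul (der_word i)"

lemma der_linear: "Vector_Spaces.linear smul smul (der i)"
  unfolding der_def by (rule linear_lin_ext) unfold_locales

lemmas der_add = module_hom.add[OF module_hom_linearI[OF der_linear]]
  and der_smul = module_hom.scale[OF module_hom_linearI[OF der_linear]]
  and der_diff = module_hom.diff[OF module_hom_linearI[OF der_linear]]
  and der_sum = module_hom.sum[OF module_hom_linearI[OF der_linear]]
  and der_zero = module_hom.zero[OF module_hom_linearI[OF der_linear]]

lemma der_word: "der i (word w) = der_word i w"
  by (simp add: der_def lin_ext_smul_word)

lemma der_one: "der i 1 = 0"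
  using der_word[of i "[]"] by (simp add: word_Nil)

lemma der_letter_mult: "der i (word [v] * f) = smul (xi i v) f + emb (tw (par i) v) * der i f"
proof (induction f rule: free_alg_induct)
  case (word w)
  then show ?case
    by (simp add: der_word flip: word_Cons)
qed (simp_all add: der_zero der_add der_smul smul_mult_right algebra_simps smul.scale_right_distrib mult.commute)

lemma emb_tw: "emb (tw q v) = (\<Sum>j\<in>Ix. smul (koszul q (par j) * xi j v) (word [X j]))"
  by (simp add: emb_def)

lemma der_emb_mult: "der i (emb v * f) = smul (xi i v) f + emb (tw (par i) v) * der i f" if i: "i \<in> Ix"
proof -
  have "der i (emb v * f) = (\<Sum>j\<in>Ix. smul (xi j v) (der i (word [X j] * f)))"
    by (simp add: emb_def sum_distrib_right smul_mult_left der_sum der_smul)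
  also have "\<dots> = (\<Sum>j\<in>Ix. smul (xi j v * xi i (X j)) f)
      + (\<Sum>j\<in>Ix. smul (xi j v) (emb (tw (par i) (X j)))) * der i f"
    by (simp add: der_letter_mult smul.scale_right_distrib sum.distrib sum_distrib_right smul_mult_left)
  also have "(\<Sum>j\<in>Ix. smul (xi j v) (emb (tw (par i) (X j)))) = emb (tw (par i) v)"
    by (simp add: emb_tw[of _ v] tw_part[OF basis_mem] emb_scale emb_basis mult.commute)
  also have "(\<Sum>j\<in>Ix. smul (xi j v * xi i (X j)) f) = smul (xi i v) f"
    using i by (simp add: xi_basis if_distrib[of "\<lambda>x. smul (_ * x) _"] cong: if_cong)
  finally show ?thesis .
qed

text \<open>In the expansion on a word \<open>v # w\<close> the two terms that differentiate
  \<open>v\<close> trade places when \<open>i\<close> and \<open>j\<close> are exchanged, and the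
  two twists of \<open>v\<close> commute.\<close>

lemma der_der:
  assumes "i \<in> Ix" "j \<in> Ix"
  shows "der i (der j f) = smul (koszul (par i) (par j)) (der j (der i f))"
proof (induction f rule: free_alg_induct)
  case (word w)
  show ?case
  proof (induction w)
    case Nil
    then show ?case
      by (simp only: der_word der_word.simps der_zero smul.scale_zero_right)
  next
    case (Cons v w)
    have exp: "der k (der l (word (v # w))) = smul (xi l v) (der k (word w))
        + smul (koszul (par k) (par l) * xi k v) (der l (word w))
        + emb (tw (par k) (tw (par l) v)) * der k (der l (word w))" if "k \<in> Ix" "l \<in> Ix" for k l
    proof -
      have "der l (word (v # w)) = smul (xi l v) (word w) + emb (tw (par l) v) * der l (word w)"
        using der_letter_mult[of l v "word w"] by (simp add: word_mult)
      then show ?thesis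
        using that by (simp add: der_emb_mult der_add der_smul koszul_commute[of "par l" "par k"])
    qed
    show ?case
      unfolding exp[OF assms] exp[OF assms(2,1)]
      by (simp add: Cons smul.scale_right_distrib smul_mult_right tw_tw[of "par i" "par j"]
          koszul_commute[of "par j" "par i"] flip: mult.assoc)
  qed
qed (simp_all add: der_zero der_add der_smul smul.scale_right_distrib mult.commute)

end


subsection \<open>Homogeneous elements\<close>

definition homog :: "nat \<Rightarrow> ('k::field, 'v) free_alg \<Rightarrow> bool" where
  "homog s f \<longleftrightarrow> (\<forall>w\<in>Poly_Mapping.keys f. length w = s)"

lemma homog_zero: "homog s 0"
  by (simp add: homog_def)

lemma homog_word: "homog s (word w) \<longleftrightarrow> length w = s"
  by (simp add: homog_def word_def)

lemma homog_add: "homog s f \<Longrightarrow> homog s g \<Longrightarrow> homog s (f + g)"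
  using keys_add[of f g] by (auto simp: homog_def)

lemma homog_smul: "homog s f \<Longrightarrow> homog s (smul c f)"
proof -
  have "Poly_Mapping.keys (smul c f) \<subseteq> Poly_Mapping.keys f"
    unfolding smul_def scalar_def using keys_mult[of "Poly_Mapping.single [] c" f]
    by (auto simp: plus_list_def split: if_splits)
  then show "homog s f \<Longrightarrow> homog s (smul c f)"
    by (auto simp: homog_def)
qed

lemma homog_sum: "(\<And>x. x \<in> A \<Longrightarrow> homog s (f x)) \<Longrightarrow> homog s (sum f A)"
  by (induction A rule: infinite_finite_induct) (auto intro: homog_zero homog_add)

lemma homog_mult: "homog s f \<Longrightarrow> homog t g \<Longrightarrow> homog (s + t) (f * g)"
  using keys_mult[of f g] by (auto simp: homog_def plus_list_def)

lemma homog_0_iff: "homog 0 f \<Longrightarrow> \<exists>c. f = smul c 1"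
proof -
  assume h: "homog 0 f"
  then have "Poly_Mapping.keys f \<subseteq> {[]}"
    by (auto simp: homog_def)
  then have "f = Poly_Mapping.single [] (Poly_Mapping.lookup f [])"
    by (intro poly_mapping_eqI) (auto simp: lookup_single when_def in_keys_iff)
  then show ?thesis
    by (metis smul_word word_Nil)
qed

lemma homog_linear_induct [consumes 1, case_names zero add smul word]:
  assumes "homog s f" and "P 0" "\<And>f g. P f \<Longrightarrow> P g \<Longrightarrow> P (f + g)"
    "\<And>c f. P f \<Longrightarrow> P (smul c f)" "\<And>w. length w = s \<Longrightarrow> P (word w)"
  shows "P f"
proof -
  have "P (\<Sum>w\<in>A. smul (Poly_Mapping.lookup f w) (word w))"
    if "finite A" "A \<subseteq> Poly_Mapping.keys f" for A
    using that by (induction A) (use assms in \<open>auto simp: homog_def\<close>)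
  from this[of "Poly_Mapping.keys f"] show ?thesis
    using free_alg_sum[of f] by simp
qed


context based_lie_superalgebra
begin

lemma homog_emb: "homog 1 (emb v)"
  unfolding emb_def by (intro homog_sum homog_smul) (simp add: homog_word)

lemma homog_emb_mult: "homog s f \<Longrightarrow> homog (Suc s) (emb v * f)"
  using homog_mult[OF homog_emb] by fastforce

lemma homog_der_word: "length w = Suc s \<Longrightarrow> homog s (der_word i w)"
proof (induction w arbitrary: s)
  case (Cons v w)
  then show ?case
  proof (cases s)
    case 0
    with Cons show ?thesis
      by (simp add: homog_zero homog_add homog_smul homog_word)
  next
    case (Suc t)
    with Cons show ?thesis
      by (simp add: homog_add homog_smul homog_word homog_emb_mult)
  qed
qed simp

lemma homog_der: "homog (Suc s) f \<Longrightarrow> homog s (der i f)"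
  by (induction f rule: homog_linear_induct)
     (simp_all add: der_zero der_add der_smul der_word homog_zero homog_add homog_smul homog_der_word)

lemma der_homog_0: "homog 0 f \<Longrightarrow> der i f = 0"
  by (auto dest!: homog_0_iff simp: der_smul der_one)


subsection \<open>Bilinear maps and contraction with the bracket\<close>

definition bilinear :: "('g \<Rightarrow> ('k, 'g) free_alg \<Rightarrow> ('k, 'g) free_alg) \<Rightarrow> bool" where
  "bilinear \<beta> \<longleftrightarrow> (\<forall>z f f'. \<beta> z (f + f') = \<beta> z f + \<beta> z f') \<and> (\<forall>z c f. \<beta> z (smul c f) = smul c (\<beta> z f)) \<and>
     (\<forall>z z' f. \<beta> (z + z') f = \<beta> z f + \<beta> z' f) \<and> (\<forall>z c f. \<beta> (scale c z) f = smul c (\<beta> z f))"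

lemma bilinearD:
  assumes "bilinear \<beta>"
  shows "\<beta> z (f + f') = \<beta> z f + \<beta> z f'" "\<beta> z (smul c f) = smul c (\<beta> z f)"
    "\<beta> (z + z') f = \<beta> z f + \<beta> z' f" "\<beta> (scale c z) f = smul c (\<beta> z f)"
    "\<beta> z 0 = 0" "\<beta> 0 f = 0" "\<beta> z (sum h A) = (\<Sum>x\<in>A. \<beta> z (h x))" "\<beta> (sum k A) f = (\<Sum>x\<in>A. \<beta> (k x) f)"
proof -
  show 1: "\<beta> z (f + f') = \<beta> z f + \<beta> z f'" and 2: "\<beta> z (smul c f) = smul c (\<beta> z f)"
    and 3: "\<beta> (z + z') f = \<beta> z f + \<beta> z' f" and 4: "\<beta> (scale c z) f = smul c (\<beta> z f)" for f f' z z' c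
    using assms by (auto simp: bilinear_def)
  show 5: "\<beta> z 0 = 0" using 2[of z 0 0] by simp
  show 6: "\<beta> 0 f = 0" using 4[of 0 0 f] by simp
  show "\<beta> z (sum h A) = (\<Sum>x\<in>A. \<beta> z (h x))"
    by (induction A rule: infinite_finite_induct) (auto simp: 1 5)
  show "\<beta> (sum k A) f = (\<Sum>x\<in>A. \<beta> (k x) f)"
    by (induction A rule: infinite_finite_induct) (auto simp: 3 6)
qed

text \<open>
  An element of \<open>g \<otimes> S(g)\<close> is only ever met through bilinear maps on it, so the operator \<open>T\<close> of the
  introduction is represented by \<open>\<beta> \<mapsto> \<beta> \<circ> T\<close>.
\<close>

definition contract :: "('g \<Rightarrow> ('k, 'g) free_alg \<Rightarrow> ('k, 'g) free_alg) \<Rightarrow> 'g \<Rightarrow> ('k, 'g) free_alg \<Rightarrow> ('k, 'g) free_alg"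
where "contract \<beta> z f = (\<Sum>i\<in>Ix. \<beta> (bracket z (X i)) (der i f))"

lemma bilinear_contract: "bilinear \<beta> \<Longrightarrow> bilinear (contract \<beta>)"
  unfolding bilinear_def[of "contract \<beta>"]
  by (simp add: contract_def der_add der_smul bilinearD bracket_add_left bracket_scale_left
      sum.distrib smul.scale_sum_right)

lemma bilinear_contract_pow: "bilinear \<beta> \<Longrightarrow> bilinear ((contract ^^ k) \<beta>)"
  by (induction k) (auto intro: bilinear_contract)

lemma contract_Suc: "(contract ^^ Suc k) \<beta> z f = (\<Sum>i\<in>Ix. (contract ^^ k) \<beta> (bracket z (X i)) (der i f))"
  by (simp add: contract_def)

text \<open>Every contraction differentiates once, so \<open>contract\<close> is locally nilpotent
  and power series in it are finite sums.\<close>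

lemma contract_pow_zero: "bilinear \<beta> \<Longrightarrow> homog s f \<Longrightarrow> s < k \<Longrightarrow> (contract ^^ k) \<beta> z f = 0"
proof (induction k arbitrary: s z f)
  case (Suc k)
  show ?case
  proof (cases s)
    case 0
    then show ?thesis
      using Suc.prems by (simp add: contract_Suc der_homog_0 bilinearD[OF bilinear_contract_pow] del: funpow.simps)
  next
    case (Suc t)
    then have "(contract ^^ k) \<beta> (bracket z (X i)) (der i f) = 0" for i
      using Suc.IH[of t "der i f"] Suc.prems homog_der by auto
    then show ?thesis
      by (simp add: contract_Suc del: funpow.simps)
  qed
qed simp

text \<open>\<open>contract\<close> changes the arguments of \<open>\<beta>\<close>, whereas
  \<open>h\<close> acts on its values.\<close>

lemma contract_commute_linear:
  assumes "Vector_Spaces.linear smul smul h"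
  shows "(contract ^^ k) (\<lambda>z f. h (\<beta> z f)) z f = h ((contract ^^ k) \<beta> z f)"
proof -
  interpret h: Vector_Spaces.linear smul smul h by fact
  show ?thesis
    by (induction k arbitrary: z f) (simp_all add: contract_def h.sum)
qed

text \<open>
  \<open>contract_series a \<beta>\<close> is the value at \<open>\<beta>\<close> of the power series with coefficients \<open>a\<close> in the locally
  nilpotent operator \<open>contract\<close>.
\<close>

definition contract_series :: "(nat \<Rightarrow> 'k) \<Rightarrow> ('g \<Rightarrow> ('k, 'g) free_alg \<Rightarrow> ('k, 'g) free_alg)
    \<Rightarrow> 'g \<Rightarrow> ('k, 'g) free_alg \<Rightarrow> ('k, 'g) free_alg" where
  "contract_series a \<beta> z = lin_ext smul (\<lambda>w. \<Sum>k\<le>length w. smul (a k) ((contract ^^ k) \<beta> z (word w)))"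

lemma contract_series_linear: "Vector_Spaces.linear smul smul (contract_series a \<beta> z)"
  unfolding contract_series_def by (rule linear_lin_ext) unfold_locales

lemmas contract_series_add = module_hom.add[OF module_hom_linearI[OF contract_series_linear]]
  and contract_series_smul = module_hom.scale[OF module_hom_linearI[OF contract_series_linear]]
  and contract_series_zero = module_hom.zero[OF module_hom_linearI[OF contract_series_linear]]

lemma contract_series_homog:
  assumes "bilinear \<beta>" "homog s f" "s \<le> N"
  shows "contract_series a \<beta> z f = (\<Sum>k\<le>N. smul (a k) ((contract ^^ k) \<beta> z f))"
  using assms(2)
proof (induction f rule: homog_linear_induct)
  case (word w)
  have "(\<Sum>k\<le>length w. smul (a k) ((contract ^^ k) \<beta> z (word w)))
      = (\<Sum>k\<le>N. smul (a k) ((contract ^^ k) \<beta> z (word w)))"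
    using assms word by (intro sum.mono_neutral_left) (auto simp: contract_pow_zero[where s = s] homog_word)
  then show ?case
    by (simp add: contract_series_def lin_ext_smul_word)
qed (simp_all add: contract_series_zero contract_series_add contract_series_smul bilinearD[OF bilinear_contract_pow[OF assms(1)]]
      smul.scale_right_distrib sum.distrib smul.scale_sum_right mult.commute)

lemma bilinear_contract_series: "bilinear \<beta> \<Longrightarrow> bilinear (contract_series a \<beta>)"
proof -
  assume b: "bilinear \<beta>"
  note bs = bilinearD[OF bilinear_contract_pow[OF b]]
  have "contract_series a \<beta> (z + z') f = contract_series a \<beta> z f + contract_series a \<beta> z' f" for z z' f
    by (induction f rule: free_alg_induct)
       (simp_all add: contract_series_zero contract_series_add contract_series_smul smul.scale_right_distrib add_ac
        contract_series_homog[OF b _ order.refl] homog_word bs sum.distrib)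
  moreover have "contract_series a \<beta> (scale c z) f = smul c (contract_series a \<beta> z f)" for c z f
    by (induction f rule: free_alg_induct)
       (simp_all add: contract_series_zero contract_series_add contract_series_smul smul.scale_right_distrib mult.commute
        contract_series_homog[OF b _ order.refl] homog_word bs smul.scale_sum_right)
  ultimately show "bilinear (contract_series a \<beta>)"
    by (simp add: bilinear_def contract_series_add contract_series_smul)
qed

text \<open>The bound \<open>N\<close> stays fixed while the degree \<open>s\<close> drops in the
  induction, so that all derivatives of \<open>f\<close> are summed over the same range.\<close>

lemma contract_contract_series:
  assumes "bilinear \<beta>" "homog s f" "s \<le> N"
  shows "(contract ^^ k) (contract_series a \<beta>) z f = (\<Sum>j\<le>N. smul (a j) ((contract ^^ (k + j)) \<beta> z f))"
  using assms(2,3)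
proof (induction k arbitrary: s z f)
  case 0
  then show ?case
    using contract_series_homog[OF assms(1) 0] by simp
next
  case (Suc k)
  show ?case
  proof (cases s)
    case 0
    with Suc.prems have "der i f = 0" for i
      using der_homog_0 by auto
    then show ?thesis
      by (simp add: contract_Suc bilinearD[OF bilinear_contract_pow[OF bilinear_contract_series[OF assms(1)]]]
           bilinearD[OF bilinear_contract_pow[OF assms(1)]] del: funpow.simps)
  next
    case (Suc t)
    have "(contract ^^ Suc k) (contract_series a \<beta>) z f
      = (\<Sum>i\<in>Ix. \<Sum>j\<le>N. smul (a j) ((contract ^^ (k + j)) \<beta> (bracket z (X i)) (der i f)))"
      unfolding contract_Suc using Suc Suc.prems homog_der by (intro sum.cong Suc.IH[of t]) auto
    also have "\<dots> = (\<Sum>j\<le>N. smul (a j) ((contract ^^ Suc (k + j)) \<beta> z f))"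
      by (subst sum.swap) (simp add: contract_Suc smul.scale_sum_right del: funpow.simps)
    finally show ?thesis by simp
  qed
qed

lemma sum_triangle:
  fixes h :: "nat \<Rightarrow> nat \<Rightarrow> 'b::comm_monoid_add"
  assumes "\<And>i j. N < i + j \<Longrightarrow> h i j = 0"
  shows "(\<Sum>i\<le>N. \<Sum>j\<le>N. h i j) = (\<Sum>k\<le>N. \<Sum>i\<le>k. h i (k - i))"
proof -
  have "(\<Sum>i\<le>N. \<Sum>j\<le>N. h i j) = sum (case_prod h) ({..N} \<times> {..N})"
    by (simp add: sum.cartesian_product)
  also have "\<dots> = sum (case_prod h) {(i, j). i + j \<le> N}"
    using assms by (intro sum.mono_neutral_right) (auto simp: not_le, meson not_le)
  also have "\<dots> = (\<Sum>k\<le>N. \<Sum>i\<le>k. h i (k - i))"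
    by (rule sum.triangle_reindex_eq)
  finally show ?thesis .
qed

text \<open>Power series in one operator compose by the Cauchy product of their coefficients, and
  \<open>ac\<close> says that this product is 1.\<close>

lemma contract_series_contract_series:
  assumes "bilinear \<beta>" and ac: "\<And>k. (\<Sum>i\<le>k. a i * c (k - i)) = (if k = 0 then 1 else 0)"
  shows "contract_series a (contract_series c \<beta>) z f = \<beta> z f"
proof (induction f rule: free_alg_induct)
  case (word w)
  let ?N = "length w"
  have "contract_series a (contract_series c \<beta>) z (word w)
      = (\<Sum>k\<le>?N. \<Sum>j\<le>?N. smul (a k * c j) ((contract ^^ (k + j)) \<beta> z (word w)))"
    using assms(1) by (simp add: contract_series_homog[OF bilinear_contract_series, of _ ?N _ ?N] contract_contract_series[of _ ?N _ ?N] homog_word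
        smul.scale_sum_right)
  also have "\<dots> = (\<Sum>k\<le>?N. \<Sum>i\<le>k. smul (a i * c (k - i)) ((contract ^^ (i + (k - i))) \<beta> z (word w)))"
    using assms(1) by (intro sum_triangle) (simp add: contract_pow_zero[where s = ?N] homog_word)
  also have "\<dots> = (\<Sum>k\<le>?N. smul (\<Sum>i\<le>k. a i * c (k - i)) ((contract ^^ k) \<beta> z (word w)))"
    by (simp add: smul.scale_sum_left)
  also have "\<dots> = \<beta> z (word w)"
    by (simp add: ac if_distrib[of "\<lambda>x. smul x _"] cong: if_cong)
  finally show ?case .
qed (simp_all add: contract_series_zero contract_series_add contract_series_smul bilinearD[OF assms(1)])

lemma contract_series_commute_linear:
  assumes h: "Vector_Spaces.linear smul smul h" and b: "bilinear \<beta>"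
  shows "contract_series a (\<lambda>z f. h (\<beta> z f)) z f = h (contract_series a \<beta> z f)"
proof (rule linear_eq_on_words[where sc = smul and L' = "\<lambda>f. h (contract_series a \<beta> z f)"])
  interpret h: Vector_Spaces.linear smul smul h by fact
  show "Vector_Spaces.linear smul smul (\<lambda>f. h (contract_series a \<beta> z f))"
    using Vector_Spaces.linear_compose[OF contract_series_linear h] by (simp add: o_def)
  show "contract_series a (\<lambda>z f. h (\<beta> z f)) z (word w) = h (contract_series a \<beta> z (word w))" for w
    using b by (simp add: contract_series_homog[OF b, where s = "length w" and N = "length w"] homog_word h.sum h.scale
       contract_series_def lin_ext_smul_word contract_commute_linear[OF h])
qed (rule contract_series_linear)

text \<open>Values of \<open>\<beta>\<close> are merely summed, while the derivatives act inside, on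
  \<open>f\<close>. Hence \<open>J\<close> may be \<open>env_ideal\<close>, which the derivatives do
  not respect in general.\<close>

lemma contract_cong:
  assumes J: "two_sided_ideal J" and "\<And>z f. \<beta> z f - \<beta>' z f \<in> J"
  shows "(contract ^^ k) \<beta> z f - (contract ^^ k) \<beta>' z f \<in> J"
  using assms(2)
proof (induction k arbitrary: \<beta> \<beta>' z f)
  case (Suc k)
  have "contract \<beta> z f - contract \<beta>' z f \<in> J" for z f
    unfolding contract_def by (rule two_sided_ideal.cong_sum[OF J]) (rule Suc.prems)
  then show ?case
    by (simp add: funpow_Suc_right Suc.IH del: funpow.simps)
qed (simp add: two_sided_ideal.zero_mem[OF J])

lemma contract_series_cong:
  assumes J: "two_sided_ideal J" and c: "\<And>z f. \<beta> z f - \<beta>' z f \<in> J"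
  shows "contract_series a \<beta> z f - contract_series a \<beta>' z f \<in> J"
proof (induction f rule: free_alg_induct)
  interpret two_sided_ideal J by fact
  {
    case zero
    then show ?case by (simp add: contract_series_zero zero_mem)
  next
    case (add f g)
    then show ?case using cong_add by (simp add: contract_series_add)
  next
    case (smul c f)
    then show ?case by (simp add: contract_series_smul two_sided_smul_cong[OF J])
  next
    case (word w)
    show ?case
      by (simp add: contract_series_def lin_ext_smul_word)
         (intro cong_sum two_sided_smul_cong[OF J] contract_cong J c)
  }
qed


subsection \<open>The defining ideals\<close>

definition lin_ideal :: "('k, 'g) free_alg set" where
  "lin_ideal = gen_ideal (linearity_relations scale UNIV)"

definition sym_ideal :: "('k, 'g) free_alg set" where
  "sym_ideal = gen_ideal (linearity_relations scale UNIV \<union> sym_relations V)"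

definition env_ideal :: "('k, 'g) free_alg set" where
  "env_ideal = gen_ideal (linearity_relations scale UNIV \<union> env_relations V bracket)"

sublocale lin: two_sided_ideal lin_ideal
  unfolding lin_ideal_def by (rule two_sided_ideal_gen_ideal)

sublocale sym: two_sided_ideal sym_ideal
  unfolding sym_ideal_def by (rule two_sided_ideal_gen_ideal)

sublocale env: two_sided_ideal env_ideal
  unfolding env_ideal_def by (rule two_sided_ideal_gen_ideal)

lemma lin_subset_sym: "lin_ideal \<subseteq> sym_ideal" and lin_subset_env: "lin_ideal \<subseteq> env_ideal"
  by (auto simp: lin_ideal_def sym_ideal_def env_ideal_def dest: gen_ideal_mono[THEN subsetD, rotated])

lemmas lin_smul_cong = two_sided_smul_cong[OF lin.two_sided_ideal_axioms]
  and sym_smul_cong = two_sided_smul_cong[OF sym.two_sided_ideal_axioms]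
  and env_smul_cong = two_sided_smul_cong[OF env.two_sided_ideal_axioms]

lemma letter_add: "word [u + v] - (word [u] + word [v]) \<in> lin_ideal"
proof -
  have "word [u + v] - word [u] - word [v] \<in> linearity_relations scale UNIV"
    unfolding linearity_relations_def by blast
  then show ?thesis
    by (auto simp: lin_ideal_def diff_diff_add intro: gen_ideal.gen)
qed

lemma letter_scale: "word [scale c v] - smul c (word [v]) \<in> lin_ideal"
proof -
  have "word [scale c v] - scalar c * word [v] \<in> linearity_relations scale UNIV"
    unfolding linearity_relations_def by blast
  then show ?thesis
    by (auto simp: lin_ideal_def smul_def intro: gen_ideal.gen)
qed

lemma letter_zero: "word [0] \<in> lin_ideal"
  using letter_scale[of 0 0] by simp

lemma letter_sum: "finite A \<Longrightarrow> word [sum f A] - (\<Sum>x\<in>A. word [f x]) \<in> lin_ideal"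
proof (induction A rule: finite_induct)
  case (insert x A)
  have "word [f x + sum f A] - (word [f x] + word [sum f A]) \<in> lin_ideal"
    by (rule letter_add)
  also have "word [f x] + word [sum f A] - (word [f x] + (\<Sum>x\<in>A. word [f x])) \<in> lin_ideal"
    by (intro lin.cong_add lin.cong_refl insert.IH)
  finally show ?case
    using insert by simp
qed (simp add: letter_zero)

lemma letter_emb: "word [v] - emb v \<in> lin_ideal"
proof -
  have "word [v] - (\<Sum>i\<in>Ix. word [scale (xi i v) (X i)]) \<in> lin_ideal"
    using letter_sum[OF finite_Ix, of "\<lambda>i. scale (xi i v) (X i)"] basis_expansion[of v] by simp
  also have "(\<Sum>i\<in>Ix. word [scale (xi i v) (X i)]) - (\<Sum>i\<in>Ix. smul (xi i v) (word [X i])) \<in> lin_ideal"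
    by (intro lin.cong_sum letter_scale)
  finally show ?thesis
    by (simp add: emb_def)
qed

lemma letters_super_commute:
  "u \<in> V p \<Longrightarrow> v \<in> V q \<Longrightarrow> word [u] * word [v] - smul (koszul p q) (word [v] * word [u]) \<in> sym_ideal"
  unfolding sym_ideal_def smul_def by (rule gen_ideal.gen) (auto simp: sym_relations_def)

lemma letters_env_commute:
  assumes "u \<in> V p" "v \<in> V q"
  shows "word [u] * word [v] - smul (koszul p q) (word [v] * word [u]) - word [bracket u v] \<in> env_ideal"
  unfolding env_ideal_def smul_def
  by (rule gen_ideal.gen) (use assms in \<open>auto simp: env_relations_def\<close>)

lemma basis_letter_commute:
  assumes i: "i \<in> Ix"
  shows "word [X i] * emb (tw (par i) v) - emb v * word [X i] \<in> sym_ideal"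
proof -
  have "word [X i] * emb (tw (par i) v)
      = (\<Sum>j\<in>Ix. smul (koszul (par i) (par j) * xi j v) (word [X i] * word [X j]))"
    by (simp add: emb_tw sum_distrib_left smul_mult_right)
  also have "\<dots> - (\<Sum>j\<in>Ix. smul (koszul (par i) (par j) * xi j v)
      (smul (koszul (par i) (par j)) (word [X j] * word [X i]))) \<in> sym_ideal"
    by (intro sym.cong_sum sym_smul_cong letters_super_commute basis_mem i)
  also have "(\<Sum>j\<in>Ix. smul (koszul (par i) (par j) * xi j v)
      (smul (koszul (par i) (par j)) (word [X j] * word [X i]))) = emb v * word [X i]"
    by (simp add: emb_def sum_distrib_right smul_mult_left ac_simps)
  finally show ?thesis .
qed

lemma emb_commute:
  "emb z * emb z' - (emb (pr 0 z') * emb z + emb (pr 1 z') * emb (tw 1 z)) \<in> sym_ideal"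
proof -
  have "emb z * emb z' = (\<Sum>i\<in>Ix. smul (xi i z') (emb z * word [X i]))"
    by (simp add: emb_def[of z'] sum_distrib_left smul_mult_right)
  also have "\<dots> - (\<Sum>i\<in>Ix. smul (xi i z') (word [X i] * emb (tw (par i) z))) \<in> sym_ideal"
    by (intro sym.cong_sum sym_smul_cong sym.cong_sym[OF basis_letter_commute])
  also have "(\<Sum>i\<in>Ix. smul (xi i z') (word [X i] * emb (tw (par i) z)))
      = (\<Sum>i\<in>Ix. smul (xi i (pr 0 z')) (word [X i]) * emb z + smul (xi i (pr 1 z')) (word [X i]) * emb (tw 1 z))"
  proof (intro sum.cong refl)
    fix i assume i: "i \<in> Ix"
    show "smul (xi i z') (word [X i] * emb (tw (par i) z))
      = smul (xi i (pr 0 z')) (word [X i]) * emb z + smul (xi i (pr 1 z')) (word [X i]) * emb (tw 1 z)"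
      using i by (cases "par i") (simp_all add: smul_mult_left)
  qed
  also have "\<dots> = emb (pr 0 z') * emb z + emb (pr 1 z') * emb (tw 1 z)"
    by (simp add: sum.distrib emb_def[of "pr _ _"] sum_distrib_right)
  finally show ?thesis .
qed

lemma env_commute:
  assumes i: "i \<in> Ix"
  shows "emb z * word [X i] - word [X i] * emb (tw (par i) z) - emb (bracket z (X i)) \<in> env_ideal"
proof -
  let ?b = "\<lambda>j. bracket (X j) (X i)"
  let ?k = "\<lambda>j. koszul (par i) (par j)"
  have "emb z * word [X i] - word [X i] * emb (tw (par i) z)
      = (\<Sum>j\<in>Ix. smul (xi j z) (word [X j] * word [X i] - smul (?k j) (word [X i] * word [X j])))"
    by (simp add: emb_tw emb_def[of z] sum_distrib_left sum_distrib_right smul_mult_left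
        smul_mult_right sum_subtractf smul.scale_right_diff_distrib mult.commute)
  also have "\<dots> - (\<Sum>j\<in>Ix. smul (xi j z) (emb (?b j))) \<in> env_ideal"
  proof (intro env.cong_sum env_smul_cong)
    fix j assume j: "j \<in> Ix"
    have "word [X j] * word [X i] - smul (?k j) (word [X i] * word [X j]) - word [?b j] \<in> env_ideal"
      using letters_env_commute[OF basis_mem[OF j] basis_mem[OF i]] by (simp add: koszul_commute[of "par i"])
    also have "word [?b j] - emb (?b j) \<in> env_ideal"
      using letter_emb lin_subset_env by blast
    finally show "word [X j] * word [X i] - smul (?k j) (word [X i] * word [X j]) - emb (?b j) \<in> env_ideal" .
  qed
  also have "(\<Sum>j\<in>Ix. smul (xi j z) (emb (?b j))) = emb (bracket z (X i))"
  proof -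
    interpret L: Vector_Spaces.linear scale scale "\<lambda>z. bracket z (X i)"
      by (rule bracket_linear_left)
    show ?thesis
      by (subst (3) basis_expansion) (simp add: L.sum L.scale emb_sum emb_scale)
  qed
  finally show ?thesis .
qed

text \<open>Induction on the word. Differentiating the first letter \<open>v\<close> gives back
  \<open>emb v\<close>; in the other term \<open>X i\<close> is moved to the right of the twisted
  letter by \<open>basis_letter_commute\<close>, which removes the twist and leaves the formula for
  the rest of the word.\<close>

lemma euler:
  assumes "homog s f"
  shows "(\<Sum>i\<in>Ix. word [X i] * der i f) - smul (of_nat s) f \<in> sym_ideal"
  using assms
proof (induction f rule: homog_linear_induct)
  case zero
  then show ?case by (simp add: der_zero sym.zero_mem)
next
  case (add f g)
  then show ?case
    using sym.cong_add[OF add] by (simp add: der_add distrib_left sum.distrib smul.scale_right_distrib)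
next
  case (smul c f)
  then show ?case
    using sym_smul_cong[OF smul, of c]
    by (simp add: der_smul smul_mult_right smul.scale_sum_right mult.commute)
next
  case (word w)
  show ?case
    using word
  proof (induction w arbitrary: s)
    case Nil
    then show ?case by (simp add: der_word sym.zero_mem)
  next
    case (Cons v w)
    have "(\<Sum>i\<in>Ix. word [X i] * der i (word (v # w)))
        = emb v * word w + (\<Sum>i\<in>Ix. word [X i] * emb (tw (par i) v) * der i (word w))"
      by (simp add: der_word emb_def distrib_left sum.distrib smul_mult_right smul_mult_left
          sum_distrib_right mult.assoc)
    also have "\<dots> - (emb v * word w + (\<Sum>i\<in>Ix. emb v * word [X i] * der i (word w))) \<in> sym_ideal"
      by (intro sym.cong_add sym.cong_sum sym.cong_mult_right sym.cong_refl basis_letter_commute)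
    also have "emb v * word w + (\<Sum>i\<in>Ix. emb v * word [X i] * der i (word w))
        = emb v * (word w + (\<Sum>i\<in>Ix. word [X i] * der i (word w)))"
      by (simp add: distrib_left sum_distrib_left mult.assoc)
    also have "\<dots> - word [v] * (word w + smul (of_nat (length w)) (word w)) \<in> sym_ideal"
      using lin_subset_sym sym.cong_sym[of "word [v]" "emb v"] letter_emb
      by (intro sym.cong_mult sym.cong_add sym.cong_refl Cons.IH) auto
    also have "word [v] * (word w + smul (of_nat (length w)) (word w)) = smul (of_nat s) (word (v # w))"
      using Cons.prems by (simp add: distrib_left smul_mult_right word_mult
          smul.scale_left_distrib flip: Cons.prems)
    finally show ?case .
  qed
qed


subsection \<open>Symmetrisation by Euler's formula\<close>

text \<open>Euler's formula read as a definition: each basis vector in turn becomes the first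
  letter. Modulo \<open>lin_ideal\<close> this is the signed average over permutations, by
  \<open>word_sym_euler_sym\<close> and \<open>word_sym_sorted\<close>.\<close>

primrec euler_sym :: "nat \<Rightarrow> ('k, 'g) free_alg \<Rightarrow> ('k, 'g) free_alg" where
  "euler_sym 0 f = f"
| "euler_sym (Suc s) f = smul (1 / of_nat (Suc s)) (\<Sum>i\<in>Ix. word [X i] * euler_sym s (der i f))"

lemma euler_sym_linear: "euler_sym s (f + g) = euler_sym s f + euler_sym s g" "euler_sym s (smul c f) = smul c (euler_sym s f)"
  by (induction s arbitrary: f g c)
     (simp_all add: der_add der_smul distrib_left sum.distrib smul.scale_right_distrib
      smul_mult_right mult.commute flip: smul.scale_sum_right)

definition symmetrise :: "('k, 'g) free_alg \<Rightarrow> ('k, 'g) free_alg" where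
  "symmetrise = lin_ext smul (\<lambda>w. euler_sym (length w) (word w))"

lemma symmetrise_linear: "Vector_Spaces.linear smul smul symmetrise"
  unfolding symmetrise_def by (rule linear_lin_ext) unfold_locales

lemmas symmetrise_add = module_hom.add[OF module_hom_linearI[OF symmetrise_linear]]
  and symmetrise_smul = module_hom.scale[OF module_hom_linearI[OF symmetrise_linear]]
  and symmetrise_diff = module_hom.diff[OF module_hom_linearI[OF symmetrise_linear]]
  and symmetrise_zero = module_hom.zero[OF module_hom_linearI[OF symmetrise_linear]]

lemma symmetrise_word: "symmetrise (word w) = euler_sym (length w) (word w)"
  by (simp add: symmetrise_def lin_ext_smul_word)

lemma symmetrise_homog: "homog s f \<Longrightarrow> symmetrise f = euler_sym s f"
proof (induction f rule: homog_linear_induct)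
  case zero
  then show ?case using euler_sym_linear(2)[of s 0 0] by (simp add: symmetrise_zero)
qed (simp_all add: symmetrise_add symmetrise_smul euler_sym_linear symmetrise_word)

lemma symmetrise_homog_0: "homog 0 f \<Longrightarrow> symmetrise f = f"
  by (simp add: symmetrise_homog)

lemma symmetrise_recursion:
  assumes "homog s f"
  shows "(\<Sum>i\<in>Ix. word [X i] * symmetrise (der i f)) = smul (of_nat s) (symmetrise f)"
proof (cases s)
  case 0
  with assms show ?thesis
    by (simp add: der_homog_0 symmetrise_zero)
next
  case (Suc t)
  with assms have "symmetrise (der i f) = euler_sym t (der i f)" for i
    by (simp add: symmetrise_homog homog_der)
  then have "smul (of_nat s) (symmetrise f) = smul (of_nat s / of_nat (Suc t)) (\<Sum>i\<in>Ix. word [X i] * symmetrise (der i f))"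
    using assms Suc by (simp add: symmetrise_homog[of s])
  moreover have "of_nat s / of_nat (Suc t) = (1::'k)"
    unfolding Suc by (rule divide_self) (simp add: of_nat_neq_0 del: of_nat_Suc)
  ultimately show ?thesis by simp
qed

text \<open>With \<open>emb z\<close> in place of \<open>word [z]\<close>, multiplication is exactly
  bilinear.\<close>

definition left_mul :: "'g \<Rightarrow> ('k, 'g) free_alg \<Rightarrow> ('k, 'g) free_alg" where
  "left_mul z f = emb z * f"

lemma bilinear_left_mul: "bilinear left_mul"
  by (simp add: bilinear_def left_mul_def emb_add emb_scale distrib_left distrib_right smul_mult_left smul_mult_right)

lemma bilinear_left_mul_symmetrise: "bilinear (\<lambda>z f. left_mul z (symmetrise f))"
  by (simp add: bilinear_def symmetrise_add symmetrise_smul bilinearD[OF bilinear_left_mul])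

abbreviation contract_sym :: "nat \<Rightarrow> 'g \<Rightarrow> ('k, 'g) free_alg \<Rightarrow> ('k, 'g) free_alg" where
  "contract_sym k \<equiv> (contract ^^ k) (\<lambda>z f. left_mul z (symmetrise f))"

lemmas bilinear_contract_sym = bilinear_contract_pow[OF bilinear_left_mul_symmetrise]

text \<open>\<open>env_commute\<close> moves \<open>X i\<close> to the right of \<open>z\<close> at
  the price of one more contraction, and \<open>symmetrise_recursion\<close> evaluates the remaining
  sum. Each of the \<open>k\<close> contractions has lowered the degree by one, hence the factor
  \<open>s - k\<close>.\<close>

lemma left_mult_contract_sym:
  assumes "homog s f"
  shows "(\<Sum>i\<in>Ix. word [X i] * contract_sym k (tw (par i) z) (der i f))
    - (smul (of_nat s - of_nat k) (contract_sym k z f) - contract_sym (Suc k) z f) \<in> env_ideal"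
  using assms
proof (induction k arbitrary: s z f)
  case 0
  have "(\<Sum>i\<in>Ix. word [X i] * contract_sym 0 (tw (par i) z) (der i f))
      = (\<Sum>i\<in>Ix. (word [X i] * emb (tw (par i) z)) * symmetrise (der i f))"
    by (simp add: left_mul_def mult.assoc)
  also have "\<dots> - (\<Sum>i\<in>Ix. (emb z * word [X i] - emb (bracket z (X i))) * symmetrise (der i f)) \<in> env_ideal"
  proof (intro env.cong_sum env.cong_mult_right)
    fix i assume i: "i \<in> Ix"
    show "word [X i] * emb (tw (par i) z) - (emb z * word [X i] - emb (bracket z (X i))) \<in> env_ideal"
      using env.neg_mem[OF env_commute[OF i, of z]] by (simp add: algebra_simps)
  qed
  also have "(\<Sum>i\<in>Ix. (emb z * word [X i] - emb (bracket z (X i))) * symmetrise (der i f))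
      = emb z * (\<Sum>i\<in>Ix. word [X i] * symmetrise (der i f)) - contract_sym (Suc 0) z f"
    by (simp add: contract_def left_mul_def left_diff_distrib sum_subtractf sum_distrib_left mult.assoc)
  also have "\<dots> = smul (of_nat s - of_nat 0) (contract_sym 0 z f) - contract_sym (Suc 0) z f"
    by (simp add: symmetrise_recursion[OF 0] left_mul_def smul_mult_right)
  finally show ?case .
next
  case (Suc k)
  show ?case
  proof (cases s)
    case 0
    with Suc.prems have "der i f = 0" for i
      by (simp add: der_homog_0)
    then show ?thesis
      by (simp add: bilinearD[OF bilinear_contract_sym] contract_Suc[of "Suc k"] contract_Suc[of k] env.zero_mem del: funpow.simps)
  next
    case (Suc t)
    have "(\<Sum>i\<in>Ix. word [X i] * contract_sym (Suc k) (tw (par i) z) (der i f))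
        = (\<Sum>j\<in>Ix. \<Sum>i\<in>Ix. word [X i] * contract_sym k (tw (par i) (bracket z (X j))) (der i (der j f)))"
    proof (subst sum.swap, unfold contract_Suc sum_distrib_left, intro sum.cong refl)
      fix i j assume ij: "i \<in> Ix" "j \<in> Ix"
      show "word [X i] * contract_sym k (bracket (tw (par i) z) (X j)) (der j (der i f))
          = word [X i] * contract_sym k (tw (par i) (bracket z (X j))) (der i (der j f))"
        by (simp add: bracket_tw[OF ij(2)] der_der[OF ij] bilinearD[OF bilinear_contract_sym])
    qed
    also have "\<dots> - (\<Sum>j\<in>Ix. smul (of_nat t - of_nat k) (contract_sym k (bracket z (X j)) (der j f))
        - contract_sym (Suc k) (bracket z (X j)) (der j f)) \<in> env_ideal"
      using Suc Suc.prems by (intro env.cong_sum Suc.IH homog_der) auto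
    also have "(\<Sum>j\<in>Ix. smul (of_nat t - of_nat k) (contract_sym k (bracket z (X j)) (der j f))
        - contract_sym (Suc k) (bracket z (X j)) (der j f))
        = smul (of_nat s - of_nat (Suc k)) (contract_sym (Suc k) z f) - contract_sym (Suc (Suc k)) z f"
      unfolding contract_Suc[of "Suc k"] contract_Suc[of k _ z] by (simp add: sum_subtractf smul.scale_sum_right Suc)
    finally show ?thesis .
  qed
qed

text \<open>The Taylor coefficients of \<open>(1 - exp(-t)) / t\<close>.\<close>

definition acoef :: "nat \<Rightarrow> 'k" where "acoef k = (- 1) ^ k / fact (Suc k)"

text \<open>The Taylor coefficients of \<open>t / (1 - exp(-t))\<close>.\<close>

definition ccoef :: "nat \<Rightarrow> 'k" where "ccoef k = (- 1) ^ k * bernoulli k / fact k"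

lemma acoef_0 [simp]: "acoef 0 = 1"
  by (simp add: acoef_def)

text \<open>This is the recursion that makes the surplus terms telescope in
  \<open>symmetrise_left_mul_homog\<close>, and so the origin of the coefficients.\<close>

lemma acoef_Suc: "of_nat (k + 2) * acoef (Suc k) = - acoef k"
proof -
  have "(of_nat (k + 2) :: 'k) \<noteq> 0"
    by (metis add_2_eq_Suc' of_nat_neq_0)
  moreover have "fact (Suc (Suc k)) = of_nat (k + 2) * (fact (Suc k) :: 'k)"
    by simp
  ultimately show ?thesis
    unfolding acoef_def by (simp del: fact_Suc of_nat_add)
qed

text \<open>Euler's formula for the product \<open>z f\<close>: the Leibniz rule yields
  \<open>z \<sigma>(f)\<close> and a sum over \<open>X i\<close> to which the induction hypothesis
  and then \<open>left_mult_contract_sym\<close> apply.\<close>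

lemma symmetrise_left_mul_homog:
  assumes "homog s f" "s \<le> N"
  shows "symmetrise (left_mul z f) - (\<Sum>k\<le>N. smul (acoef k) (contract_sym k z f)) \<in> env_ideal"
  using assms
proof (induction s arbitrary: z f)
  case (0 z f)
  have "(\<Sum>k\<le>N. smul (acoef k) (contract_sym k z f)) = (\<Sum>k\<in>{0}. smul (acoef k) (contract_sym k z f))"
    using 0 by (intro sum.mono_neutral_right) (auto simp: contract_pow_zero[OF bilinear_left_mul_symmetrise 0(1)])
  then show ?case
    using symmetrise_recursion[OF homog_emb_mult[OF 0(1), of z]] 0
    by (simp add: left_mul_def der_emb_mult der_homog_0 symmetrise_smul symmetrise_homog_0 smul_mult_right env.zero_mem
        flip: smul_mult_left sum_distrib_right emb_def)
next
  case (Suc s z f)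
  let ?S = "Suc s"
  \<comment> \<open>The degree of \<open>left_mul z f\<close>, one more than the degree
    \<open>?S\<close> of \<open>f\<close>.\<close>
  let ?c = "of_nat (Suc ?S) :: 'k"
  have "smul ?c (symmetrise (left_mul z f)) = (\<Sum>i\<in>Ix. word [X i] * symmetrise (der i (left_mul z f)))"
    using symmetrise_recursion[OF homog_emb_mult[OF Suc.prems(1), of z]] by (simp add: left_mul_def)
  also have "\<dots> = left_mul z (symmetrise f) + (\<Sum>i\<in>Ix. word [X i] * symmetrise (left_mul (tw (par i) z) (der i f)))"
  proof -
    have "(\<Sum>i\<in>Ix. word [X i] * smul (xi i z) (symmetrise f)) = left_mul z (symmetrise f)"
      by (simp add: left_mul_def emb_def sum_distrib_right smul_mult_left smul_mult_right)
    then show ?thesis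
      by (simp add: left_mul_def der_emb_mult symmetrise_add symmetrise_smul distrib_left sum.distrib)
  qed
  also have "\<dots> - (left_mul z (symmetrise f) + (\<Sum>i\<in>Ix. word [X i] * (\<Sum>k\<le>N. smul (acoef k) (contract_sym k (tw (par i) z) (der i f)))))
      \<in> env_ideal"
    using Suc.prems by (intro env.cong_add env.cong_refl env.cong_sum env.cong_mult_left Suc.IH homog_der) auto
  also have "left_mul z (symmetrise f) + (\<Sum>i\<in>Ix. word [X i] * (\<Sum>k\<le>N. smul (acoef k) (contract_sym k (tw (par i) z) (der i f))))
      = left_mul z (symmetrise f) + (\<Sum>k\<le>N. smul (acoef k) (\<Sum>i\<in>Ix. word [X i] * contract_sym k (tw (par i) z) (der i f)))"
    by (simp add: sum_distrib_left smul_mult_right smul.scale_sum_right) (rule sum.swap)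
  also have "\<dots> - (left_mul z (symmetrise f) + (\<Sum>k\<le>N. smul (acoef k) (smul (of_nat ?S - of_nat k) (contract_sym k z f) - contract_sym (Suc k) z f)))
      \<in> env_ideal"
    by (intro env.cong_add env.cong_refl env.cong_sum env_smul_cong left_mult_contract_sym Suc.prems)
  also have "left_mul z (symmetrise f) + (\<Sum>k\<le>N. smul (acoef k) (smul (of_nat ?S - of_nat k) (contract_sym k z f) - contract_sym (Suc k) z f))
      = (\<Sum>k\<le>N. smul ?c (smul (acoef k) (contract_sym k z f)))"
  proof -
    \<comment> \<open>Write \<open>S - k\<close> as \<open>(S + 1) - (k + 1)\<close> and replace
      \<open>- a_k\<close> by \<open>(k + 2) a_(k+1)\<close>: what remains beside the wanted term is
      a telescoping difference.\<close>
    have 1: "smul (acoef k) (smul (of_nat ?S - of_nat k) (contract_sym k z f) - contract_sym (Suc k) z f)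
        = smul ?c (smul (acoef k) (contract_sym k z f)) - (smul (of_nat (Suc k) * acoef k) (contract_sym k z f)
            - smul (of_nat (k + 2) * acoef (Suc k)) (contract_sym (Suc k) z f))" for k
    proof -
      have "acoef k * (of_nat ?S - of_nat k) = ?c * acoef k - of_nat (Suc k) * acoef k"
        by (simp add: algebra_simps)
      then have "smul (acoef k * (of_nat ?S - of_nat k)) (contract_sym k z f)
          = smul (?c * acoef k) (contract_sym k z f) - smul (of_nat (Suc k) * acoef k) (contract_sym k z f)"
        by (simp only: smul.scale_left_diff_distrib)
      then show ?thesis
        unfolding acoef_Suc by (simp add: smul.scale_right_diff_distrib del: of_nat_Suc)
    qed
    \<comment> \<open>The lower end is the summand \<open>z \<sigma>(f)\<close> that is to be
      cancelled; the upper end has \<open>N + 1\<close> contractions, more than the degree of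
      \<open>f\<close>, and vanishes.\<close>
    have 2: "(\<Sum>k\<le>N. smul (of_nat (Suc k) * acoef k) (contract_sym k z f)
            - smul (of_nat (k + 2) * acoef (Suc k)) (contract_sym (Suc k) z f)) = left_mul z (symmetrise f)"
      using sum_telescope[of "\<lambda>k. smul (of_nat (Suc k) * acoef k) (contract_sym k z f)" N]
        contract_pow_zero[OF bilinear_left_mul_symmetrise Suc.prems(1), of "Suc N" z] Suc.prems(2) by simp
    show ?thesis
      unfolding 1 by (subst sum_subtractf) (simp only: 2, simp)
  qed
  finally have "smul (1 / ?c) (smul ?c (symmetrise (left_mul z f))) - smul (1 / ?c) (\<Sum>k\<le>N. smul ?c (smul (acoef k) (contract_sym k z f))) \<in> env_ideal"
    by (rule env_smul_cong)
  moreover have "?c \<noteq> 0" by (rule of_nat_neq_0)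
  ultimately show ?case
    by (simp add: smul.scale_sum_right del: of_nat_Suc)
qed

subsection \<open>The action on the symmetric algebra\<close>

text \<open>The defining recursion with \<open>B_k\<close> moved to the other side. The case
  \<open>k = 1\<close> is separate because \<open>B_1\<close> is prescribed as a value.\<close>

lemma bernoulli_recursion:
  "k > 0 \<Longrightarrow> (\<Sum>i\<le>k. of_nat (k choose i) * (bernoulli i / of_nat (k - i + 1)) :: 'k) = 0"
proof -
  assume "k > 0"
  then have "k = 1 \<or> (\<exists>j. k = Suc (Suc j))"
    by (metis One_nat_def gr0_implies_Suc not0_implies_Suc)
  then show ?thesis
  proof
    assume "k = 1"
    then show ?thesis by simp
  next
    assume "\<exists>j. k = Suc (Suc j)"
    then obtain j where k: "k = Suc (Suc j)" ..
    have "bernoulli k = - (\<Sum>i<k. of_nat (k choose i) * (bernoulli i / of_nat (k - i + 1)) :: 'k)"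
      unfolding k by (rule bernoulli.simps(3))
    moreover have "{..k} = insert k {..<k}" by auto
    ultimately show ?thesis by (simp del: bernoulli.simps)
  qed
qed

text \<open>Up to the factor \<open>(- 1) ^ k / fact k\<close> the convolution is the sum in
  \<open>bernoulli_recursion\<close>.\<close>

lemma ccoef_acoef: "(\<Sum>i\<le>k. ccoef i * acoef (k - i)) = (if k = 0 then 1 else 0)"
proof (cases "k = 0")
  case False
  have "ccoef i * acoef (k - i)
      = (- 1) ^ k / fact k * (of_nat (k choose i) * (bernoulli i / of_nat (k - i + 1)))"
    if "i \<le> k" for i
  proof -
    have "((- 1) ^ i * (- 1) ^ (k - i) :: 'k) = (- 1) ^ k"
      using that by (simp flip: power_add)
    moreover have "(fact (Suc (k - i)) :: 'k) = of_nat (k - i + 1) * fact (k - i)"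
      by simp
    moreover have "(of_nat (k - i + 1) :: 'k) \<noteq> 0"
      by (metis Suc_eq_plus1 of_nat_neq_0)
    moreover have "(e * b) / (u * (r * v)) = e / w * (w / (u * v) * (b / r))"
      if "r \<noteq> 0" "u \<noteq> 0" "v \<noteq> 0" "w \<noteq> 0" for e b r u v w :: 'k
      using that by (simp add: field_simps)
    moreover have "ccoef i * acoef (k - i)
        = ((- 1) ^ i * (- 1) ^ (k - i) * bernoulli i) / (fact i * fact (Suc (k - i)))"
      by (simp add: ccoef_def acoef_def mult_ac del: fact_Suc bernoulli.simps)
    ultimately show ?thesis
      using that by (simp add: binomial_fact del: bernoulli.simps fact_Suc of_nat_add)
  qed
  then have "(\<Sum>i\<le>k. ccoef i * acoef (k - i))
      = (- 1) ^ k / fact k * (\<Sum>i\<le>k. of_nat (k choose i) * (bernoulli i / of_nat (k - i + 1)))"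
    unfolding sum_distrib_left by (intro sum.cong refl) simp
  then show ?thesis
    using False bernoulli_recursion[of k] by simp
qed (simp add: ccoef_def)

lemma acoef_ccoef: "(\<Sum>i\<le>k. acoef i * ccoef (k - i)) = (if k = 0 then 1 else 0)"
  using ccoef_acoef[of k] sum.nat_diff_reindex[of "\<lambda>i. acoef i * ccoef (k - i)" "Suc k"]
  by (simp add: mult.commute lessThan_Suc_atMost cong: sum.cong_simp)

definition pi_op :: "'g \<Rightarrow> ('k, 'g) free_alg \<Rightarrow> ('k, 'g) free_alg" where
  "pi_op = contract_series ccoef left_mul"

lemma bilinear_pi_op: "bilinear pi_op"
  unfolding pi_op_def by (rule bilinear_contract_series[OF bilinear_left_mul])

lemma contract_series_pi_op: "contract_series acoef pi_op z f = left_mul z f"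
  unfolding pi_op_def by (rule contract_series_contract_series[OF bilinear_left_mul acoef_ccoef])

lemma symmetrise_left_mul: "symmetrise (left_mul z f) - contract_series acoef (\<lambda>z f. left_mul z (symmetrise f)) z f \<in> env_ideal"
proof (induction f rule: free_alg_induct)
  case zero
  then show ?case
    by (simp add: symmetrise_zero contract_series_zero bilinearD[OF bilinear_left_mul] env.zero_mem)
next
  case (add f g)
  then show ?case
    using env.cong_add[OF add] by (simp add: symmetrise_add contract_series_add bilinearD[OF bilinear_left_mul])
next
  case (smul c f)
  then show ?case
    using env_smul_cong[OF smul, of c] by (simp add: symmetrise_smul contract_series_smul bilinearD[OF bilinear_left_mul])
next
  case (word w)
  then show ?case
    using symmetrise_left_mul_homog[of "length w" "word w" "length w" z]
    by (simp add: homog_word contract_series_homog[OF bilinear_left_mul_symmetrise, of "length w" _ "length w"])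
qed

text \<open>The linear map \<open>symmetrise\<close> can be moved inside the series; there
  \<open>symmetrise_left_mul\<close> produces the series of \<open>acoef\<close>, which that of
  \<open>ccoef\<close> cancels.\<close>

lemma symmetrise_pi_op: "symmetrise (pi_op z f) - left_mul z (symmetrise f) \<in> env_ideal"
proof -
  have "symmetrise (pi_op z f) = contract_series ccoef (\<lambda>z f. symmetrise (left_mul z f)) z f"
    unfolding pi_op_def by (rule contract_series_commute_linear[OF symmetrise_linear bilinear_left_mul, symmetric])
  also have "\<dots> - contract_series ccoef (contract_series acoef (\<lambda>z f. left_mul z (symmetrise f))) z f \<in> env_ideal"
    by (intro contract_series_cong env.two_sided_ideal_axioms symmetrise_left_mul)
  also have "contract_series ccoef (contract_series acoef (\<lambda>z f. left_mul z (symmetrise f))) z f = left_mul z (symmetrise f)"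
    by (rule contract_series_contract_series[OF bilinear_left_mul_symmetrise ccoef_acoef])
  finally show ?thesis .
qed


subsection \<open>The action is a representation\<close>

type_synonym (in -) ('k, 'g) ternary = "'g \<Rightarrow> 'g \<Rightarrow> ('k, 'g) free_alg \<Rightarrow> ('k, 'g) free_alg"

definition trilinear :: "('k, 'g) ternary \<Rightarrow> bool" where
  "trilinear \<gamma> \<longleftrightarrow> (\<forall>z'. bilinear (\<lambda>z. \<gamma> z z')) \<and> (\<forall>z. bilinear (\<gamma> z))"

lemma trilinearD:
  assumes "trilinear \<gamma>"
  shows "\<gamma> z z' (f + f') = \<gamma> z z' f + \<gamma> z z' f'" "\<gamma> z z' (smul c f) = smul c (\<gamma> z z' f)"
    "\<gamma> (y + z) z' f = \<gamma> y z' f + \<gamma> z z' f" "\<gamma> (scale c z) z' f = smul c (\<gamma> z z' f)"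
    "\<gamma> z (y + z') f = \<gamma> z y f + \<gamma> z z' f" "\<gamma> z (scale c z') f = smul c (\<gamma> z z' f)"
    "\<gamma> z z' 0 = 0"
  using assms by (auto simp: trilinear_def bilinear_def bilinearD(5)[of "\<gamma> z"])

text \<open>
  Likewise, \<open>contract1\<close> and \<open>contract2\<close> stand for \<open>T\<^sub>1\<close> and \<open>T\<^sub>2\<close>. In \<open>contract1\<close> the derivative
  has to pass the second argument, which is where the twist comes from.
\<close>

definition contract1 :: "('k, 'g) ternary \<Rightarrow> ('k, 'g) ternary" where
  "contract1 \<gamma> z z' f = (\<Sum>i\<in>Ix. \<gamma> (bracket z (X i)) (tw (par i) z') (der i f))"

definition contract2 :: "('k, 'g) ternary \<Rightarrow> ('k, 'g) ternary" where
  "contract2 \<gamma> z z' f = (\<Sum>i\<in>Ix. \<gamma> z (bracket z' (X i)) (der i f))"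

definition bracket_slot :: "('g \<Rightarrow> ('k, 'g) free_alg \<Rightarrow> ('k, 'g) free_alg) \<Rightarrow> ('k, 'g) ternary" where
  "bracket_slot \<beta> z z' f = \<beta> (bracket z z') f"

text \<open>Exchange of the two arguments with the Koszul sign, again for inhomogeneous vectors:
  only the odd part of \<open>z'\<close> twists \<open>z\<close>.\<close>

definition super_swap :: "('k, 'g) ternary \<Rightarrow> ('k, 'g) ternary" where
  "super_swap \<gamma> z z' f = \<gamma> (pr 0 z') z f + \<gamma> (pr 1 z') (tw 1 z) f"

lemma contract1_Suc: "(contract1 ^^ Suc k) \<gamma> z z' f = (\<Sum>i\<in>Ix. (contract1 ^^ k) \<gamma> (bracket z (X i)) (tw (par i) z') (der i f))"
  and contract2_Suc: "(contract2 ^^ Suc k) \<gamma> z z' f = (\<Sum>i\<in>Ix. (contract2 ^^ k) \<gamma> z (bracket z' (X i)) (der i f))"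
  by (simp_all add: contract1_def[of "(contract1 ^^ k) \<gamma>"] contract2_def[of "(contract2 ^^ k) \<gamma>"])

lemma trilinear_contract1: "trilinear \<gamma> \<Longrightarrow> trilinear (contract1 \<gamma>)"
  unfolding trilinear_def[of "contract1 \<gamma>"] bilinear_def
  by (simp add: contract1_def der_add der_smul trilinearD bilinear_simps sum.distrib smul.scale_sum_right)

lemma trilinear_contract2: "trilinear \<gamma> \<Longrightarrow> trilinear (contract2 \<gamma>)"
  unfolding trilinear_def[of "contract2 \<gamma>"] bilinear_def
  by (simp add: contract2_def der_add der_smul trilinearD bilinear_simps sum.distrib smul.scale_sum_right)

lemma trilinear_contract1_pow: "trilinear \<gamma> \<Longrightarrow> trilinear ((contract1 ^^ k) \<gamma>)"
  by (induction k) (auto intro: trilinear_contract1)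

lemma trilinear_contract2_pow: "trilinear \<gamma> \<Longrightarrow> trilinear ((contract2 ^^ k) \<gamma>)"
  by (induction k) (auto intro: trilinear_contract2)

lemma trilinear_bracket_slot: "bilinear \<beta> \<Longrightarrow> trilinear (bracket_slot \<beta>)"
  unfolding trilinear_def bilinear_def[of "\<lambda>z. bracket_slot \<beta> z _"] bilinear_def[of "bracket_slot \<beta> _"]
  by (simp add: bracket_slot_def bilinearD bilinear_simps)

lemma trilinear_super_swap: "trilinear \<gamma> \<Longrightarrow> trilinear (super_swap \<gamma>)"
  unfolding trilinear_def[of "super_swap \<gamma>"] bilinear_def
  by (simp add: super_swap_def trilinearD bilinear_simps add_ac smul.scale_right_distrib)

text \<open>The sign from moving the twist past \<open>X j\<close> cancels the sign from exchanging
  the two derivatives.\<close>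

lemma contract1_contract2: "trilinear \<gamma> \<Longrightarrow> contract1 (contract2 \<gamma>) = contract2 (contract1 \<gamma>)"
proof (intro ext)
  fix z z' f assume g: "trilinear \<gamma>"
  have "contract1 (contract2 \<gamma>) z z' f = (\<Sum>j\<in>Ix. \<Sum>i\<in>Ix. \<gamma> (bracket z (X i)) (bracket (tw (par i) z') (X j)) (der j (der i f)))"
    unfolding contract1_def contract2_def by (rule sum.swap)
  also have "\<dots> = contract2 (contract1 \<gamma>) z z' f"
    unfolding contract1_def contract2_def
  proof (intro sum.cong refl)
    fix i j assume ij: "i \<in> Ix" "j \<in> Ix"
    show "\<gamma> (bracket z (X i)) (bracket (tw (par i) z') (X j)) (der j (der i f))
        = \<gamma> (bracket z (X i)) (tw (par i) (bracket z' (X j))) (der i (der j f))"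
      by (simp add: bracket_tw[OF ij(2)] der_der[OF ij] trilinearD[OF g])
  qed
  finally show "contract1 (contract2 \<gamma>) z z' f = contract2 (contract1 \<gamma>) z z' f" .
qed

lemma contract1_pow_contract2: "trilinear \<gamma> \<Longrightarrow> (contract1 ^^ k) (contract2 \<gamma>) = contract2 ((contract1 ^^ k) \<gamma>)"
  by (induction k) (simp_all add: contract1_contract2 trilinear_contract1_pow)

lemma contract1_pow_contract2_pow: "trilinear \<gamma> \<Longrightarrow> (contract1 ^^ k) ((contract2 ^^ l) \<gamma>) = (contract2 ^^ l) ((contract1 ^^ k) \<gamma>)"
  by (induction l) (simp_all add: contract1_pow_contract2 trilinear_contract2_pow)

lemma pr_bracket: "i \<in> Ix \<Longrightarrow> bracket (pr p z) (X i) = pr (p + par i) (bracket z (X i))"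
proof -
  assume i: "i \<in> Ix"
  have "bracket (pr q z) (X i) \<in> V (q + par i)" for q
    by (intro bracket_graded pr_mem basis_mem i)
  from pr_part[OF this]
  have "pr (p + par i) (bracket (pr q z) (X i)) = (if p = q then bracket (pr q z) (X i) else 0)" for q
    by (cases p; cases q; cases "par i") (simp_all add: add_bit_eq_xor)
  moreover have "bracket z (X i) = bracket (pr 0 z) (X i) + bracket (pr 1 z) (X i)"
    by (metis bracket_add_left pr_total)
  ultimately show ?thesis
    by (cases p) (simp_all add: pr_add)
qed

text \<open>The swap intertwines the two contractions: the twist of \<open>z'\<close> in
  \<open>contract1\<close> supplies the sign that arises when \<open>X i\<close> is bracketed into
  the twisted \<open>z\<close>.\<close>

lemma contract1_super_swap: "trilinear \<gamma> \<Longrightarrow> contract1 (super_swap \<gamma>) = super_swap (contract2 \<gamma>)"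
proof (intro ext)
  fix z z' f assume g: "trilinear \<gamma>"
  show "contract1 (super_swap \<gamma>) z z' f = super_swap (contract2 \<gamma>) z z' f"
    unfolding contract1_def contract2_def super_swap_def sum.distrib
    by (intro arg_cong2[where f = "(+)"] sum.cong refl)
       (simp_all add: pr_tw bracket_tw trilinearD[OF g] koszul_commute[of 1])
qed

lemma contract2_super_swap: "trilinear \<gamma> \<Longrightarrow> contract2 (super_swap \<gamma>) = super_swap (contract1 \<gamma>)"
proof (intro ext)
  fix z z' f assume g: "trilinear \<gamma>"
  have tt: "tw 1 (tw 1 z) = z"
    by (rule eq_if_xi_eq) simp
  show "contract2 (super_swap \<gamma>) z z' f = super_swap (contract1 \<gamma>) z z' f"
    unfolding contract1_def contract2_def super_swap_def sum.distrib[symmetric]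
  proof (intro sum.cong refl)
    fix i assume i: "i \<in> Ix"
    show "\<gamma> (pr 0 (bracket z' (X i))) z (der i f) + \<gamma> (pr 1 (bracket z' (X i))) (tw 1 z) (der i f)
        = \<gamma> (bracket (pr 0 z') (X i)) (tw (par i) z) (der i f)
          + \<gamma> (bracket (pr 1 z') (X i)) (tw (par i) (tw 1 z)) (der i f)"
      using i by (cases "par i") (simp_all add: pr_bracket tt)
  qed
qed

lemma contract1_pow_super_swap: "trilinear \<gamma> \<Longrightarrow> (contract1 ^^ k) (super_swap \<gamma>) = super_swap ((contract2 ^^ k) \<gamma>)"
  by (induction k) (simp_all add: contract1_super_swap trilinear_contract2_pow)

lemma contract2_pow_super_swap: "trilinear \<gamma> \<Longrightarrow> (contract2 ^^ k) (super_swap \<gamma>) = super_swap ((contract1 ^^ k) \<gamma>)"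
  by (induction k) (simp_all add: contract2_super_swap trilinear_contract1_pow)

lemma super_swap_bracket_slot: "bilinear \<beta> \<Longrightarrow> super_swap (bracket_slot \<beta>) z z' f = - bracket_slot \<beta> z z' f"
proof -
  assume b: "bilinear \<beta>"
  have "super_swap (bracket_slot \<beta>) z z' f = \<beta> (- bracket z z') f"
    by (simp add: super_swap_def bracket_slot_def flip: bilinearD(3)[OF b] antisymmetry_pr[of z' z])
  also have "\<dots> = smul (-1) (\<beta> (bracket z z') f)"
    by (simp flip: bilinearD(4)[OF b])
  finally show ?thesis
    by (simp add: bracket_slot_def)
qed

lemma pow_minus:
  "(contract1 ^^ k) (\<lambda>z z' f. - \<gamma> z z' f) = (\<lambda>z z' f. - (contract1 ^^ k) \<gamma> z z' f)"
  "(contract2 ^^ k) (\<lambda>z z' f. - \<gamma> z z' f) = (\<lambda>z z' f. - (contract2 ^^ k) \<gamma> z z' f)"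
  by (induction k) (auto simp: contract1_def contract2_def sum_negf intro!: ext)

lemma pow_diff:
  "(contract1 ^^ k) (\<lambda>z z' f. \<gamma> z z' f - \<delta> z z' f) = (\<lambda>z z' f. (contract1 ^^ k) \<gamma> z z' f - (contract1 ^^ k) \<delta> z z' f)"
  "(contract2 ^^ k) (\<lambda>z z' f. \<gamma> z z' f - \<delta> z z' f) = (\<lambda>z z' f. (contract2 ^^ k) \<gamma> z z' f - (contract2 ^^ k) \<delta> z z' f)"
  by (induction k) (auto simp: contract1_def contract2_def sum_subtractf intro!: ext)

lemma contract1_pow_zero:
  assumes "trilinear \<gamma>" "homog s f" "\<And>z z' f t. homog t f \<Longrightarrow> t + k \<le> s \<Longrightarrow> \<gamma> z z' f = 0"
  shows "(contract1 ^^ k) \<gamma> z z' f = 0"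
  using assms(2,3)
proof (induction k arbitrary: s z z' f)
  case (Suc k)
  have "(contract1 ^^ k) \<gamma> (bracket z (X i)) (tw (par i) z') (der i f) = 0" for i
  proof (cases s)
    case 0
    then show ?thesis
      using Suc.prems(1) der_homog_0 trilinearD(7)[OF trilinear_contract1_pow[OF assms(1)]] by metis
  next
    case (Suc t)
    then show ?thesis
      using Suc.prems homog_der by (intro Suc.IH[of t]) auto
  qed
  then show ?case by (simp add: contract1_Suc del: funpow.simps)
qed simp

lemma contract2_pow_zero:
  assumes "trilinear \<gamma>" "homog s f" "s < k"
  shows "(contract2 ^^ k) \<gamma> z z' f = 0"
  using assms(2,3)
proof (induction k arbitrary: s z z' f)
  case (Suc k)
  have "(contract2 ^^ k) \<gamma> z (bracket z' (X i)) (der i f) = 0" for i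
  proof (cases s)
    case 0
    then show ?thesis
      using Suc.prems(1) der_homog_0 trilinearD(7)[OF trilinear_contract2_pow[OF assms(1)]] by metis
  next
    case (Suc t)
    then show ?thesis
      using Suc.prems homog_der by (intro Suc.IH[of t]) auto
  qed
  then show ?case by (simp add: contract2_Suc del: funpow.simps)
qed simp

lemma contract1_contract2_pow_zero:
  assumes "trilinear \<gamma>" "homog s f" "s < k + l"
  shows "(contract1 ^^ k) ((contract2 ^^ l) \<gamma>) z z' f = 0"
  using assms by (intro contract1_pow_zero[where s = s] trilinear_contract2_pow) (auto intro: contract2_pow_zero)

abbreviation contract_bracket :: "('g \<Rightarrow> ('k, 'g) free_alg \<Rightarrow> ('k, 'g) free_alg) \<Rightarrow> nat \<Rightarrow> nat \<Rightarrow> ('k, 'g) ternary" where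
  "contract_bracket \<beta> i j \<equiv> (contract1 ^^ i) ((contract2 ^^ j) (bracket_slot \<beta>))"

text \<open>Pascal's rule for two families: the second for the powers of \<open>T1 + T2\<close>, the
  first for the quotients \<open>((T1 + T2)^k - T1^k) / T2\<close>, whose top term is
  missing.\<close>

lemma pascal_sums:
  fixes h :: "nat \<Rightarrow> ('k, 'g) free_alg"
  shows "(\<Sum>i\<le>k. smul (of_nat (k choose i)) (h i)) + (\<Sum>i<k. smul (of_nat (k choose i)) (h (Suc i)))
      = (\<Sum>i\<le>k. smul (of_nat (Suc k choose i)) (h i))"
    and "(\<Sum>i\<le>k. smul (of_nat (k choose i)) (h i)) + (\<Sum>i\<le>k. smul (of_nat (k choose i)) (h (Suc i)))
      = (\<Sum>i\<le>Suc k. smul (of_nat (Suc k choose i)) (h i))"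
proof -
  have s: "(\<Sum>i\<le>k. smul (of_nat (k choose i)) (h i)) = h 0 + (\<Sum>i<k. smul (of_nat (k choose Suc i)) (h (Suc i)))"
    "(\<Sum>i\<le>k. smul (of_nat (Suc k choose i)) (h i))
      = h 0 + (\<Sum>i<k. smul (of_nat (Suc k choose Suc i)) (h (Suc i)))"
    by (simp_all add: sum.lessThan_Suc_shift flip: lessThan_Suc_atMost del: sum.lessThan_Suc)
  show 1: "(\<Sum>i\<le>k. smul (of_nat (k choose i)) (h i)) + (\<Sum>i<k. smul (of_nat (k choose i)) (h (Suc i)))
      = (\<Sum>i\<le>k. smul (of_nat (Suc k choose i)) (h i))"
    unfolding s by (simp add: smul.scale_left_distrib sum.distrib)
  show "(\<Sum>i\<le>k. smul (of_nat (k choose i)) (h i)) + (\<Sum>i\<le>k. smul (of_nat (k choose i)) (h (Suc i)))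
      = (\<Sum>i\<le>Suc k. smul (of_nat (Suc k choose i)) (h i))"
    using 1 by (simp add: lessThan_Suc_atMost[symmetric] add.assoc del: binomial_Suc_Suc)
qed

text \<open>By \<open>jacobi_right\<close>, contracting a bracket is \<open>contract1\<close> plus
  \<open>contract2\<close>. These commute, so the binomial theorem applies.\<close>

lemma bracket_slot_contract_pow:
  assumes "bilinear \<beta>"
  shows "bracket_slot ((contract ^^ k) \<beta>) z z' f = (\<Sum>i\<le>k. smul (of_nat (k choose i)) (contract_bracket \<beta> i (k - i) z z' f))"
proof (induction k arbitrary: z z' f)
  case (Suc k)
  note bk = bilinearD[OF bilinear_contract_pow[OF assms]]
  have "bracket_slot ((contract ^^ Suc k) \<beta>) z z' f
      = (\<Sum>i\<in>Ix. bracket_slot ((contract ^^ k) \<beta>) z (bracket z' (X i)) (der i f)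
          + bracket_slot ((contract ^^ k) \<beta>) (bracket z (X i)) (tw (par i) z') (der i f))"
    unfolding bracket_slot_def contract_Suc by (intro sum.cong refl) (simp add: jacobi_right bk)
  also have "\<dots> = (\<Sum>i\<le>k. smul (of_nat (k choose i)) (contract2 (contract_bracket \<beta> i (k - i)) z z' f))
      + (\<Sum>i\<le>k. smul (of_nat (k choose i)) (contract1 (contract_bracket \<beta> i (k - i)) z z' f))"
    unfolding Suc sum.distrib contract1_def contract2_def smul.scale_sum_right
    by (intro arg_cong2[where f = "(+)"] sum.swap)
  also have "\<dots> = (\<Sum>i\<le>k. smul (of_nat (k choose i)) (contract_bracket \<beta> i (Suc k - i) z z' f))
      + (\<Sum>i\<le>k. smul (of_nat (k choose i)) (contract_bracket \<beta> (Suc i) (Suc k - Suc i) z z' f))"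
    by (intro arg_cong2[where f = "(+)"] sum.cong refl)
       (simp_all add: Suc_diff_le contract1_pow_contract2[OF trilinear_contract2_pow[OF trilinear_bracket_slot[OF assms]]])
  also have "\<dots> = (\<Sum>i\<le>Suc k. smul (of_nat (Suc k choose i)) (contract_bracket \<beta> i (Suc k - i) z z' f))"
    by (rule pascal_sums(2))
  finally show ?case .
qed simp

text \<open>A derivative either hits the factor \<open>z'\<close>, which creates the bracket of
  \<open>z\<close> and \<open>z'\<close>, or passes it, which is one application of
  \<open>contract1\<close>. Collecting the first kind gives \<open>((T1 + T2)^k - T1^k) / T2\<close>
  on the bracket, with \<open>T1\<close>, \<open>T2\<close> the two contractions.\<close>

lemma contract_pow_left_mul:
  assumes "bilinear \<beta>"
  shows "(contract ^^ k) \<beta> z (left_mul z' f) = (\<Sum>i<k. smul (of_nat (k choose i)) (contract_bracket \<beta> i (k - 1 - i) z z' f))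
    + (contract1 ^^ k) (\<lambda>z z' f. \<beta> z (left_mul z' f)) z z' f"
proof (induction k arbitrary: z z' f)
  case (Suc k)
  note bk = bilinearD[OF bilinear_contract_pow[OF assms]]
  let ?M = "\<lambda>z z' f. \<beta> z (left_mul z' f)"
  have "(contract ^^ Suc k) \<beta> z (left_mul z' f)
      = (\<Sum>i\<in>Ix. smul (xi i z') ((contract ^^ k) \<beta> (bracket z (X i)) f))
        + (\<Sum>i\<in>Ix. (contract ^^ k) \<beta> (bracket z (X i)) (left_mul (tw (par i) z') (der i f)))"
    unfolding contract_Suc sum.distrib[symmetric] by (intro sum.cong refl) (simp add: left_mul_def der_emb_mult bk)
  also have "(\<Sum>i\<in>Ix. smul (xi i z') ((contract ^^ k) \<beta> (bracket z (X i)) f)) = bracket_slot ((contract ^^ k) \<beta>) z z' f"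
    unfolding bracket_slot_def bracket_expansion[of z z'] by (simp add: bk)
  also have "\<dots> = (\<Sum>i\<le>k. smul (of_nat (k choose i)) (contract_bracket \<beta> i (k - i) z z' f))"
    by (rule bracket_slot_contract_pow[OF assms])
  also have "(\<Sum>i\<in>Ix. (contract ^^ k) \<beta> (bracket z (X i)) (left_mul (tw (par i) z') (der i f)))
      = (\<Sum>i<k. smul (of_nat (k choose i)) (contract1 (contract_bracket \<beta> i (k - 1 - i)) z z' f)) + (contract1 ^^ Suc k) ?M z z' f"
    unfolding Suc sum.distrib by (simp add: contract1_def smul.scale_sum_right sum.swap[of _ "{..<k}"])
  also have "(\<Sum>i<k. smul (of_nat (k choose i)) (contract1 (contract_bracket \<beta> i (k - 1 - i)) z z' f))
      = (\<Sum>i<k. smul (of_nat (k choose i)) (contract_bracket \<beta> (Suc i) (k - Suc i) z z' f))"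
    by simp
  finally show ?case
    using pascal_sums(1)[of k "\<lambda>i. contract_bracket \<beta> i (k - i) z z' f"]
    by (simp add: lessThan_Suc_atMost add.assoc[symmetric])
qed simp

definition pi_pi :: "('k, 'g) ternary" where
  "pi_pi z z' f = pi_op z (pi_op z' f)"

definition defect :: "('k, 'g) ternary" where
  "defect z z' f = pi_pi z z' f - super_swap pi_pi z z' f - bracket_slot pi_op z z' f"

lemma trilinear_pi_pi: "trilinear pi_pi"
  unfolding trilinear_def bilinear_def by (simp add: pi_pi_def bilinearD[OF bilinear_pi_op])

lemma trilinear_diff: "trilinear \<gamma> \<Longrightarrow> trilinear \<delta> \<Longrightarrow> trilinear (\<lambda>z z' f. \<gamma> z z' f - \<delta> z z' f)"
  unfolding trilinear_def[of "\<lambda>z z' f. \<gamma> z z' f - \<delta> z z' f"] bilinear_def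
  by (simp add: trilinearD smul.scale_right_diff_distrib)

lemma trilinear_defect: "trilinear defect"
  unfolding defect_def[abs_def] by (intro trilinear_diff trilinear_pi_pi trilinear_super_swap trilinear_bracket_slot bilinear_pi_op)

lemma contract2_pow_pi_pi: "(contract2 ^^ l) pi_pi z z' f = pi_op z ((contract ^^ l) pi_op z' f)"
proof (induction l arbitrary: z z' f)
  case (Suc l)
  then show ?case
    by (simp add: contract2_Suc contract_Suc bilinearD[OF bilinear_pi_op] del: funpow.simps)
qed (simp add: pi_pi_def)

lemma contract1_pow_eq_sum:
  assumes "trilinear \<gamma>" "\<And>l. trilinear (\<delta> l)"
    and eq: "\<And>t z z' f. homog t f \<Longrightarrow> t \<le> M \<Longrightarrow> \<gamma> z z' f = (\<Sum>l\<le>M. smul (c l) (\<delta> l z z' f))"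
    and "homog s f" "s \<le> M"
  shows "(contract1 ^^ k) \<gamma> z z' f = (\<Sum>l\<le>M. smul (c l) ((contract1 ^^ k) (\<delta> l) z z' f))"
  using assms(4,5)
proof (induction k arbitrary: s z z' f)
  case 0
  then show ?case using eq by simp
next
  case (Suc k)
  have "(contract1 ^^ k) \<gamma> (bracket z (X i)) (tw (par i) z') (der i f)
      = (\<Sum>l\<le>M. smul (c l) ((contract1 ^^ k) (\<delta> l) (bracket z (X i)) (tw (par i) z') (der i f)))" for i
  proof (cases s)
    case 0
    then have "der i f = 0" using Suc.prems der_homog_0 by blast
    then show ?thesis
      by (simp add: trilinearD(7)[OF trilinear_contract1_pow[OF assms(1)]] trilinearD(7)[OF trilinear_contract1_pow[OF assms(2)]])
  next
    case (Suc t)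
    with Suc.prems show ?thesis
      using homog_der by (intro Suc.IH[of t]) auto
  qed
  then show ?case
    by (simp add: contract1_Suc smul.scale_sum_right sum.swap[of _ "{..M}"] del: funpow.simps)
qed

text \<open>Multiplication is \<open>a(T)\<close> applied to \<open>pi_op\<close>; this is used for
  both factors. The first double sum is \<open>(a(T1 + T2) - a(T1)) / T2\<close> on the bracket, the
  second is \<open>a(T1) a(T2)\<close> on the composite action.\<close>

lemma left_mul_left_mul:
  assumes f: "homog s f" and s: "s \<le> M"
  shows "left_mul z (left_mul z' f)
    = (\<Sum>k\<le>M. \<Sum>i\<le>k. smul (acoef (Suc k) * of_nat (Suc k choose i)) (contract_bracket pi_op i (k - i) z z' f))
      + (\<Sum>k\<le>M. \<Sum>l\<le>M. smul (acoef k * acoef l) ((contract1 ^^ k) ((contract2 ^^ l) pi_pi) z z' f))"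
proof -
  let ?M = "\<lambda>z z' f. pi_op z (left_mul z' f)"
  have tM: "trilinear ?M"
    unfolding trilinear_def bilinear_def by (simp add: bilinearD[OF bilinear_pi_op] bilinearD[OF bilinear_left_mul])
  have "?M z z' f = (\<Sum>l\<le>M. smul (acoef l) ((contract2 ^^ l) pi_pi z z' f))" if "homog t f" "t \<le> M" for t z z' f
    using contract_series_pi_op[of z' f] contract_series_homog[OF bilinear_pi_op that, of acoef z']
    by (simp add: contract2_pow_pi_pi bilinearD[OF bilinear_pi_op] flip: bilinearD(2,7)[OF bilinear_pi_op])
  then have T1M: "(contract1 ^^ k) ?M z z' f = (\<Sum>l\<le>M. smul (acoef l) ((contract1 ^^ k) ((contract2 ^^ l) pi_pi) z z' f))" for k
    by (intro contract1_pow_eq_sum[OF tM trilinear_contract2_pow[OF trilinear_pi_pi] _ f s])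
  \<comment> \<open>The range ends at \<open>Suc M\<close> because \<open>left_mul z' f\<close> has
    one degree more than \<open>f\<close>.\<close>
  have "left_mul z (left_mul z' f) = (\<Sum>k\<le>Suc M. smul (acoef k) ((contract ^^ k) pi_op z (left_mul z' f)))"
    using contract_series_pi_op[of z "left_mul z' f"] contract_series_homog[OF bilinear_pi_op homog_emb_mult[OF f, of z'], of "Suc M" acoef z] s
    by (simp add: left_mul_def)
  also have "\<dots> = (\<Sum>k\<le>Suc M. \<Sum>i<k. smul (acoef k * of_nat (k choose i)) (contract_bracket pi_op i (k - 1 - i) z z' f))
      + (\<Sum>k\<le>Suc M. smul (acoef k) ((contract1 ^^ k) ?M z z' f))"
    by (simp only: contract_pow_left_mul[OF bilinear_pi_op] smul.scale_right_distrib sum.distrib smul.scale_sum_right smul.scale_scale)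
  also have "(\<Sum>k\<le>Suc M. smul (acoef k) ((contract1 ^^ k) ?M z z' f))
      = (\<Sum>k\<le>M. \<Sum>l\<le>M. smul (acoef k * acoef l) ((contract1 ^^ k) ((contract2 ^^ l) pi_pi) z z' f))"
  proof -
    \<comment> \<open>More contractions than the degree of \<open>f\<close>, so the last index drops
      out again.\<close>
    have "(contract1 ^^ Suc M) ((contract2 ^^ l) pi_pi) z z' f = 0" for l
      using s by (intro contract1_contract2_pow_zero[OF trilinear_pi_pi f]) simp
    then show ?thesis
      by (simp add: T1M smul.scale_sum_right del: funpow.simps)
  qed
  also have "(\<Sum>k\<le>Suc M. \<Sum>i<k. smul (acoef k * of_nat (k choose i)) (contract_bracket pi_op i (k - 1 - i) z z' f))
      = (\<Sum>k\<le>M. \<Sum>i\<le>k. smul (acoef (Suc k) * of_nat (Suc k choose i)) (contract_bracket pi_op i (k - i) z z' f))"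
    unfolding sum.atMost_Suc_shift by (simp add: lessThan_Suc_atMost)
  finally show ?thesis .
qed

text \<open>The coefficient form of
  \<open>(a(s+t) - a(s))/t + (a(s+t) - a(t))/s = - a(s) a(t)\<close>, which for
  \<open>a(t) = (1 - exp(-t)) / t\<close> follows from \<open>exp(-s-t) = exp(-s) exp(-t)\<close>.
  In coefficients it is Pascal's rule.\<close>

lemma acoef_binomial:
  assumes "i \<le> k"
  shows "acoef (Suc k) * (of_nat (Suc k choose i) + of_nat (Suc k choose Suc i)) = - (acoef i * acoef (k - i))"
proof -
  have "(of_nat (Suc k choose i) + of_nat (Suc k choose Suc i) :: 'k) = of_nat (Suc (Suc k) choose Suc i)"
    by (simp only: binomial_Suc_Suc of_nat_add)
  also have "\<dots> = fact (Suc (Suc k)) / (fact (Suc i) * fact (Suc (k - i)))"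
    using assms by (subst binomial_fact) (simp_all add: Suc_diff_le del: fact_Suc)
  finally have "acoef (Suc k) * (of_nat (Suc k choose i) + of_nat (Suc k choose Suc i))
      = (- 1) ^ Suc k / (fact (Suc i) * fact (Suc (k - i)))"
    by (simp add: acoef_def del: fact_Suc power_Suc binomial_Suc_Suc)
  moreover have "((- 1) ^ Suc k :: 'k) = - ((- 1) ^ i * (- 1) ^ (k - i))"
    using assms by (simp flip: power_add)
  ultimately show ?thesis
    by (simp add: acoef_def del: fact_Suc power_Suc binomial_Suc_Suc)
qed

text \<open>The super commutator \<open>?D\<close> of two left multiplications lies in
  \<open>sym_ideal\<close>. Expanding it by \<open>left_mul_left_mul\<close>, the bracket terms
  combine by \<open>acoef_binomial\<close> into exactly the bracket part of the defect.\<close>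

lemma defect_series:
  assumes f: "homog s f"
  shows "(\<Sum>k\<le>s. \<Sum>l\<le>s. smul (acoef k * acoef l) ((contract1 ^^ k) ((contract2 ^^ l) defect) z z' f)) \<in> sym_ideal"
proof -
  let ?F = "\<lambda>k l. (contract1 ^^ k) ((contract2 ^^ l) pi_pi)"
  let ?F' = "\<lambda>k l. (contract1 ^^ k) ((contract2 ^^ l) (super_swap pi_pi))"
  let ?D = "left_mul z (left_mul z' f) - (left_mul (pr 0 z') (left_mul z f) + left_mul (pr 1 z') (left_mul (tw 1 z) f))"
  \<comment> \<open>The swap exchanges the two contractions, and the antisymmetric bracket adds a
    minus sign.\<close>
  have "contract_bracket pi_op i j (pr 0 z') z f + contract_bracket pi_op i j (pr 1 z') (tw 1 z) f = - contract_bracket pi_op j i z z' f" for i j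
  proof -
    have tr: "trilinear (bracket_slot pi_op)" by (rule trilinear_bracket_slot[OF bilinear_pi_op])
    have "super_swap (contract_bracket pi_op i j) = (contract2 ^^ i) ((contract1 ^^ j) (super_swap (bracket_slot pi_op)))"
      by (simp add: contract1_pow_super_swap contract2_pow_super_swap tr trilinear_contract2_pow)
    also have "super_swap (bracket_slot pi_op) = (\<lambda>z z' f. - bracket_slot pi_op z z' f)"
      by (intro ext super_swap_bracket_slot bilinear_pi_op)
    finally show ?thesis
      by (simp add: super_swap_def pow_minus fun_eq_iff tr flip: contract1_pow_contract2_pow)
  qed
  note swE = this
  have swF: "?F k l (pr 0 z') z f + ?F k l (pr 1 z') (tw 1 z) f = ?F' l k z z' f" for k l
  proof -
    have "super_swap (?F k l) = (contract2 ^^ k) ((contract1 ^^ l) (super_swap pi_pi))"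
      by (simp add: contract1_pow_super_swap contract2_pow_super_swap trilinear_pi_pi trilinear_contract2_pow)
    also have "\<dots> = ?F' l k"
      by (rule contract1_pow_contract2_pow[OF trilinear_super_swap[OF trilinear_pi_pi], symmetric])
    finally show ?thesis
      by (simp add: super_swap_def fun_eq_iff)
  qed
  have "left_mul (pr 0 z') (left_mul z f) + left_mul (pr 1 z') (left_mul (tw 1 z) f)
    = (\<Sum>k\<le>s. \<Sum>i\<le>k. smul (acoef (Suc k) * of_nat (Suc k choose i))
          (contract_bracket pi_op i (k - i) (pr 0 z') z f + contract_bracket pi_op i (k - i) (pr 1 z') (tw 1 z) f))
      + (\<Sum>k\<le>s. \<Sum>l\<le>s. smul (acoef k * acoef l) (?F k l (pr 0 z') z f + ?F k l (pr 1 z') (tw 1 z) f))"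
    unfolding left_mul_left_mul[OF f order.refl] by (simp only: smul.scale_right_distrib sum.distrib add_ac)
  also have "\<dots> = - (\<Sum>k\<le>s. \<Sum>i\<le>k. smul (acoef (Suc k) * of_nat (Suc k choose i)) (contract_bracket pi_op (k - i) i z z' f))
      + (\<Sum>k\<le>s. \<Sum>l\<le>s. smul (acoef k * acoef l) (?F' k l z z' f))"
  proof -
    have "(\<Sum>k\<le>s. \<Sum>l\<le>s. smul (acoef k * acoef l) (?F' l k z z' f))
        = (\<Sum>k\<le>s. \<Sum>l\<le>s. smul (acoef k * acoef l) (?F' k l z z' f))"
      by (subst sum.swap) (simp add: mult.commute)
    then show ?thesis
      unfolding swE swF by (simp add: sum_negf)
  qed
  \<comment> \<open>The reflection of \<open>i\<close> to \<open>k - i\<close> restores the order of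
    the contractions and turns the binomial of \<open>i\<close> into that of \<open>Suc i\<close>,
    the companion needed in \<open>acoef_binomial\<close>.\<close>
  also have "(\<Sum>k\<le>s. \<Sum>i\<le>k. smul (acoef (Suc k) * of_nat (Suc k choose i)) (contract_bracket pi_op (k - i) i z z' f))
      = (\<Sum>k\<le>s. \<Sum>i\<le>k. smul (acoef (Suc k) * of_nat (Suc k choose Suc i)) (contract_bracket pi_op i (k - i) z z' f))"
  proof (rule sum.cong[OF refl])
    fix k
    have "(\<Sum>i\<le>k. smul (acoef (Suc k) * of_nat (Suc k choose i)) (contract_bracket pi_op (k - i) i z z' f))
        = (\<Sum>i\<le>k. smul (acoef (Suc k) * of_nat (Suc k choose (k - i))) (contract_bracket pi_op (k - (k - i)) (k - i) z z' f))"
      by (rule sum.reindex_bij_witness[of _ "\<lambda>i. k - i" "\<lambda>i. k - i"]) auto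
    also have "\<dots> = (\<Sum>i\<le>k. smul (acoef (Suc k) * of_nat (Suc k choose Suc i)) (contract_bracket pi_op i (k - i) z z' f))"
      using binomial_symmetric[of "Suc _" "Suc k"] by (intro sum.cong refl) simp
    finally show "(\<Sum>i\<le>k. smul (acoef (Suc k) * of_nat (Suc k choose i)) (contract_bracket pi_op (k - i) i z z' f))
      = (\<Sum>i\<le>k. smul (acoef (Suc k) * of_nat (Suc k choose Suc i)) (contract_bracket pi_op i (k - i) z z' f))" .
  qed
  finally have "?D = (\<Sum>k\<le>s. \<Sum>i\<le>k. smul (acoef (Suc k) * (of_nat (Suc k choose i) + of_nat (Suc k choose Suc i)))
        (contract_bracket pi_op i (k - i) z z' f))
      + (\<Sum>k\<le>s. \<Sum>l\<le>s. smul (acoef k * acoef l) (?F k l z z' f - ?F' k l z z' f))"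
    unfolding left_mul_left_mul[OF f order.refl, of z z']
    by (simp only: smul.scale_right_diff_distrib smul.scale_left_distrib distrib_left sum.distrib sum_subtractf)
       (simp add: algebra_simps)
  also have "(\<Sum>k\<le>s. \<Sum>i\<le>k. smul (acoef (Suc k) * (of_nat (Suc k choose i) + of_nat (Suc k choose Suc i)))
        (contract_bracket pi_op i (k - i) z z' f)) = - (\<Sum>k\<le>s. \<Sum>i\<le>k. smul (acoef i * acoef (k - i)) (contract_bracket pi_op i (k - i) z z' f))"
    by (simp add: acoef_binomial sum_negf del: binomial_Suc_Suc)
  \<comment> \<open>The triangle of indices may be filled up to a square, since more than
    \<open>s\<close> contractions annihilate \<open>f\<close>.\<close>
  also have "(\<Sum>k\<le>s. \<Sum>i\<le>k. smul (acoef i * acoef (k - i)) (contract_bracket pi_op i (k - i) z z' f))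
      = (\<Sum>k\<le>s. \<Sum>l\<le>s. smul (acoef k * acoef l) (contract_bracket pi_op k l z z' f))"
    by (rule sum_triangle[symmetric]) (simp add: contract1_contract2_pow_zero[OF trilinear_bracket_slot[OF bilinear_pi_op] f])
  finally have "?D = (\<Sum>k\<le>s. \<Sum>l\<le>s. smul (acoef k * acoef l) ((contract1 ^^ k) ((contract2 ^^ l) defect) z z' f))"
    by (simp add: defect_def[abs_def] pow_diff smul.scale_right_diff_distrib sum_subtractf)
  moreover have "?D \<in> sym_ideal"
    using sym.cong_mult_right[OF emb_commute[of z z'], of f] by (simp add: left_mul_def distrib_right mult.assoc)
  ultimately show ?thesis by simp
qed

lemma contract1_contract2_pow_mem:
  assumes "trilinear \<gamma>" "\<And>z z' f t. homog t f \<Longrightarrow> t < s \<Longrightarrow> \<gamma> z z' f \<in> sym_ideal"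
  shows "homog t f \<Longrightarrow> t < s + (k + l) \<Longrightarrow> (contract1 ^^ k) ((contract2 ^^ l) \<gamma>) z z' f \<in> sym_ideal"
proof (induction k arbitrary: t z z' f)
  case 0
  then show ?case
  proof (induction l arbitrary: t z z' f)
    case 0
    then show ?case using assms(2) by simp
  next
    case (Suc l)
    have "(contract2 ^^ l) \<gamma> z (bracket z' (X i)) (der i f) \<in> sym_ideal" for i
    proof (cases t)
      case 0
      then show ?thesis
        using Suc.prems(1) der_homog_0 trilinearD(7)[OF trilinear_contract2_pow[OF assms(1)]] sym.zero_mem by metis
    next
      case (Suc u)
      then show ?thesis
        using Suc.prems homog_der Suc.IH[of u "der i f"] by simp
    qed
    then show ?case
      by (simp add: contract2_Suc sym.sum_mem del: funpow.simps(2))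
  qed
next
  case (Suc k)
  have "(contract1 ^^ k) ((contract2 ^^ l) \<gamma>) (bracket z (X i)) (tw (par i) z') (der i f) \<in> sym_ideal" for i
  proof (cases t)
    case 0
    then show ?thesis
      using Suc.prems(1) der_homog_0 trilinearD(7)[OF trilinear_contract1_pow[OF trilinear_contract2_pow[OF assms(1)]]] sym.zero_mem by metis
  next
    case (Suc u)
    then show ?thesis
      using Suc.prems homog_der Suc.IH[of u "der i f"] by simp
  qed
  then show ?case
    by (simp add: contract1_Suc sym.sum_mem del: funpow.simps(2))
qed

text \<open>The operator in \<open>defect_series\<close> is the identity plus terms with at least
  one contraction. These evaluate the defect in lower degrees only, so strong induction on the
  degree inverts it.\<close>

lemma defect_homog: "homog s f \<Longrightarrow> defect z z' f \<in> sym_ideal"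
proof (induction s arbitrary: z z' f rule: less_induct)
  case (less s)
  let ?t = "\<lambda>(k, l). smul (acoef k * acoef l) ((contract1 ^^ k) ((contract2 ^^ l) defect) z z' f)"
  let ?A = "{..s} \<times> {..s}"
  have 1: "sum ?t ?A \<in> sym_ideal"
    using defect_series[OF less.prems, of z z'] by (simp add: sum.cartesian_product)
  have 2: "sum ?t (?A - {(0, 0)}) \<in> sym_ideal"
  proof (rule sym.sum_mem)
    fix x assume "x \<in> ?A - {(0, 0)}"
    then obtain k l where x: "x = (k, l)" "\<not> (k = 0 \<and> l = 0)"
      by (cases x) auto
    then have "(contract1 ^^ k) ((contract2 ^^ l) defect) z z' f \<in> sym_ideal"
      using less by (intro contract1_contract2_pow_mem[OF trilinear_defect, of s s]) auto
    then show "?t x \<in> sym_ideal"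
      unfolding x by (auto intro: two_sided_smul_mem sym.two_sided_ideal_axioms)
  qed
  have "sum ?t ?A = ?t (0, 0) + sum ?t (?A - {(0, 0)})"
    by (rule sum.remove) auto
  then have "sum ?t ?A - sum ?t (?A - {(0, 0)}) = defect z z' f"
    by simp
  then show ?case
    using sym.diff_mem[OF 1 2] by simp
qed

lemma defect_mem: "defect z z' f \<in> sym_ideal"
  by (induction f rule: free_alg_induct)
     (auto simp: trilinearD[OF trilinear_defect] homog_word intro: sym.zero_mem sym.add_mem defect_homog
       two_sided_smul_mem sym.two_sided_ideal_axioms)

lemma pi_op_bracket:
  assumes "x \<in> V p" "y \<in> V q"
  shows "pi_op x (pi_op y f) - smul (koszul p q) (pi_op y (pi_op x f)) - pi_op (bracket x y) f \<in> sym_ideal"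
proof -
  have "super_swap pi_pi x y f = smul (koszul p q) (pi_op y (pi_op x f))"
    using assms by (cases q) (simp_all add: super_swap_def pi_pi_def pr_part tw_part bilinearD[OF bilinear_pi_op] koszul_commute[of 1])
  then show ?thesis
    using defect_mem[of x y f] by (simp add: defect_def pi_pi_def bracket_slot_def)
qed


subsection \<open>Injectivity of the symmetrisation map\<close>

definition twist_map :: "bit \<Rightarrow> ('k, 'g) free_alg \<Rightarrow> ('k, 'g) free_alg" where
  "twist_map q = lin_ext smul (\<lambda>w. prod_list (map (\<lambda>v. emb (tw q v)) w))"

lemma twist_map_linear: "Vector_Spaces.linear smul smul (twist_map q)"
  unfolding twist_map_def by (rule linear_lin_ext) unfold_locales

lemmas twist_map_add = module_hom.add[OF module_hom_linearI[OF twist_map_linear]]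
  and twist_map_smul = module_hom.scale[OF module_hom_linearI[OF twist_map_linear]]
  and twist_map_diff = module_hom.diff[OF module_hom_linearI[OF twist_map_linear]]
  and twist_map_zero = module_hom.zero[OF module_hom_linearI[OF twist_map_linear]]

lemma twist_map_word: "twist_map q (word w) = prod_list (map (\<lambda>v. emb (tw q v)) w)"
  by (simp add: twist_map_def lin_ext_smul_word)

lemma twist_map_one: "twist_map q 1 = 1"
  using twist_map_word[of q "[]"] by (simp add: word_Nil)

lemma twist_map_mult: "twist_map q (f * g) = twist_map q f * twist_map q g"
proof (induction f rule: free_alg_induct)
  case (word w)
  show ?case
    by (induction g rule: free_alg_induct)
       (simp_all add: twist_map_zero twist_map_add twist_map_smul smul_mult_right distrib_left
        word_mult twist_map_word)
qed (simp_all add: twist_map_zero twist_map_add twist_map_smul smul_mult_left distrib_right)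

text \<open>The algebra endomorphism \<open>twist_map\<close>, induced by \<open>tw\<close>, plays
  the role of the sign in the super Leibniz rule and allows \<open>f\<close> to be
  inhomogeneous.\<close>

lemma der_mult: "der i (f * g) = der i f * g + twist_map (par i) f * der i g"
proof (induction f rule: free_alg_induct)
  case (word w)
  show ?case
  proof (induction w)
    case Nil
    then show ?case by (simp add: word_Nil der_one twist_map_one)
  next
    case (Cons v w)
    have "der i (word (v # w) * g) = smul (xi i v) (word w * g) + emb (tw (par i) v) * der i (word w * g)"
      using der_letter_mult[of i v "word w * g"] by (simp add: word_mult flip: mult.assoc)
    then show ?case
      unfolding Cons by (simp add: der_word twist_map_word distrib_left distrib_right smul_mult_left mult.assoc)
  qed
qed (simp_all add: der_zero twist_map_zero der_add twist_map_add der_smul twist_map_smul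
      smul_mult_left distrib_right smul.scale_right_distrib algebra_simps)

lemma word_letters_cong:
  assumes "two_sided_ideal K" "lin_ideal \<subseteq> K"
  shows "word w - prod_list (map emb w) \<in> K"
proof (induction w)
  case Nil
  then show ?case
    using assms(1) by (simp add: word_Nil two_sided_ideal.zero_mem)
next
  case (Cons v w)
  have "word [v] * word w - emb v * prod_list (map emb w) \<in> K"
    using assms letter_emb by (intro two_sided_ideal.cong_mult[OF assms(1)] Cons) auto
  then show ?case by (simp add: word_mult)
qed

lemma twist_map_word_cong: "twist_map q (word w) - word (map (tw q) w) \<in> sym_ideal"
  using sym.cong_sym[OF word_letters_cong[OF sym.two_sided_ideal_axioms lin_subset_sym, of "map (tw q) w"]]
  by (simp add: twist_map_word o_def)

lemma scalar_smul: "scalar c * f = smul c f"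
  by (simp add: smul_def)

lemma der_lin_relation: "r \<in> linearity_relations scale UNIV \<Longrightarrow> der i r = 0"
  by (auto simp: linearity_relations_def scalar_smul der_diff der_smul der_word smul.scale_left_distrib)

lemma twist_map_lin_relation: "r \<in> linearity_relations scale UNIV \<Longrightarrow> twist_map q r = 0"
  by (auto simp: linearity_relations_def scalar_smul twist_map_diff twist_map_smul twist_map_word
      tw_add tw_scale emb_add emb_scale)

lemma twist_map_mem: "f \<in> sym_ideal \<Longrightarrow> twist_map q f \<in> sym_ideal"
  unfolding sym_ideal_def
proof (induction rule: gen_ideal.induct)
  case (gen r)
  then consider "r \<in> linearity_relations scale UNIV" | "r \<in> sym_relations V" by blast
  then show ?case
  proof cases
    case 2
    then obtain u v p p' where r: "r = word [u] * word [v] - scalar (koszul p p') * (word [v] * word [u])"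
      and uv: "u \<in> V p" "v \<in> V p'"
      by (auto simp: sym_relations_def)
    have "twist_map q (word [u, v]) - smul (koszul p p') (twist_map q (word [v, u])) - (word [tw q u, tw q v]
        - smul (koszul p p') (word [tw q v, tw q u])) \<in> sym_ideal"
      using twist_map_word_cong[of q "[u, v]"] twist_map_word_cong[of q "[v, u]"]
      by (intro sym.cong_diff sym_smul_cong) simp_all
    also have "word [tw q u, tw q v] - smul (koszul p p') (word [tw q v, tw q u]) - 0 \<in> sym_ideal"
      using letters_super_commute[OF tw_mem[OF uv(1)] tw_mem[OF uv(2)], of q q] by (simp add: word_mult)
    finally show ?thesis
      unfolding r sym_ideal_def by (simp add: word_mult scalar_smul twist_map_diff twist_map_smul)
  qed (simp add: twist_map_lin_relation gen_ideal.zero)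
qed (simp_all add: twist_map_zero twist_map_add twist_map_mult gen_ideal.intros)

text \<open>A commutation relation has degree two, so its derivative has degree one. Its terms
  cancel because \<open>xi i\<close> vanishes on letters whose parity is not \<open>par i\<close>.
  Products are handled by \<open>der_mult\<close> and \<open>twist_map_mem\<close>.\<close>

lemma der_mem:
  assumes i: "i \<in> Ix" and "f \<in> sym_ideal"
  shows "der i f \<in> sym_ideal"
  using assms(2) unfolding sym_ideal_def
proof (induction rule: gen_ideal.induct)
  case (gen r)
  then consider "r \<in> linearity_relations scale UNIV" | "r \<in> sym_relations V" by blast
  then show ?case
  proof cases
    case 2
    then obtain u v p q where r: "r = word [u] * word [v] - scalar (koszul p q) * (word [v] * word [u])"
      and uv: "u \<in> V p" "v \<in> V q"
      by (auto simp: sym_relations_def)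
    have d: "der i (word [a, b]) - (smul (xi i a) (word [b]) + smul (koszul (par i) pa * xi i b) (word [a])) \<in> sym_ideal"
        if "a \<in> V pa" for a b pa
      proof -
        have "emb a - word [a] \<in> sym_ideal"
          using sym.cong_sym letter_emb lin_subset_sym by blast
        then show ?thesis
          using that sym.cong_add[OF sym.cong_refl sym_smul_cong]
          by (simp add: der_word tw_part emb_scale smul_mult_right word_Nil mult.commute sym_smul_cong
             flip: smul.scale_right_diff_distrib)
      qed
      have "der i (word [u, v]) - smul (koszul p q) (der i (word [v, u]))
        - (smul (xi i u) (word [v]) + smul (koszul (par i) p * xi i v) (word [u])
          - smul (koszul p q) (smul (xi i v) (word [u]) + smul (koszul (par i) q * xi i u) (word [v]))) \<in> sym_ideal"
        by (intro sym.cong_diff sym_smul_cong d uv)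
      also have "smul (xi i u) (word [v]) + smul (koszul (par i) p * xi i v) (word [u])
          - smul (koszul p q) (smul (xi i v) (word [u]) + smul (koszul (par i) q * xi i u) (word [v])) = 0"
      proof -
        have "koszul (par i) p * xi i v = koszul p q * xi i v"
          using xi_part[OF uv(2) i] by (cases "par i = q") (simp_all add: koszul_commute[of q p])
        moreover have "koszul p q * (koszul (par i) q * xi i u) = xi i u"
          using xi_part[OF uv(1) i] by (cases "par i = p") simp_all
        ultimately have k: "koszul (par i) p * xi i v = koszul p q * xi i v"
          "koszul p q * (koszul (par i) q * xi i u) = xi i u" .
        show ?thesis
          by (simp only: smul.scale_right_distrib smul.scale_scale k) simp
      qed
      finally show ?thesis
        unfolding r sym_ideal_def by (simp add: word_mult scalar_smul der_diff der_smul)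
  qed (simp add: der_lin_relation gen_ideal.zero)
qed (simp_all add: der_zero der_add der_mult gen_ideal.intros twist_map_mem[unfolded sym_ideal_def])

lemma contract_pow_mem:
  assumes "\<And>z f. f \<in> sym_ideal \<Longrightarrow> \<beta> z f \<in> sym_ideal"
  shows "f \<in> sym_ideal \<Longrightarrow> (contract ^^ k) \<beta> z f \<in> sym_ideal"
proof (induction k arbitrary: z f)
  case (Suc k)
  then show ?case
    by (simp add: contract_Suc sym.sum_mem der_mem del: funpow.simps(2))
qed (simp add: assms)

lemma contract_series_bounded:
  assumes "bilinear \<beta>" "\<And>w. w \<in> Poly_Mapping.keys f \<Longrightarrow> length w \<le> N"
  shows "contract_series a \<beta> z f = (\<Sum>k\<le>N. smul (a k) ((contract ^^ k) \<beta> z f))"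
proof -
  note b = bilinearD[OF bilinear_contract_series[OF assms(1)]] bilinearD[OF bilinear_contract_pow[OF assms(1)]]
  have "contract_series a \<beta> z f = (\<Sum>w\<in>Poly_Mapping.keys f. smul (Poly_Mapping.lookup f w) (contract_series a \<beta> z (word w)))"
    by (subst free_alg_sum) (simp add: b)
  also have "\<dots> = (\<Sum>w\<in>Poly_Mapping.keys f. smul (Poly_Mapping.lookup f w)
      (\<Sum>k\<le>N. smul (a k) ((contract ^^ k) \<beta> z (word w))))"
    using assms(2) by (intro sum.cong refl) (simp add: contract_series_homog[OF assms(1), where N = N] homog_word)
  also have "\<dots> = (\<Sum>k\<le>N. smul (a k) (\<Sum>w\<in>Poly_Mapping.keys f. smul (Poly_Mapping.lookup f w)
      ((contract ^^ k) \<beta> z (word w))))"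
    by (simp add: smul.scale_sum_right mult.commute sum.swap[of _ "{..N}"])
  also have "\<dots> = (\<Sum>k\<le>N. smul (a k) ((contract ^^ k) \<beta> z f))"
    by (subst (6) free_alg_sum) (simp add: b)
  finally show ?thesis .
qed

lemma left_mul_mem: "f \<in> sym_ideal \<Longrightarrow> left_mul z f \<in> sym_ideal"
  by (simp add: left_mul_def sym.mult_left_mem)

lemma ex_bound: "\<exists>N. \<forall>w\<in>Poly_Mapping.keys f. length w \<le> N"
  using finite_keys[of f] by (intro exI[of _ "Max (length ` Poly_Mapping.keys f)"]) auto

lemma pi_op_mem: "f \<in> sym_ideal \<Longrightarrow> pi_op z f \<in> sym_ideal"
proof -
  assume f: "f \<in> sym_ideal"
  obtain N where N: "\<forall>w\<in>Poly_Mapping.keys f. length w \<le> N"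
    using ex_bound by blast
  have "pi_op z f = (\<Sum>k\<le>N. smul (ccoef k) ((contract ^^ k) left_mul z f))"
    unfolding pi_op_def using N by (intro contract_series_bounded bilinear_left_mul) auto
  also have "\<dots> \<in> sym_ideal"
    by (intro sym.sum_mem two_sided_smul_mem sym.two_sided_ideal_axioms contract_pow_mem left_mul_mem f)
  finally show ?thesis .
qed

section \<open>The action of U(g) on S(g)\<close>

definition act :: "('k, 'g) free_alg \<Rightarrow> ('k, 'g) free_alg \<Rightarrow> ('k, 'g) free_alg" where
  "act u f = lin_ext smul (\<lambda>w. foldr pi_op w f) u"

lemma act_linear: "Vector_Spaces.linear smul smul (\<lambda>u. act u f)"
  unfolding act_def by (rule linear_lin_ext) unfold_locales

lemmas act_add = module_hom.add[OF module_hom_linearI[OF act_linear]]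
  and act_smul = module_hom.scale[OF module_hom_linearI[OF act_linear]]
  and act_diff = module_hom.diff[OF module_hom_linearI[OF act_linear]]
  and act_sum = module_hom.sum[OF module_hom_linearI[OF act_linear]]
  and act_zero = module_hom.zero[OF module_hom_linearI[OF act_linear]]

lemma act_word: "act (word w) f = foldr pi_op w f"
  by (simp add: act_def lin_ext_smul_word)

lemma act_add_right: "act u (f + g) = act u f + act u g" and act_smul_right: "act u (smul c f) = smul c (act u f)"
proof -
  have "foldr pi_op w (f + g) = foldr pi_op w f + foldr pi_op w g" "foldr pi_op w (smul c f) = smul c (foldr pi_op w f)" for w
    by (induction w) (simp_all add: bilinearD[OF bilinear_pi_op])
  then show "act u (f + g) = act u f + act u g" "act u (smul c f) = smul c (act u f)"
    by (induction u rule: free_alg_induct)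
       (simp_all add: act_zero act_add act_smul act_word smul.scale_right_distrib add_ac mult.commute)
qed

lemma act_zero_right: "act u 0 = 0"
  using act_smul_right[of u 0 0] by simp

lemma act_mult: "act (u * v) f = act u (act v f)"
proof (induction u rule: free_alg_induct)
  case (word w)
  show ?case
  proof (induction v rule: free_alg_induct)
    case (word w')
    then show ?case by (simp add: word_mult act_word)
  qed (simp_all add: act_zero act_add act_smul distrib_left smul_mult_right
        act_zero_right act_add_right act_smul_right)
qed (simp_all add: act_zero act_add act_smul distrib_right smul_mult_left)

lemma act_sym_mem: "f \<in> sym_ideal \<Longrightarrow> act u f \<in> sym_ideal"
proof (induction u rule: free_alg_induct)
  case (word w)
  then show ?case
    by (induction w) (simp_all add: act_word pi_op_mem)
qed (simp_all add: act_zero act_add act_smul sym.zero_mem sym.add_mem two_sided_smul_mem sym.two_sided_ideal_axioms)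

text \<open>On the commutation relations this is \<open>pi_op_bracket\<close>. The induction is over
  all \<open>f\<close>, since a right multiple first acts by its other factor; left multiples use
  \<open>act_sym_mem\<close>.\<close>

lemma act_env_mem: "u \<in> env_ideal \<Longrightarrow> act u f \<in> sym_ideal"
  unfolding env_ideal_def
proof (induction arbitrary: f rule: gen_ideal.induct)
  case (gen r)
  then consider "r \<in> linearity_relations scale UNIV" | "r \<in> env_relations V bracket" by blast
  then show ?case
  proof cases
    case 1
    then have "act r f = 0"
      by (auto simp: linearity_relations_def scalar_smul act_diff act_smul act_word bilinearD[OF bilinear_pi_op])
    then show ?thesis by (simp add: sym.zero_mem)
  next
    case 2
    then obtain x y p q where "r = word [x] * word [y] - scalar (koszul p q) * (word [y] * word [x])
        - word [bracket x y]" "x \<in> V p" "y \<in> V q"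
      by (auto simp: env_relations_def)
    then show ?thesis
      using pi_op_bracket by (simp add: word_mult scalar_smul act_diff act_smul act_word)
  qed
qed (simp_all add: act_zero act_add act_mult sym.zero_mem sym.add_mem act_sym_mem)

text \<open>The bracket of \<open>X i\<close> and \<open>X j\<close> is super-antisymmetric and the
  second derivative super-symmetric, so the double sum equals its own negative.\<close>

lemma contract_pow_basis:
  assumes "bilinear \<beta>"
  shows "(\<Sum>i\<in>Ix. (contract ^^ Suc k) \<beta> (X i) (der i f)) = 0"
proof -
  note b = bilinearD[OF bilinear_contract_pow[OF assms, of k]]
  have bneg: "(contract ^^ k) \<beta> (- z) g = - (contract ^^ k) \<beta> z g" for z g
    using b(4)[of "- 1" z g] by (simp add: smul_minus_one)
  let ?S = "\<Sum>i\<in>Ix. \<Sum>j\<in>Ix. (contract ^^ k) \<beta> (bracket (X i) (X j)) (der j (der i f))"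
  have "?S = (\<Sum>j\<in>Ix. \<Sum>i\<in>Ix. (contract ^^ k) \<beta> (bracket (X i) (X j)) (der j (der i f)))"
    by (rule sum.swap)
  also have "\<dots> = (\<Sum>j\<in>Ix. \<Sum>i\<in>Ix. - (contract ^^ k) \<beta> (bracket (X j) (X i)) (der i (der j f)))"
  proof (rule sum.cong[OF refl], rule sum.cong[OF refl])
    fix j i assume ij: "j \<in> Ix" "i \<in> Ix"
    have a: "bracket (X i) (X j) = scale (- koszul (par i) (par j)) (bracket (X j) (X i))"
      using super_antisymmetry[OF basis_mem[OF ij(2)] basis_mem[OF ij(1)]] by simp
    show "(contract ^^ k) \<beta> (bracket (X i) (X j)) (der j (der i f)) = - (contract ^^ k) \<beta> (bracket (X j) (X i)) (der i (der j f))"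
      unfolding a by (subst der_der[OF ij]) (simp add: b bneg koszul_commute[of "par j" "par i"])
  qed
  also have "\<dots> = - ?S"
    by (simp add: sum_negf)
  finally have "?S + ?S = 0"
    unfolding eq_neg_iff_add_eq_0 .
  then have "smul (1 + 1) ?S = 0"
    by (simp only: smul.scale_left_distrib smul.scale_one)
  then have "?S = 0"
    by simp
  then show ?thesis
    by (simp add: contract_Suc del: funpow.simps)
qed

text \<open>Euler's formula for \<sigma> and induction reduce the claim to the sum of
  \<open>pi_op (X i) (der i f)\<close>. By \<open>contract_pow_basis\<close> only the constant term
  of the Bernoulli series survives there, and the other Euler formula, \<open>euler\<close>,
  evaluates the result.\<close>

lemma act_symmetrise_homog: "homog s f \<Longrightarrow> act (symmetrise f) 1 - f \<in> sym_ideal"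
proof (induction s arbitrary: f)
  case 0
  then obtain c where "f = smul c 1"
    using homog_0_iff by blast
  then show ?case
    using 0 act_word[of "[]" 1] by (simp add: symmetrise_homog_0 act_smul word_Nil sym.zero_mem)
next
  case (Suc s)
  let ?c = "of_nat (Suc s) :: 'k"
  have "smul ?c (act (symmetrise f) 1) = act (\<Sum>i\<in>Ix. word [X i] * symmetrise (der i f)) 1"
    by (simp only: symmetrise_recursion[OF Suc.prems] act_smul)
  also have "\<dots> = (\<Sum>i\<in>Ix. pi_op (X i) (act (symmetrise (der i f)) 1))"
    by (simp add: act_sum act_mult act_word)
  also have "\<dots> - (\<Sum>i\<in>Ix. pi_op (X i) (der i f)) \<in> sym_ideal"
  proof (rule sym.cong_sum)
    fix i
    have "pi_op (X i) (act (symmetrise (der i f)) 1 - der i f) \<in> sym_ideal"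
      by (intro pi_op_mem Suc.IH homog_der Suc.prems)
    moreover have "pi_op z (g - h) = pi_op z g - pi_op z h" for z g h
      using bilinearD(1)[OF bilinear_pi_op, of z "g - h" h] by simp
    ultimately show "pi_op (X i) (act (symmetrise (der i f)) 1) - pi_op (X i) (der i f) \<in> sym_ideal"
      by simp
  qed
  also have "(\<Sum>i\<in>Ix. pi_op (X i) (der i f)) = (\<Sum>i\<in>Ix. left_mul (X i) (der i f))"
  proof -
    have "(\<Sum>i\<in>Ix. pi_op (X i) (der i f)) = (\<Sum>i\<in>Ix. \<Sum>k\<le>s. smul (ccoef k) ((contract ^^ k) left_mul (X i) (der i f)))"
      unfolding pi_op_def by (intro sum.cong refl contract_series_homog[OF bilinear_left_mul homog_der[OF Suc.prems]]) simp
    also have "\<dots> = (\<Sum>k\<le>s. smul (ccoef k) (\<Sum>i\<in>Ix. (contract ^^ k) left_mul (X i) (der i f)))"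
      by (subst sum.swap) (simp add: smul.scale_sum_right)
    also have "\<dots> = (\<Sum>k\<in>{0}. smul (ccoef k) (\<Sum>i\<in>Ix. (contract ^^ k) left_mul (X i) (der i f)))"
    proof (rule sum.mono_neutral_right)
      show "\<forall>k\<in>{..s} - {0}. smul (ccoef k) (\<Sum>i\<in>Ix. (contract ^^ k) left_mul (X i) (der i f)) = 0"
      proof
        fix k assume "k \<in> {..s} - {0}"
        then obtain l where "k = Suc l"
          using not0_implies_Suc by blast
        then show "smul (ccoef k) (\<Sum>i\<in>Ix. (contract ^^ k) left_mul (X i) (der i f)) = 0"
          by (simp only: contract_pow_basis[OF bilinear_left_mul] smul.scale_zero_right)
      qed
    qed auto
    finally show ?thesis by (simp add: ccoef_def)
  qed
  also have "(\<Sum>i\<in>Ix. left_mul (X i) (der i f)) = (\<Sum>i\<in>Ix. word [X i] * der i f)"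
    by (simp add: left_mul_def emb_basis)
  also have "\<dots> - smul ?c f \<in> sym_ideal"
    by (rule euler[OF Suc.prems])
  finally have "smul (1 / ?c) (smul ?c (act (symmetrise f) 1)) - smul (1 / ?c) (smul ?c f) \<in> sym_ideal"
    by (rule sym_smul_cong)
  moreover have "?c \<noteq> 0" by (rule of_nat_neq_0)
  ultimately show ?case
    by (simp del: of_nat_Suc)
qed

lemma act_symmetrise: "act (symmetrise f) 1 - f \<in> sym_ideal"
proof (induction f rule: free_alg_induct)
  case zero
  then show ?case by (simp add: symmetrise_zero act_zero sym.zero_mem)
next
  case (add f g)
  then show ?case using sym.cong_add[OF add] by (simp add: symmetrise_add act_add)
next
  case (smul c f)
  then show ?case using sym_smul_cong[OF smul] by (simp add: symmetrise_smul act_smul)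
next
  case (word w)
  then show ?case by (intro act_symmetrise_homog[of "length w"]) (simp add: homog_word)
qed

lemma symmetrise_inj: "symmetrise f \<in> env_ideal \<Longrightarrow> f \<in> sym_ideal"
  using sym.diff_mem[OF act_env_mem act_symmetrise, of "symmetrise f" 1 f] by simp

end


subsection \<open>Symmetrisation without a basis\<close>

text \<open>
  \<open>pr q\<close> projects onto the part of parity \<open>q\<close>; \<open>tw q\<close> is the sign picked up by a letter when a
  letter of parity \<open>q\<close> moves past it. Only their values on \<open>V 0\<close> and \<open>V 1\<close> matter, but totality
  and linearity on the whole type spare carrier conditions.
\<close>

locale super_projection = vector_space scale
  for scale :: "'k::field_char_0 \<Rightarrow> 'v::ab_group_add \<Rightarrow> 'v" +
  fixes V :: "bit \<Rightarrow> 'v set" and pr tw :: "bit \<Rightarrow> 'v \<Rightarrow> 'v"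
  assumes pr_comb: "pr q (u + scale c v) = pr q u + scale c (pr q v)"
    and tw_comb: "tw q (u + scale c v) = tw q u + scale c (tw q v)"
    and pr_part: "v \<in> V p \<Longrightarrow> pr q v = (if p = q then v else 0)"
    and tw_part: "v \<in> V p \<Longrightarrow> tw q v = scale (koszul q p) v"
    and add_mem: "u \<in> V p \<Longrightarrow> v \<in> V p \<Longrightarrow> u + v \<in> V p"
    and scale_mem: "v \<in> V p \<Longrightarrow> scale c v \<in> V p"
    and zero_mem: "0 \<in> V p"
begin

text \<open>\<open>ext \<beta> w\<close> sums over all ways of pulling one letter of \<open>w\<close> to the front.\<close>

fun ext :: "(bit \<Rightarrow> 'v \<Rightarrow> 'v list \<Rightarrow> ('k, 'v) free_alg) \<Rightarrow> 'v list \<Rightarrow> ('k, 'v) free_alg" where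
  "ext \<beta> [] = 0"
| "ext \<beta> (v # w) = \<beta> 0 (pr 0 v) w + \<beta> 1 (pr 1 v) w + ext (\<lambda>q u w'. \<beta> q u (tw q v # w')) w"

text \<open>The counterpart of \<open>euler_sym\<close>, with the pulled-out letter in place of the
  basis vector and its derivative. The value 1 at \<open>0\<close> is meant for the empty word;
  \<open>n\<close> is always the length of \<open>w\<close>.\<close>

primrec word_sym :: "nat \<Rightarrow> 'v list \<Rightarrow> ('k, 'v) free_alg" where
  "word_sym 0 w = 1"
| "word_sym (Suc n) w = smul (1 / of_nat (Suc n)) (ext (\<lambda>q u w'. word [u] * word_sym n w') w)"

definition free_sym :: "('k, 'v) free_alg \<Rightarrow> ('k, 'v) free_alg" where
  "free_sym = lin_ext smul (\<lambda>w. word_sym (length w) w)"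

text \<open>Only the relations of the tensor algebra: congruences modulo this ideal survive
  evaluation in any algebra along a linear map, be it U(g) or End(g).\<close>

definition T :: "('k, 'v) free_alg set" where
  "T = gen_ideal (linearity_relations scale UNIV)"

sublocale T: two_sided_ideal T
  unfolding T_def by (rule two_sided_ideal_gen_ideal)

lemmas T_smul_cong = two_sided_smul_cong[OF T.two_sided_ideal_axioms]

lemma letter_comb: "word [u + scale c v] - (word [u] + smul c (word [v])) \<in> T"
proof -
  have "word [u + w] - word [u] - word [w] \<in> linearity_relations scale UNIV"
    "word [scale c v] - scalar c * word [v] \<in> linearity_relations scale UNIV" for w
    unfolding linearity_relations_def by blast+
  then have "word [u + scale c v] - word [u] - word [scale c v] \<in> T"
    "word [scale c v] - smul c (word [v]) \<in> T"
    unfolding T_def smul_def by (auto intro: gen_ideal.gen)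
  from T.add_mem[OF this] show ?thesis
    by (simp add: algebra_simps)
qed

lemma letter_zero: "word [0] \<in> T"
  using letter_comb[of 0 1 0] T.neg_mem by fastforce

text \<open>A letter pulled out of \<open>b\<close> passes all of \<open>a\<close>, which twists
  every letter of \<open>a\<close>.\<close>

lemma ext_append: "ext \<beta> (a @ b) = ext (\<lambda>q u w. \<beta> q u (w @ b)) a + ext (\<lambda>q u w. \<beta> q u (map (tw q) a @ w)) b"
  by (induction a arbitrary: \<beta>) (simp_all add: add_ac)

lemma ext_comb: "ext (\<lambda>q u w. \<beta> q u w + smul c (\<gamma> q u w)) w = ext \<beta> w + smul c (ext \<gamma> w)"
  by (induction w arbitrary: \<beta> \<gamma>) (simp_all add: smul.scale_right_distrib add_ac)

lemma ext_smul: "ext (\<lambda>q u w. smul c (\<gamma> q u w)) w = smul c (ext \<gamma> w)"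
  by (induction w arbitrary: \<gamma>) (simp_all add: smul.scale_right_distrib)

lemma ext_cong_mod:
  "(\<And>q u w'. Suc (length w') = length w \<Longrightarrow> \<beta> q u w' - \<gamma> q u w' \<in> T) \<Longrightarrow> ext \<beta> w - ext \<gamma> w \<in> T"
proof (induction w arbitrary: \<beta> \<gamma>)
  case (Cons v w)
  have "ext (\<lambda>q u w'. \<beta> q u (tw q v # w')) w - ext (\<lambda>q u w'. \<gamma> q u (tw q v # w')) w \<in> T"
    by (intro Cons.IH Cons.prems) simp
  then show ?case
    unfolding ext.simps by (intro T.cong_add Cons.prems) simp_all
qed (simp add: T.zero_mem)

text \<open>The letter pulled to the front lies in \<open>a\<close> (\<open>?A\<close>), is the
  combined letter itself (\<open>?B\<close>), or lies in \<open>b\<close> (\<open>?C\<close>). The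
  middle case uses the linearity relations, the outer ones the induction hypothesis.\<close>

lemma word_sym_comb:
  "Suc (length a + length b) = n \<Longrightarrow>
    word_sym n (a @ (u + scale c v) # b) - (word_sym n (a @ u # b) + smul c (word_sym n (a @ v # b))) \<in> T"
proof (induction n arbitrary: a b u v)
  case (Suc n)
  let ?\<beta> = "\<lambda>q x w. word [x] * word_sym n w"
  let ?A = "\<lambda>x. ext (\<lambda>q y w. ?\<beta> q y (w @ x # b)) a"
  let ?B = "\<lambda>q x. ?\<beta> q (pr q x) (map (tw q) a @ b)"
  let ?C = "\<lambda>x. ext (\<lambda>q y w. ?\<beta> q y (map (tw q) a @ tw q x # w)) b"
  let ?x = "u + scale c v"
  have e: "word_sym (Suc n) (a @ x # b) = smul (1 / of_nat (Suc n)) (?A x + (?B 0 x + ?B 1 x + ?C x))" for x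
    unfolding word_sym.simps ext_append ext.simps by simp
  have "?A ?x - ext (\<lambda>q y w. ?\<beta> q y (w @ u # b) + smul c (?\<beta> q y (w @ v # b))) a \<in> T"
  proof (rule ext_cong_mod)
    fix y and w :: "'v list" assume "Suc (length w) = length a"
    then have "word [y] * word_sym n (w @ ?x # b) - word [y] * (word_sym n (w @ u # b) + smul c (word_sym n (w @ v # b))) \<in> T"
      using Suc.prems by (intro T.cong_mult_left Suc.IH) simp
    then show "word [y] * word_sym n (w @ ?x # b) - (word [y] * word_sym n (w @ u # b) + smul c (word [y] * word_sym n (w @ v # b))) \<in> T"
      by (simp add: distrib_left smul_mult_right)
  qed
  then have A: "?A ?x - (?A u + smul c (?A v)) \<in> T"
    by (simp add: ext_comb)
  have "?C ?x - ext (\<lambda>q y w. ?\<beta> q y (map (tw q) a @ tw q u # w) + smul c (?\<beta> q y (map (tw q) a @ tw q v # w))) b \<in> T"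
  proof (rule ext_cong_mod)
    fix q y and w :: "'v list" assume "Suc (length w) = length b"
    then have "word [y] * word_sym n (map (tw q) a @ (tw q u + scale c (tw q v)) # w)
        - word [y] * (word_sym n (map (tw q) a @ tw q u # w) + smul c (word_sym n (map (tw q) a @ tw q v # w))) \<in> T"
      using Suc.prems by (intro T.cong_mult_left Suc.IH) simp
    then show "word [y] * word_sym n (map (tw q) a @ tw q ?x # w)
        - (word [y] * word_sym n (map (tw q) a @ tw q u # w) + smul c (word [y] * word_sym n (map (tw q) a @ tw q v # w))) \<in> T"
      by (simp add: tw_comb distrib_left smul_mult_right)
  qed
  then have C: "?C ?x - (?C u + smul c (?C v)) \<in> T"
    by (simp add: ext_comb)
  have B: "?B q ?x - (?B q u + smul c (?B q v)) \<in> T" for q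
    using T.cong_mult_right[OF letter_comb[of "pr q u" c "pr q v"], of "word_sym n (map (tw q) a @ b)"]
    by (simp add: pr_comb distrib_right smul_mult_left)
  have "smul (1 / of_nat (Suc n)) (?A ?x + (?B 0 ?x + ?B 1 ?x + ?C ?x))
      - smul (1 / of_nat (Suc n)) ((?A u + smul c (?A v)) + ((?B 0 u + smul c (?B 0 v)) + (?B 1 u + smul c (?B 1 v))
        + (?C u + smul c (?C v)))) \<in> T"
    by (intro T_smul_cong T.cong_add A B C)
  also have "smul (1 / of_nat (Suc n)) ((?A u + smul c (?A v)) + ((?B 0 u + smul c (?B 0 v)) + (?B 1 u + smul c (?B 1 v))
        + (?C u + smul c (?C v)))) = word_sym (Suc n) (a @ u # b) + smul c (word_sym (Suc n) (a @ v # b))"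
    unfolding e smul.scale_right_distrib smul.scale_scale mult.commute[of c] by (simp only: add_ac)
  finally show ?case
    unfolding e .
qed simp

lemma word_sym_zero: "Suc (length a + length b) = n \<Longrightarrow> word_sym n (a @ 0 # b) \<in> T"
  using word_sym_comb[of a b n 0 "-1" 0] by (simp add: smul_minus_one)

lemma word_sym_scale:
  assumes "Suc (length a + length b) = n"
  shows "word_sym n (a @ scale c v # b) - smul c (word_sym n (a @ v # b)) \<in> T"
  using T.add_mem[OF word_sym_comb[OF assms, of 0 c v] word_sym_zero[OF assms]] by simp

lemma tw_mem: "v \<in> V p \<Longrightarrow> tw q v \<in> V p"
  by (simp add: tw_part scale_mem)

lemma letter_pr_mult:
  assumes "v \<in> V p"
  shows "word [pr 0 v] * f 0 + word [pr 1 v] * f 1 - word [v] * f p \<in> T"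
  using assms T.mult_right_mem[OF letter_zero] by (cases p) (simp_all add: pr_part)

text \<open>If the pulled letter lies in \<open>a\<close> or \<open>b\<close>, the induction
  hypothesis applies. Pulling \<open>u\<close> on one side corresponds to pulling \<open>u\<close>
  on the other, where it also passes \<open>v\<close> and acquires exactly the sign
  \<open>?k\<close>; likewise for \<open>v\<close>.\<close>

lemma word_sym_swap:
  assumes "u \<in> V p" "v \<in> V q" "length a + length b + 2 = n"
  shows "word_sym n (a @ u # v # b) - smul (koszul p q) (word_sym n (a @ v # u # b)) \<in> T"
  using assms
proof (induction n arbitrary: a b u v)
  case (Suc n)
  let ?\<beta> = "\<lambda>q x w. word [x] * word_sym n w"
  let ?k = "koszul p q :: 'k"
  let ?A = "\<lambda>u v. ext (\<lambda>q y w. ?\<beta> q y (w @ u # v # b)) a"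
  let ?B = "\<lambda>u v q. word_sym n (map (tw q) a @ v # b)"
  let ?B' = "\<lambda>u v q. word_sym n (map (tw q) a @ tw q u # b)"
  let ?C = "\<lambda>u v. ext (\<lambda>q y w. ?\<beta> q y (map (tw q) a @ tw q u # tw q v # w)) b"
  let ?r = "1 / of_nat (Suc n) :: 'k"
  have e: "word_sym (Suc n) (a @ u # v # b) = smul ?r (?A u v
      + ((word [pr 0 u] * ?B u v 0 + word [pr 1 u] * ?B u v 1)
        + ((word [pr 0 v] * ?B' u v 0 + word [pr 1 v] * ?B' u v 1) + ?C u v)))" for u v
    unfolding word_sym.simps ext_append ext.simps by (simp add: add_ac)
  have A: "?A u v - smul ?k (?A v u) \<in> T"
    unfolding ext_smul[symmetric]
  proof (rule ext_cong_mod)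
    fix y and w :: "'v list" assume "Suc (length w) = length a"
    then have "word [y] * word_sym n (w @ u # v # b) - word [y] * smul ?k (word_sym n (w @ v # u # b)) \<in> T"
      using Suc.prems by (intro T.cong_mult_left Suc.IH) simp_all
    then show "word [y] * word_sym n (w @ u # v # b) - smul ?k (word [y] * word_sym n (w @ v # u # b)) \<in> T"
      by (simp add: smul_mult_right)
  qed
  have C: "?C u v - smul ?k (?C v u) \<in> T"
    unfolding ext_smul[symmetric]
  proof (rule ext_cong_mod)
    fix r y and w :: "'v list" assume "Suc (length w) = length b"
    then have "word [y] * word_sym n (map (tw r) a @ tw r u # tw r v # w)
        - word [y] * smul ?k (word_sym n (map (tw r) a @ tw r v # tw r u # w)) \<in> T"
      using Suc.prems by (intro T.cong_mult_left Suc.IH tw_mem) simp_all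
    then show "word [y] * word_sym n (map (tw r) a @ tw r u # tw r v # w)
        - smul ?k (word [y] * word_sym n (map (tw r) a @ tw r v # tw r u # w)) \<in> T"
      by (simp add: smul_mult_right)
  qed
  have B: "(word [pr 0 u] * ?B u v 0 + word [pr 1 u] * ?B u v 1) - word [u] * ?B u v p \<in> T"
    "(word [pr 0 v] * ?B v u 0 + word [pr 1 v] * ?B v u 1) - word [v] * ?B v u q \<in> T"
    by (intro letter_pr_mult Suc.prems)+
  have "word [v] * ?B' u v q - word [v] * smul ?k (?B v u q) \<in> T"
    unfolding tw_part[OF Suc.prems(1)] koszul_commute[of q p]
    using Suc.prems by (intro T.cong_mult_left word_sym_scale) simp
  with letter_pr_mult[OF Suc.prems(2)]
  have B1: "(word [pr 0 v] * ?B' u v 0 + word [pr 1 v] * ?B' u v 1) - word [v] * smul ?k (?B v u q) \<in> T"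
    by (rule T.cong_trans)
  have "word [u] * ?B' v u p - word [u] * smul ?k (?B u v p) \<in> T"
    unfolding tw_part[OF Suc.prems(2)]
    using Suc.prems by (intro T.cong_mult_left word_sym_scale) simp
  with letter_pr_mult[OF Suc.prems(1)]
  have B2: "(word [pr 0 u] * ?B' v u 0 + word [pr 1 u] * ?B' v u 1) - word [u] * smul ?k (?B u v p) \<in> T"
    by (rule T.cong_trans)
  have "word_sym (Suc n) (a @ u # v # b) - smul ?r (smul ?k (?A v u) + (word [u] * ?B u v p
      + (word [v] * smul ?k (?B v u q) + smul ?k (?C v u)))) \<in> T"
    unfolding e by (intro T_smul_cong T.cong_add A B B1 C)
  also have "smul ?r (smul ?k (?A v u) + (word [u] * ?B u v p
        + (word [v] * smul ?k (?B v u q) + smul ?k (?C v u))))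
      = smul ?k (smul ?r (?A v u + (word [v] * ?B v u q + (word [u] * smul ?k (?B u v p) + ?C v u))))"
  proof -
    have "smul ?k (word [u] * smul ?k (?B u v p)) = word [u] * ?B u v p"
      by (simp add: smul_mult_right)
    then have "smul ?k (?A v u + (word [v] * ?B v u q + (word [u] * smul ?k (?B u v p) + ?C v u)))
      = smul ?k (?A v u) + (word [u] * ?B u v p + (word [v] * smul ?k (?B v u q) + smul ?k (?C v u)))"
      by (simp add: smul.scale_right_distrib smul_mult_right add_ac)
    then show ?thesis
      by (metis (no_types, lifting) smul.scale_left_commute)
  qed
  also have "\<dots> - smul ?k (word_sym (Suc n) (a @ v # u # b)) \<in> T"
    unfolding e by (rule T_smul_cong, rule T.cong_sym) (intro T_smul_cong T.cong_add T.cong_refl B B2)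
  finally show ?case .
qed simp

lemma free_sym_linear: "Vector_Spaces.linear smul smul free_sym"
  unfolding free_sym_def by (rule linear_lin_ext) unfold_locales

lemmas free_sym_add = module_hom.add[OF module_hom_linearI[OF free_sym_linear]]
  and free_sym_smul = module_hom.scale[OF module_hom_linearI[OF free_sym_linear]]
  and free_sym_diff = module_hom.diff[OF module_hom_linearI[OF free_sym_linear]]
  and free_sym_zero = module_hom.zero[OF module_hom_linearI[OF free_sym_linear]]

lemma free_sym_word: "free_sym (word w) = word_sym (length w) w"
  by (simp add: free_sym_def lin_ext_smul_word)

lemma free_sym_mem: "f \<in> gen_ideal (linearity_relations scale UNIV \<union> sym_relations V) \<Longrightarrow> free_sym f \<in> T"
proof -
  \<comment> \<open>Strengthened by words on both sides, since \<open>free_sym\<close> is not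
    multiplicative and an ideal contains all such multiples.\<close>
  have "free_sym (word a * f * word b) \<in> T"
    if "f \<in> gen_ideal (linearity_relations scale UNIV \<union> sym_relations V)" for f a b
    using that
  proof (induction arbitrary: a b rule: gen_ideal.induct)
    case zero
    then show ?case by (simp add: free_sym_zero T.zero_mem)
  next
    case (gen r)
    then consider (add) u v where "r = word [u + v] - word [u] - word [v]"
      | (scale) c v where "r = word [scale c v] - smul c (word [v])"
      | (sym) u v p q where "u \<in> V p" "v \<in> V q" "r = word [u] * word [v] - smul (koszul p q) (word [v] * word [u])"
      unfolding linearity_relations_def sym_relations_def smul_def by blast
    then show ?case
    proof cases
      case add
      have "word a * r * word b = word (a @ (u + scale 1 v) # b) - word (a @ u # b) - word (a @ v # b)"
        unfolding add by (simp add: algebra_simps word_mult)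
      then show ?thesis
        using word_sym_comb[of a b "Suc (length a + length b)" u 1 v] by (simp add: free_sym_diff free_sym_add free_sym_word diff_diff_add)
    next
      case scale
      have "word a * r * word b = word (a @ scale c v # b) - smul c (word (a @ v # b))"
        unfolding scale by (simp add: algebra_simps word_mult smul_mult_left smul_mult_right)
      then show ?thesis
        using word_sym_scale[of a b "Suc (length a + length b)" c v] by (simp add: free_sym_diff free_sym_smul free_sym_word)
    next
      case sym
      have "word a * r * word b = word (a @ u # v # b) - smul (koszul p q) (word (a @ v # u # b))"
        unfolding sym by (simp add: algebra_simps word_mult smul_mult_left smul_mult_right)
      then show ?thesis
        using word_sym_swap[OF sym(1,2), of a b "length a + length b + 2"] by (simp add: free_sym_diff free_sym_smul free_sym_word)
    qed
  next
    case (add f g)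
    then show ?case
      using T.add_mem by (simp add: distrib_left distrib_right free_sym_add)
  next
    case (mult_left f g)
    show ?case
    proof (induction g rule: free_alg_induct)
      case (word w)
      then show ?case
        using mult_left.IH[of "a @ w" b] by (simp add: word_mult flip: mult.assoc)
    qed (simp_all add: distrib_left distrib_right free_sym_zero free_sym_add free_sym_smul T.zero_mem T.add_mem
        smul_mult_left smul_mult_right two_sided_smul_mem[OF T.two_sided_ideal_axioms])
  next
    case (mult_right f g)
    show ?case
    proof (induction g rule: free_alg_induct)
      case (word w)
      then show ?case
        using mult_right.IH[of a "w @ b"] by (simp add: word_mult mult.assoc)
    qed (simp_all add: distrib_left distrib_right free_sym_zero free_sym_add free_sym_smul T.zero_mem T.add_mem
        smul_mult_left smul_mult_right two_sided_smul_mem[OF T.two_sided_ideal_axioms])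
  qed
  from this[of f "[]" "[]"] show "f \<in> gen_ideal (linearity_relations scale UNIV \<union> sym_relations V) \<Longrightarrow> free_sym f \<in> T"
    by (simp add: word_Nil)
qed


subsection \<open>The permutation formula\<close>

text \<open>Positions increase along \<open>xs\<close>, so the letter at \<open>x\<close> passes
  exactly those at smaller positions. The two assumptions on \<open>\<beta>\<close> discard the
  vanishing parity component and extract the scalars produced by \<open>tw\<close>.\<close>

lemma ext_sorted:
  fixes L :: "nat \<Rightarrow> 'v" and P :: "nat \<Rightarrow> bit"
  assumes "sorted_wrt (<) xs" "\<And>x. x \<in> set xs \<Longrightarrow> L x \<in> V (P x)"
    and "\<And>q w. \<beta> q 0 w \<in> T"
    and "\<And>q u a c v b. Suc (Suc (length a + length b)) = length xs \<Longrightarrow> \<beta> q u (a @ scale c v # b) - smul c (\<beta> q u (a @ v # b)) \<in> T"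
  shows "ext \<beta> (map L xs) - (\<Sum>x\<in>set xs. smul (\<Prod>y | y \<in> set xs \<and> y < x. koszul (P y) (P x))
      (\<beta> (P x) (L x) (map L (remove1 x xs)))) \<in> T"
  using assms
proof (induction xs arbitrary: \<beta>)
  case (Cons x xs)
  let ?k = "\<lambda>xs x. (\<Prod>y | y \<in> set xs \<and> y < x. koszul (P y) (P x)) :: 'k"
  have lx: "L x \<in> V (P x)" and xs: "\<And>y. y \<in> set xs \<Longrightarrow> x < y"
    using Cons.prems by auto
  have "\<beta> 0 (pr 0 (L x)) (map L xs) + \<beta> 1 (pr 1 (L x)) (map L xs) - \<beta> (P x) (L x) (map L xs) \<in> T"
    using lx Cons.prems(3) by (cases "P x") (simp_all add: pr_part)
  moreover have "ext (\<lambda>q u w'. \<beta> q u (tw q (L x) # w')) (map L xs)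
      - (\<Sum>y\<in>set xs. smul (?k (x # xs) y) (\<beta> (P y) (L y) (L x # map L (remove1 y xs)))) \<in> T"
  proof -
    have "ext (\<lambda>q u w'. \<beta> q u (tw q (L x) # w')) (map L xs)
      - (\<Sum>y\<in>set xs. smul (?k xs y) (\<beta> (P y) (L y) (tw (P y) (L x) # map L (remove1 y xs)))) \<in> T"
    proof (rule Cons.IH)
      fix q u c v and a b :: "'v list" assume "Suc (Suc (length a + length b)) = length xs"
      then show "\<beta> q u (tw q (L x) # a @ scale c v # b) - smul c (\<beta> q u (tw q (L x) # a @ v # b)) \<in> T"
        using Cons.prems(4)[of "tw q (L x) # a" b] by simp
    qed (use Cons.prems in auto)
    also have "(\<Sum>y\<in>set xs. smul (?k xs y) (\<beta> (P y) (L y) (tw (P y) (L x) # map L (remove1 y xs))))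
      - (\<Sum>y\<in>set xs. smul (?k (x # xs) y) (\<beta> (P y) (L y) (L x # map L (remove1 y xs)))) \<in> T"
    proof (rule T.cong_sum)
      fix y assume y: "y \<in> set xs"
      have "{z. z \<in> set (x # xs) \<and> z < y} = insert x {z. z \<in> set xs \<and> z < y}" "x \<notin> {z. z \<in> set xs \<and> z < y}"
        using xs y by auto
      then have k: "?k (x # xs) y = ?k xs y * koszul (P y) (P x)"
        by (simp add: koszul_commute[of "P x"] mult.commute)
      have "\<beta> (P y) (L y) ([] @ scale (koszul (P y) (P x)) (L x) # map L (remove1 y xs))
          - smul (koszul (P y) (P x)) (\<beta> (P y) (L y) ([] @ L x # map L (remove1 y xs))) \<in> T"
        by (rule Cons.prems(4)) (use y length_pos_if_in_set[OF y] in \<open>auto simp: length_remove1\<close>)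
      then show "smul (?k xs y) (\<beta> (P y) (L y) (tw (P y) (L x) # map L (remove1 y xs)))
          - smul (?k (x # xs) y) (\<beta> (P y) (L y) (L x # map L (remove1 y xs))) \<in> T"
        unfolding k smul.scale_scale[symmetric] by (intro T_smul_cong) (simp add: tw_part[OF lx])
    qed
    finally show ?thesis .
  qed
  ultimately have "ext \<beta> (map L (x # xs)) - (\<beta> (P x) (L x) (map L xs)
      + (\<Sum>y\<in>set xs. smul (?k (x # xs) y) (\<beta> (P y) (L y) (L x # map L (remove1 y xs))))) \<in> T"
    using T.cong_add by simp
  also have "\<beta> (P x) (L x) (map L xs)
      + (\<Sum>y\<in>set xs. smul (?k (x # xs) y) (\<beta> (P y) (L y) (L x # map L (remove1 y xs))))
    = (\<Sum>y\<in>set (x # xs). smul (?k (x # xs) y) (\<beta> (P y) (L y) (map L (remove1 y (x # xs)))))"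
  proof -
    have 1: "x \<notin> set xs" using xs by blast
    have 2: "{y. (y = x \<or> y \<in> set xs) \<and> y < x} = {}" by (auto dest: xs)
    have 3: "(\<Sum>y\<in>set xs. smul (?k (x # xs) y) (\<beta> (P y) (L y) (map L (remove1 y (x # xs)))))
      = (\<Sum>y\<in>set xs. smul (?k (x # xs) y) (\<beta> (P y) (L y) (L x # map L (remove1 y xs))))"
      using 1 by (intro sum.cong refl) auto
    show ?thesis
      using 1 by (simp add: 2 3[simplified])
  qed
  finally show ?case .
qed (simp add: T.zero_mem)

text \<open>The Koszul sign of rearranging increasing positions into the order of the list: one
  factor for each inversion.\<close>

primrec perm_sign :: "(nat \<Rightarrow> bit) \<Rightarrow> nat list \<Rightarrow> 'k" where
  "perm_sign P [] = 1"
| "perm_sign P (x # xs) = (\<Prod>y | y \<in> set xs \<and> y < x. koszul (P y) (P x)) * perm_sign P xs"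

text \<open>The letter pulled first is the first entry of the rearrangement, and permutations of a
  nonempty set are classified by their first entry. The factorial absorbs the divisions in
  \<open>word_sym\<close>.\<close>

lemma word_sym_sorted:
  assumes "sorted_wrt (<) xs" "\<And>x. x \<in> set xs \<Longrightarrow> L x \<in> V (P x)" "length xs = n"
  shows "smul (fact n) (word_sym n (map L xs))
    - (\<Sum>ys\<in>permutations_of_set (set xs). smul (perm_sign P ys) (word (map L ys))) \<in> T"
  using assms
proof (induction n arbitrary: xs)
  case 0
  then show ?case by (simp add: word_Nil T.zero_mem)
next
  case (Suc n)
  let ?k = "\<lambda>x. (\<Prod>y | y \<in> set xs \<and> y < x. koszul (P y) (P x)) :: 'k"
  have dist: "distinct xs"
    using Suc.prems(1) strict_sorted_iff by blast
  have ne: "set xs \<noteq> {}" using Suc.prems(3) by auto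
  have "(of_nat (Suc n) :: 'k) \<noteq> 0" by (rule of_nat_neq_0)
  then have "smul (fact (Suc n)) (word_sym (Suc n) (map L xs)) = smul (fact n) (ext (\<lambda>q u w'. word [u] * word_sym n w') (map L xs))"
    by (simp del: of_nat_Suc add: fact_Suc)
  also have "\<dots> - smul (fact n) (\<Sum>x\<in>set xs. smul (?k x) (word [L x] * word_sym n (map L (remove1 x xs)))) \<in> T"
  proof (intro T_smul_cong ext_sorted Suc.prems)
    show "word [0] * word_sym n w \<in> T" for w
      by (intro T.mult_right_mem letter_zero)
    show "word [u] * word_sym n (a @ scale c v # b) - smul c (word [u] * word_sym n (a @ v # b)) \<in> T"
      if "Suc (Suc (length a + length b)) = length xs" for u a c v b
      using T.cong_mult_left[OF word_sym_scale[of a b n c v], of "word [u]"] that Suc.prems(3)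
      by (simp add: smul_mult_right)
  qed
  also have "smul (fact n) (\<Sum>x\<in>set xs. smul (?k x) (word [L x] * word_sym n (map L (remove1 x xs))))
      = (\<Sum>x\<in>set xs. smul (?k x) (word [L x] * smul (fact n) (word_sym n (map L (remove1 x xs)))))"
    by (simp add: smul.scale_sum_right smul_mult_right mult.commute)
  also have "\<dots> - (\<Sum>x\<in>set xs. smul (?k x) (word [L x] * (\<Sum>ys\<in>permutations_of_set (set xs - {x}).
      smul (perm_sign P ys) (word (map L ys))))) \<in> T"
  proof (intro T.cong_sum T_smul_cong T.cong_mult_left)
    fix x assume x: "x \<in> set xs"
    have sr: "set (remove1 x xs) = set xs - {x}"
      using dist by (rule set_remove1_eq)
    have "sorted_wrt (<) (remove1 x xs)"
      using Suc.prems(1) by (simp add: strict_sorted_iff sorted_remove1)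
    then show "smul (fact n) (word_sym n (map L (remove1 x xs)))
      - (\<Sum>ys\<in>permutations_of_set (set xs - {x}). smul (perm_sign P ys) (word (map L ys))) \<in> T"
      unfolding sr[symmetric]
      by (rule Suc.IH) (use Suc.prems x sr in \<open>auto simp: length_remove1\<close>)
  qed
  also have "(\<Sum>x\<in>set xs. smul (?k x) (word [L x] * (\<Sum>ys\<in>permutations_of_set (set xs - {x}).
      smul (perm_sign P ys) (word (map L ys)))))
    = (\<Sum>x\<in>set xs. \<Sum>ys\<in>permutations_of_set (set xs - {x}). smul (perm_sign P (x # ys)) (word (map L (x # ys))))"
  proof (intro sum.cong refl)
    fix x assume x: "x \<in> set xs"
    have "perm_sign P (x # ys) = ?k x * perm_sign P ys" if "ys \<in> permutations_of_set (set xs - {x})" for ys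
    proof -
      have "{y. y \<in> set ys \<and> y < x} = {y. y \<in> set xs \<and> y < x}"
        using that by (auto dest: permutations_of_setD)
      then show ?thesis by simp
    qed
    then show "smul (?k x) (word [L x] * (\<Sum>ys\<in>permutations_of_set (set xs - {x}). smul (perm_sign P ys) (word (map L ys))))
      = (\<Sum>ys\<in>permutations_of_set (set xs - {x}). smul (perm_sign P (x # ys)) (word (map L (x # ys))))"
      by (simp add: sum_distrib_left smul.scale_sum_right smul_mult_right word_mult del: perm_sign.simps)
  qed
  also have "\<dots> = (\<Sum>ys\<in>permutations_of_set (set xs). smul (perm_sign P ys) (word (map L ys)))"
  proof -
    have "(\<Sum>ys\<in>permutations_of_set (set xs). smul (perm_sign P ys) (word (map L ys)))
      = (\<Sum>x\<in>set xs. \<Sum>ys\<in>(#) x ` permutations_of_set (set xs - {x}). smul (perm_sign P ys) (word (map L ys)))"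
      unfolding permutations_of_set_nonempty[OF ne] by (rule sum.UNION_disjoint) auto
    then show ?thesis
      by (simp add: sum.reindex inj_on_def)
  qed
  finally show ?case .
qed

text \<open>\<open>koszul\<close> is -1 only on two odd letters, and \<open>p \<le> i\<close> with
  \<open>i < j\<close> says that both positions are odd.\<close>

lemma perm_sign_inversions:
  assumes "distinct xs"
  shows "perm_sign (\<lambda>x. if x < p then 0 else 1) xs
    = (- 1) ^ card {(i, j). p \<le> i \<and> i < j \<and> (\<exists>a b. a < b \<and> b < length xs \<and> xs ! a = j \<and> xs ! b = i)}"
  using assms
proof (induction xs)
  case (Cons x xs)
  let ?I = "\<lambda>xs. {(i, j). p \<le> i \<and> i < j \<and> (\<exists>a b. a < b \<and> b < length xs \<and> xs ! a = j \<and> xs ! b = i)}"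
  let ?N = "{i \<in> set xs. i < x \<and> p \<le> i}"
  have sub: "?I xs \<subseteq> set xs \<times> set xs"
    by auto
  then have fin: "finite (?I xs)"
    by (rule finite_subset) auto
  have split: "?I (x # xs) = (\<lambda>i. (i, x)) ` ?N \<union> ?I xs" (is "?l = ?r")
  proof (intro equalityI subrelI)
    fix i j assume "(i, j) \<in> ?l"
    then obtain a b where ab: "p \<le> i" "i < j" "a < b" "b < length (x # xs)" "(x # xs) ! a = j" "(x # xs) ! b = i"
      by auto
    then obtain b' where b: "b = Suc b'" using less_imp_Suc_add by blast
    show "(i, j) \<in> ?r"
    proof (cases a)
      case 0
      with ab b show ?thesis by auto
    next
      case (Suc a')
      with ab b have "a' < b' \<and> b' < length xs \<and> xs ! a' = j \<and> xs ! b' = i" by auto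
      with ab show ?thesis by blast
    qed
  next
    fix i j assume "(i, j) \<in> ?r"
    then show "(i, j) \<in> ?l"
    proof
      assume "(i, j) \<in> (\<lambda>i. (i, x)) ` ?N"
      then obtain b where "j = x" "i < x" "p \<le> i" "b < length xs" "xs ! b = i"
        by (auto simp: in_set_conv_nth)
      then have "0 < Suc b \<and> Suc b < length (x # xs) \<and> (x # xs) ! 0 = j \<and> (x # xs) ! Suc b = i" by simp
      with \<open>i < x\<close> \<open>j = x\<close> \<open>p \<le> i\<close> show ?thesis by blast
    next
      assume "(i, j) \<in> ?I xs"
      then obtain a b where ab: "p \<le> i" "i < j" "a < b" "b < length xs" "xs ! a = j" "xs ! b = i"
        by auto
      then have "Suc a < Suc b \<and> Suc b < length (x # xs) \<and> (x # xs) ! Suc a = j \<and> (x # xs) ! Suc b = i" by simp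
      with ab show ?thesis by blast
    qed
  qed
  have "card (?I (x # xs)) = card ?N + card (?I xs)"
    unfolding split using Cons.prems sub
    by (subst card_Un_disjoint) (auto simp: fin card_image inj_on_def)
  moreover have "(\<Prod>y | y \<in> set xs \<and> y < x. koszul (if y < p then 0 else 1) (if x < p then 0 else 1)) = ((- 1) ^ card ?N :: 'k)"
  proof -
    have "(\<Prod>y | y \<in> set xs \<and> y < x. koszul (if y < p then 0 else 1) (if x < p then 0 else 1))
        = (\<Prod>y\<in>?N. - 1 :: 'k)"
      by (rule prod.mono_neutral_cong_right) (auto simp: koszul_def)
    then show ?thesis by simp
  qed
  ultimately show ?case
    using Cons by (simp add: power_add)
qed simp

lemma permutations_as_lists:
  "permutations_of_set {..<r} = (\<lambda>\<tau>. map \<tau> [0..<r]) ` {\<tau>. \<tau> permutes {..<r}}"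
  "inj_on (\<lambda>\<tau>. map \<tau> [0..<r]) {\<tau>. \<tau> permutes {..<r}}"
proof -
  show inj: "inj_on (\<lambda>\<tau>. map \<tau> [0..<r]) {\<tau>. \<tau> permutes {..<r}}"
  proof (rule inj_onI, rule ext)
    fix \<sigma> \<tau> :: "nat \<Rightarrow> nat" and i
    assume "\<sigma> \<in> {\<tau>. \<tau> permutes {..<r}}" "\<tau> \<in> {\<tau>. \<tau> permutes {..<r}}" "map \<sigma> [0..<r] = map \<tau> [0..<r]"
    then show "\<sigma> i = \<tau> i"
      by (cases "i < r") (auto simp: permutes_not_in)
  qed
  have "map \<tau> [0..<r] \<in> permutations_of_set {..<r}" if "\<tau> permutes {..<r}" for \<tau>
    using permutes_image[OF that] permutes_inj_on[OF that, of "{0..<r}"]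
    by (intro permutations_of_setI) (auto simp: distinct_map atLeast0LessThan)
  then have "(\<lambda>\<tau>. map \<tau> [0..<r]) ` {\<tau>. \<tau> permutes {..<r}} = permutations_of_set {..<r}"
    by (intro card_subset_eq) (auto simp: card_image[OF inj] card_permutations)
  then show "permutations_of_set {..<r} = (\<lambda>\<tau>. map \<tau> [0..<r]) ` {\<tau>. \<tau> permutes {..<r}}" ..
qed

lemma inversions_permutation:
  assumes t: "\<tau> permutes {..<r::nat}"
  shows "{(i, j). p \<le> i \<and> i < j \<and> (\<exists>a b. a < b \<and> b < r \<and> \<tau> a = j \<and> \<tau> b = i)}
    = {(i, j). p \<le> i \<and> i < j \<and> j < r \<and> inv_into UNIV \<tau> i > inv_into UNIV \<tau> j}"
proof -
  have inv: "inv_into UNIV \<tau> (\<tau> a) = a" "\<tau> (inv_into UNIV \<tau> a) = a" for a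
    using permutes_inverses[OF t] by auto
  have lt: "\<tau> a < r \<longleftrightarrow> a < r" for a
    using permutes_in_image[OF t] by auto
  have "(\<exists>a b. a < b \<and> b < r \<and> \<tau> a = j \<and> \<tau> b = i) \<longleftrightarrow> j < r \<and> inv_into UNIV \<tau> i > inv_into UNIV \<tau> j"
    if "i < j" for i j
  proof
    assume "\<exists>a b. a < b \<and> b < r \<and> \<tau> a = j \<and> \<tau> b = i"
    then obtain a b where ab: "a < b" "b < r" "\<tau> a = j" "\<tau> b = i" by blast
    then have "a < r" by simp
    with ab show "j < r \<and> inv_into UNIV \<tau> i > inv_into UNIV \<tau> j"
      using inv lt by auto
  next
    assume "j < r \<and> inv_into UNIV \<tau> i > inv_into UNIV \<tau> j"
    then show "\<exists>a b. a < b \<and> b < r \<and> \<tau> a = j \<and> \<tau> b = i"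
      using inv(2)[of i] inv(2)[of j] lt[of "inv_into UNIV \<tau> i"] that
      by (intro exI[of _ "inv_into UNIV \<tau> j"] exI[of _ "inv_into UNIV \<tau> i"]) auto
  qed
  then show ?thesis by auto
qed

lemma free_sym_permutations:
  assumes "set as \<subseteq> V 0" "set bs \<subseteq> V 1"
  defines "r \<equiv> length as + length bs"
  shows "free_sym (word (as @ bs)) - smul (1 / fact r) (\<Sum>\<tau> | \<tau> permutes {..<r}.
      smul ((- 1) ^ odd_inversions (length as) r \<tau>) (word (map (\<lambda>i. (as @ bs) ! \<tau> i) [0..<r]))) \<in> T"
proof -
  let ?L = "\<lambda>i. (as @ bs) ! i" and ?P = "\<lambda>i. if i < length as then 0 else 1 :: bit"
  have "?L x \<in> V (?P x)" if "x < r" for x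
    using assms(1,2) nth_mem[of x as] nth_mem[of "x - length as" bs] that by (auto simp: nth_append r_def)
  then have "smul (fact r) (word_sym r (map ?L [0..<r]))
      - (\<Sum>ys\<in>permutations_of_set (set [0..<r]). smul (perm_sign ?P ys) (word (map ?L ys))) \<in> T"
    by (intro word_sym_sorted) auto
  also have "(\<Sum>ys\<in>permutations_of_set (set [0..<r]). smul (perm_sign ?P ys) (word (map ?L ys)))
      = (\<Sum>\<tau> | \<tau> permutes {..<r}. smul (perm_sign ?P (map \<tau> [0..<r])) (word (map ?L (map \<tau> [0..<r]))))"
    by (simp add: atLeast0LessThan permutations_as_lists(1) sum.reindex[OF permutations_as_lists(2)])
  also have "\<dots> = (\<Sum>\<tau> | \<tau> permutes {..<r}. smul ((- 1) ^ odd_inversions (length as) r \<tau>)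
      (word (map (\<lambda>i. (as @ bs) ! \<tau> i) [0..<r])))"
  proof (rule sum.cong[OF refl])
    fix \<tau> assume "\<tau> \<in> {\<tau>. \<tau> permutes {..<r}}"
    then have t: "\<tau> permutes {..<r}" by simp
    have "(\<exists>a b. a < b \<and> b < length (map \<tau> [0..<r]) \<and> map \<tau> [0..<r] ! a = j \<and> map \<tau> [0..<r] ! b = i)
      \<longleftrightarrow> (\<exists>a b. a < b \<and> b < r \<and> \<tau> a = j \<and> \<tau> b = i)" for i j
      by (rule ex_cong1, rule ex_cong1) auto
    moreover have "distinct (map \<tau> [0..<r])"
      using permutes_inj_on[OF t] by (simp add: distinct_map)
    ultimately have "perm_sign ?P (map \<tau> [0..<r]) = (- 1) ^ odd_inversions (length as) r \<tau>"
      by (simp only: perm_sign_inversions inversions_permutation[OF t] odd_inversions_def)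
    then show "smul (perm_sign ?P (map \<tau> [0..<r])) (word (map ?L (map \<tau> [0..<r])))
      = smul ((- 1) ^ odd_inversions (length as) r \<tau>) (word (map (\<lambda>i. (as @ bs) ! \<tau> i) [0..<r]))"
      by (simp add: o_def)
  qed
  finally have "smul (1 / fact r) (smul (fact r) (word_sym r (map ?L [0..<r])))
    - smul (1 / fact r) (\<Sum>\<tau> | \<tau> permutes {..<r}. smul ((- 1) ^ odd_inversions (length as) r \<tau>)
      (word (map (\<lambda>i. (as @ bs) ! \<tau> i) [0..<r]))) \<in> T"
    by (rule T_smul_cong)
  moreover have "map ?L [0..<r] = as @ bs"
    unfolding r_def by (metis length_append map_nth)
  ultimately show ?thesis
    by (simp add: free_sym_word r_def)
qed

end

context based_lie_superalgebra
begin


section \<open>The basis-free recursion agrees with Euler's formula\<close>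

sublocale free: super_projection scale V pr tw
proof
  fix q :: bit and u v :: 'g and c :: 'k
  show "pr q (u + scale c v) = pr q u + scale c (pr q v)"
    by (simp add: pr_add pr_scale)
  show "tw q (u + scale c v) = tw q u + scale c (tw q v)"
    by (simp add: tw_add tw_scale)
next
  fix q p :: bit and u v :: 'g and c :: 'k
  assume v: "v \<in> V p"
  then show "pr q v = (if p = q then v else 0)" "tw q v = scale (koszul q p) v" "scale c v \<in> V p"
    by (simp_all add: pr_part tw_part subspace_scale[OF subspace_part])
  assume "u \<in> V p"
  with v show "u + v \<in> V p"
    by (simp add: subspace_add[OF subspace_part])
qed (rule subspace_0[OF subspace_part])

lemma T_eq_lin_ideal: "free.T = lin_ideal"
  by (simp add: free.T_def lin_ideal_def)

text \<open>Bridges two conventions: \<open>der\<close> puts \<open>emb v\<close> in front, a sum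
  over basis letters, whereas \<open>ext\<close> keeps the letter \<open>v\<close>. For a
  \<open>\<phi>\<close> that is linear in its first letter the difference is invisible.\<close>

lemma lin_ext_emb_mult:
  assumes ml: "\<And>a b u c v. Suc (length a + length b) = Suc s
      \<Longrightarrow> \<phi> (a @ (u + scale c v) # b) - (\<phi> (a @ u # b) + smul c (\<phi> (a @ v # b))) \<in> lin_ideal"
    and "homog s f"
  shows "lin_ext smul \<phi> (emb v * f) - lin_ext smul (\<lambda>w. \<phi> (v # w)) f \<in> lin_ideal"
  using assms(2)
proof (induction f rule: homog_linear_induct)
  case zero
  then show ?case
    by (simp add: lin_ext_zero lin.zero_mem)
next
  case (add f g)
  then show ?case
    using lin.cong_add[OF add]
    by (simp add: distrib_left lin_ext_add)
next
  case (smul c f)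
  then show ?case
    using lin_smul_cong[OF smul]
    by (simp add: smul_mult_right lin_ext_scale)
next
  case (word w)
  interpret L: Vector_Spaces.linear smul smul "lin_ext smul \<phi>"
    by (rule lin_ext_smul_linear)
  have z: "\<phi> (0 # w) \<in> lin_ideal"
    using ml[of "[]" w 0 "-1" 0] word lin.neg_mem by (fastforce simp: smul_minus_one)
  have "\<phi> ((\<Sum>i\<in>A. scale (xi i v) (X i)) # w) - (\<Sum>i\<in>A. smul (xi i v) (\<phi> (X i # w))) \<in> lin_ideal"
    if "finite A" for A
    using that
  proof (induction A rule: finite_induct)
    case (insert i A)
    let ?s = "\<Sum>i\<in>A. scale (xi i v) (X i)"
    have "\<phi> ((?s + scale (xi i v) (X i)) # w) - (\<phi> (?s # w) + smul (xi i v) (\<phi> (X i # w))) \<in> lin_ideal"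
      using ml[of "[]" w] word by simp
    also have "\<phi> (?s # w) + smul (xi i v) (\<phi> (X i # w))
        - ((\<Sum>i\<in>A. smul (xi i v) (\<phi> (X i # w))) + smul (xi i v) (\<phi> (X i # w))) \<in> lin_ideal"
      by (intro lin.cong_add insert.IH lin.cong_refl)
    finally show ?case
      using insert by (simp add: add.commute)
  qed (simp add: z)
  from lin.cong_sym[OF this[OF finite_Ix]] show ?case
    by (simp add: emb_def sum_distrib_right L.sum L.scale smul_mult_left word_mult lin_ext_smul_word flip: basis_expansion)
qed

text \<open>Expanding the pulled letter in the basis turns pulling into multiplication by
  \<open>X i\<close> after \<open>der i\<close>. The parity argument \<open>q\<close> becomes
  \<open>par i\<close>, because \<open>xi i\<close> only sees the component of that parity.\<close>

lemma ext_der: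
  assumes "\<And>q a b u c v. Suc (Suc (length a + length b)) = length w
      \<Longrightarrow> \<phi> q (a @ (u + scale c v) # b) - (\<phi> q (a @ u # b) + smul c (\<phi> q (a @ v # b))) \<in> lin_ideal"
  shows "free.ext (\<lambda>q u w'. word [u] * \<phi> q w') w
    - (\<Sum>i\<in>Ix. word [X i] * lin_ext smul (\<phi> (par i)) (der i (word w))) \<in> lin_ideal"
  using assms
proof (induction w arbitrary: \<phi>)
  case Nil
  then show ?case
    by (simp add: der_word lin.zero_mem lin_ext_zero)
next
  case (Cons v w)
  have "word [pr 0 v] * \<phi> 0 w + word [pr 1 v] * \<phi> 1 w - (emb (pr 0 v) * \<phi> 0 w + emb (pr 1 v) * \<phi> 1 w) \<in> lin_ideal"
    by (intro lin.cong_add lin.cong_mult_right letter_emb)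
  also have "emb (pr 0 v) * \<phi> 0 w + emb (pr 1 v) * \<phi> 1 w = (\<Sum>i\<in>Ix. word [X i] * smul (xi i v) (\<phi> (par i) w))"
    unfolding emb_def sum_distrib_right sum.distrib[symmetric]
  proof (rule sum.cong[OF refl])
    fix i assume "i \<in> Ix"
    then show "smul (xi i (pr 0 v)) (word [X i]) * \<phi> 0 w + smul (xi i (pr 1 v)) (word [X i]) * \<phi> 1 w
        = word [X i] * smul (xi i v) (\<phi> (par i) w)"
      by (cases "par i") (simp_all add: smul_mult_left smul_mult_right)
  qed
  finally have 1: "word [pr 0 v] * \<phi> 0 w + word [pr 1 v] * \<phi> 1 w
      - (\<Sum>i\<in>Ix. word [X i] * smul (xi i v) (\<phi> (par i) w)) \<in> lin_ideal" .
  have 2: "free.ext (\<lambda>q u w'. word [u] * \<phi> q (tw q v # w')) w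
      - (\<Sum>i\<in>Ix. word [X i] * lin_ext smul (\<lambda>w. \<phi> (par i) (tw (par i) v # w)) (der i (word w))) \<in> lin_ideal"
  proof (rule Cons.IH)
    fix q u c v' and a b :: "'g list"
    assume "Suc (Suc (length a + length b)) = length w"
    then show "\<phi> q (tw q v # a @ (u + scale c v') # b)
        - (\<phi> q (tw q v # a @ u # b) + smul c (\<phi> q (tw q v # a @ v' # b))) \<in> lin_ideal"
      using Cons.prems[of "tw q v # a" b q u c v'] by simp
  qed
  have 3: "(\<Sum>i\<in>Ix. word [X i] * lin_ext smul (\<lambda>w. \<phi> (par i) (tw (par i) v # w)) (der i (word w)))
    - (\<Sum>i\<in>Ix. word [X i] * lin_ext smul (\<phi> (par i)) (emb (tw (par i) v) * der i (word w))) \<in> lin_ideal"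
  proof (intro lin.cong_sum lin.cong_mult_left)
    fix i
    show "lin_ext smul (\<lambda>w. \<phi> (par i) (tw (par i) v # w)) (der i (word w))
      - lin_ext smul (\<phi> (par i)) (emb (tw (par i) v) * der i (word w)) \<in> lin_ideal"
    proof (cases "length w")
      case 0
      then show ?thesis
        by (simp add: der_word lin.zero_mem lin_ext_zero)
    next
      case (Suc s)
      then show ?thesis
        by (intro lin.cong_sym[OF lin_ext_emb_mult[where s = s]] Cons.prems homog_der) (simp_all add: homog_word)
    qed
  qed
  have "free.ext (\<lambda>q u w'. word [u] * \<phi> q w') (v # w)
    - ((\<Sum>i\<in>Ix. word [X i] * smul (xi i v) (\<phi> (par i) w))
      + (\<Sum>i\<in>Ix. word [X i] * lin_ext smul (\<phi> (par i)) (emb (tw (par i) v) * der i (word w)))) \<in> lin_ideal"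
    unfolding free.ext.simps by (rule lin.cong_add[OF 1 lin.cong_trans[OF 2 3]])
  also have "(\<Sum>i\<in>Ix. word [X i] * smul (xi i v) (\<phi> (par i) w))
      + (\<Sum>i\<in>Ix. word [X i] * lin_ext smul (\<phi> (par i)) (emb (tw (par i) v) * der i (word w)))
    = (\<Sum>i\<in>Ix. word [X i] * lin_ext smul (\<phi> (par i)) (der i (word (v # w))))"
    by (simp add: der_word lin_ext_add lin_ext_scale lin_ext_smul_word distrib_left sum.distrib)
  finally show ?case .
qed

lemma word_sym_euler_sym:
  assumes "homog s f"
  shows "lin_ext smul (free.word_sym s) f - euler_sym s f \<in> lin_ideal"
  using assms
proof (induction s arbitrary: f)
  case (0 f)
  interpret L: Vector_Spaces.linear smul smul "lin_ext smul (free.word_sym 0)"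
    by (rule lin_ext_smul_linear)
  obtain c where f: "f = smul c (word [])"
    using 0 homog_0_iff word_Nil by metis
  have "lin_ext smul (free.word_sym 0) (word []) = word []"
    by (subst lin_ext_smul_word) (simp add: word_Nil)
  then show ?case
    by (simp only: f L.scale euler_sym.simps lin.cong_refl)
next
  case (Suc s f)
  from Suc.prems show ?case
  proof (induction f rule: homog_linear_induct)
    case zero
    then show ?case
      using euler_sym_linear(2)[of "Suc s" 0 0]
      by (simp add: lin_ext_zero lin.zero_mem
          del: euler_sym.simps)
  next
    case (add f g)
    then show ?case
      using lin.cong_add[OF add]
      by (simp add: euler_sym_linear lin_ext_add
          del: euler_sym.simps)
  next
    case (smul c f)
    then show ?case
      using lin_smul_cong[OF smul]
      by (simp add: euler_sym_linear lin_ext_scale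
          del: euler_sym.simps)
  next
    case (word w)
    have "free.word_sym (Suc s) w - smul (1 / of_nat (Suc s))
        (\<Sum>i\<in>Ix. word [X i] * lin_ext smul (free.word_sym s) (der i (word w))) \<in> lin_ideal"
      unfolding free.word_sym.simps
      using word free.word_sym_comb[of _ _ s] by (intro lin_smul_cong ext_der) (simp add: T_eq_lin_ideal)
    also have "smul (1 / of_nat (Suc s)) (\<Sum>i\<in>Ix. word [X i] * lin_ext smul (free.word_sym s) (der i (word w)))
        - euler_sym (Suc s) (word w) \<in> lin_ideal"
      unfolding euler_sym.simps using word
      by (intro lin_smul_cong lin.cong_sum lin.cong_mult_left Suc.IH homog_der) (simp add: homog_word)
    finally show ?case
      by (simp only: lin_ext_smul_word)
  qed
qed

lemma free_sym_symmetrise: "free.free_sym f - symmetrise f \<in> lin_ideal"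
proof (induction f rule: free_alg_induct)
  case zero
  then show ?case by (simp add: free.free_sym_zero symmetrise_zero lin.zero_mem)
next
  case (add f g)
  then show ?case using lin.cong_add[OF add] by (simp add: free.free_sym_add symmetrise_add)
next
  case (smul c f)
  then show ?case using lin_smul_cong[OF smul] by (simp add: free.free_sym_smul symmetrise_smul)
next
  case (word w)
  then show ?case
    using word_sym_euler_sym[of "length w" "word w"]
    by (simp add: homog_word free.free_sym_word symmetrise_word lin_ext_smul_word)
qed


subsection \<open>Multi-indices\<close>

text \<open>The indices of the ordered monomial with exponents \<open>K\<close>. Since
  \<open>foldr\<close> applies its first entry last, \<open>foldr der (index_word K)\<close> has the
  order of factors of \<open>partial_power\<close>.\<close>

definition index_word :: "(nat \<Rightarrow> nat) \<Rightarrow> nat list" where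
  "index_word K = concat (map (\<lambda>i. replicate (K i) i) [1..<m + n + 1])"

text \<open>The extension of \<open>ad_tilde\<close> to an action of the free algebra on g. It
  allows the operators of the theorem to be computed by symmetrising in g instead of End(g), see
  \<open>s_operator_eq\<close>.\<close>

definition ad_act :: "('k, 'g) free_alg \<Rightarrow> 'g \<Rightarrow> 'g" where
  "ad_act f z = lin_ext scale (\<lambda>w. foldr (ad_tilde bracket) w z) f"

lemma ad_act_linear: "Vector_Spaces.linear smul scale (\<lambda>f. ad_act f z)"
  unfolding ad_act_def by (rule linear_lin_ext) (rule vector_space_axioms)

lemmas ad_act_add = module_hom.add[OF module_hom_linearI[OF ad_act_linear]]
  and ad_act_smul = module_hom.scale[OF module_hom_linearI[OF ad_act_linear]]
  and ad_act_sum = module_hom.sum[OF module_hom_linearI[OF ad_act_linear]]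
  and ad_act_zero = module_hom.zero[OF module_hom_linearI[OF ad_act_linear]]

lemma ad_act_word: "ad_act (word w) z = foldr (ad_tilde bracket) w z"
  by (simp add: ad_act_def lin_ext_word vector_space_axioms)

lemma ad_act_letter_mult: "ad_act (word [v] * f) z = bracket (ad_act f z) v"
proof (induction f rule: free_alg_induct)
  case (word w)
  then show ?case by (simp add: word_mult ad_act_word ad_tilde_def)
next
  case zero
  then show ?case using bracket_scale_left[of 0 0 v] by (simp add: ad_act_zero)
qed (simp_all add: distrib_left smul_mult_right ad_act_add ad_act_smul bracket_add_left bracket_scale_left)

section \<open>Derivatives of ordered monomials\<close>

definition sgn_list :: "nat \<Rightarrow> nat list \<Rightarrow> 'k" where
  "sgn_list i l = prod_list (map (\<lambda>j. koszul (par i) (par j)) l)"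

lemma sgn_list_square [simp]: "sgn_list i l * sgn_list i l = 1"
proof (induction l)
  case (Cons j l)
  have "sgn_list i (j # l) * sgn_list i (j # l)
      = (koszul (par i) (par j) * koszul (par i) (par j)) * (sgn_list i l * sgn_list i l)"
    by (simp add: sgn_list_def mult_ac del: koszul_square koszul_square_left)
  then show ?case using Cons by simp
qed (simp add: sgn_list_def)

lemma foldr_der_linear:
  "foldr der l (f + g) = foldr der l f + foldr der l g" "foldr der l (smul c f) = smul c (foldr der l f)"
  "foldr der l 0 = 0"
  by (induction l) (simp_all add: der_add der_smul der_zero)

lemma der_foldr_der:
  "i \<in> Ix \<Longrightarrow> set l \<subseteq> Ix \<Longrightarrow> der i (foldr der l g) = smul (sgn_list i l) (foldr der l (der i g))"
  by (induction l) (simp_all add: sgn_list_def der_der der_smul)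

lemma der_basis_word:
  assumes "i \<in> Ix" "set l \<subseteq> Ix" "i \<notin> set l"
  shows "der i (word (map X l) * f) = smul (sgn_list i l) (word (map X l) * der i f)"
  using assms
proof (induction l)
  case (Cons j l)
  have "der i (word [X j] * (word (map X l) * f))
      = smul (koszul (par i) (par j)) (word [X j]) * der i (word (map X l) * f)"
    using Cons.prems by (simp add: der_letter_mult xi_basis tw_part[OF basis_mem] emb_scale emb_basis)
  then show ?case
    using Cons by (simp add: word_mult sgn_list_def smul_mult_left smul_mult_right flip: mult.assoc)
qed (simp add: word_Nil sgn_list_def)

lemma der_basis_power:
  assumes i: "i \<in> Ix" and l: "set l \<subseteq> Ix" "i \<notin> set l" and c: "par i = 0 \<or> c = 0"
  shows "der i (word (map X (replicate (Suc c) i @ l))) = smul (of_nat (Suc c)) (word (map X (replicate c i @ l)))"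
  using c
proof (induction c)
  case 0
  have "der i (word (map X l)) = 0"
    using der_basis_word[OF i l, of 1] by (simp add: der_one)
  then show ?case
    using i by (simp add: der_word xi_basis)
next
  case (Suc c)
  have "der i (word (map X (replicate (Suc (Suc c)) i @ l)))
      = word (map X (replicate (Suc c) i @ l)) + word [X i] * der i (word (map X (replicate (Suc c) i @ l)))"
    using i Suc.prems by (simp add: der_word xi_basis emb_basis)
  also have "\<dots> = smul (1 + of_nat (Suc c)) (word (map X (replicate (Suc c) i @ l)))"
    using Suc by (simp add: smul_mult_right word_mult smul.scale_left_distrib[of 1] del: of_nat_Suc)
  also have "1 + of_nat (Suc c) = (of_nat (Suc (Suc c)) :: 'k)"
    by simp
  finally show ?case .
qed

definition lower :: "nat \<Rightarrow> (nat \<Rightarrow> nat) \<Rightarrow> nat list" where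
  "lower i K = concat (map (\<lambda>j. replicate (K j) j) [1..<i])"

definition upper :: "nat \<Rightarrow> (nat \<Rightarrow> nat) \<Rightarrow> nat list" where
  "upper i K = concat (map (\<lambda>j. replicate (K j) j) [Suc i..<m + n + 1])"

abbreviation incr :: "nat \<Rightarrow> (nat \<Rightarrow> nat) \<Rightarrow> nat \<Rightarrow> nat" where
  "incr i K \<equiv> K(i := Suc (K i))"

lemma index_word_split: "i \<in> Ix \<Longrightarrow> index_word K = lower i K @ replicate (K i) i @ upper i K"
proof -
  assume "i \<in> Ix"
  then have "[1..<m + n + 1] = [1..<i] @ i # [Suc i..<m + n + 1]"
    using upt_add_eq_append[of 1 i "m + n + 1 - i"] by (simp add: Ix_def upt_conv_Cons)
  then show ?thesis
    by (simp add: index_word_def lower_def upper_def)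
qed

lemma lower_upper_incr: "lower i (incr i K) = lower i K" "upper i (incr i K) = upper i K"
  unfolding lower_def upper_def by (intro arg_cong[where f = concat] map_cong refl; auto)+

lemma lower_upper_sets:
  assumes "i \<in> Ix"
  shows "set (lower i K) \<subseteq> Ix" "set (upper i K) \<subseteq> Ix" "i \<notin> set (lower i K)" "i \<notin> set (upper i K)"
  using assms by (auto simp: lower_def upper_def Ix_def)

lemma der_power_incr:
  assumes i: "i \<in> Ix"
  shows "der i (foldr der (index_word K) f) = smul (sgn_list i (lower i K)) (foldr der (index_word (incr i K)) f)"
  using der_foldr_der[OF i lower_upper_sets(1)[OF i]]
  by (simp add: index_word_split[OF i] lower_upper_incr)

text \<open>The sign, from passing the smaller indices, is the same as in
  \<open>der_power_incr\<close>; the two cancel in \<open>s_op_sum\<close>.\<close>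

lemma der_index_word_incr:
  assumes i: "i \<in> Ix" and "par i = 0 \<or> K i = 0"
  shows "der i (word (map X (index_word (incr i K))))
    = smul (sgn_list i (lower i K) * of_nat (Suc (K i))) (word (map X (index_word K)))"
proof -
  note s = lower_upper_sets[OF i, of K]
  have "der i (word (map X (index_word (incr i K)))) = smul (sgn_list i (lower i K))
      (word (map X (lower i K)) * der i (word (map X (replicate (Suc (K i)) i @ upper i K))))"
    by (simp only: index_word_split[OF i, of "incr i K"] lower_upper_incr map_append word_mult[symmetric]
        fun_upd_same der_basis_word[OF i s(1,3)])
  then show ?thesis
    unfolding der_basis_power[OF i s(2,4) assms(2)]
    by (simp add: smul_mult_right word_mult index_word_split[OF i, of K] mult.commute)
qed

lemma der_index_word_zero:
  assumes i: "i \<in> Ix" and "K i = 0"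
  shows "der i (word (map X (index_word K))) = 0"
proof -
  note s = lower_upper_sets[OF i, of K]
  have "set (index_word K) \<subseteq> Ix" "i \<notin> set (index_word K)"
    using s assms by (auto simp: index_word_split[OF i])
  then show ?thesis
    using der_basis_word[OF i, of "index_word K" 1] by (simp add: der_one)
qed

lemma length_index_word: "length (index_word K) = mi_size m n K"
proof -
  have "length (concat (map (\<lambda>i. replicate (K i) i) [1..<k + 1])) = (\<Sum>i = 1..k. K i)" for k
    by (induction k) simp_all
  then show ?thesis
    by (simp add: index_word_def mi_size_def)
qed

lemma odd_square_zero:
  assumes i: "i \<in> Ix" and p: "par i = 1"
  shows "der i (der i f) = 0"
proof -
  have "der i (der i f) = - der i (der i f)"
    using der_der[OF i i, of f] p by (simp add: smul_minus_one)
  then have "smul (1 + 1) (der i (der i f)) = 0"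
    by (simp only: smul.scale_left_distrib smul.scale_one eq_neg_iff_add_eq_0)
  then show ?thesis by simp
qed

section \<open>From powers of the contraction to multi-indices\<close>

definition sized_indices :: "nat \<Rightarrow> (nat \<Rightarrow> nat) set" where
  "sized_indices k = {K \<in> multi_indices m n. mi_size m n K = k}"

lemma finite_sized_indices: "finite (sized_indices k)"
proof -
  have "K i \<le> k" if "K \<in> sized_indices k" "i \<in> {1..m + n}" for K i
    using that member_le_sum[of i "{1..m + n}" K] by (auto simp: sized_indices_def mi_size_def)
  then have "sized_indices k \<subseteq> {K. \<forall>i. (i \<in> {1..m + n} \<longrightarrow> K i \<in> {..k}) \<and> (i \<notin> {1..m + n} \<longrightarrow> K i = 0)}"
    by (auto simp: sized_indices_def multi_indices_def)
  then show ?thesis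
    using finite_set_of_finite_funs[of "{1..m + n}" "{..k}" 0] by (auto intro: finite_subset)
qed

lemma mi_size_incr: "i \<in> Ix \<Longrightarrow> mi_size m n (incr i K) = Suc (mi_size m n K)"
  by (simp add: index_word_split[of i] lower_upper_incr flip: length_index_word)

lemma mi_incr: "i \<in> Ix \<Longrightarrow> incr i K \<in> multi_indices m n \<longleftrightarrow> K \<in> multi_indices m n \<and> (par i = 0 \<or> K i = 0)"
proof -
  assume "i \<in> Ix"
  then show ?thesis
    by (auto simp: multi_indices_def Ix_def basis_parity_def split: if_splits)
qed

lemma mi_fact_incr: "i \<in> Ix \<Longrightarrow> par i = 0 \<or> K i = 0 \<Longrightarrow>
    (mi_fact m (incr i K) :: 'k) = of_nat (Suc (K i)) * mi_fact m K"
proof -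
  assume i: "i \<in> Ix" and p: "par i = 0 \<or> K i = 0"
  show ?thesis
  proof (cases "i \<le> m")
    case True
    have "(\<Prod>j\<in>{1..m} - {i}. fact (incr i K j) :: 'k) = (\<Prod>j\<in>{1..m} - {i}. fact (K j))"
      by (intro prod.cong) auto
    moreover have im: "i \<in> {1..m}" using True i by (simp add: Ix_def)
    ultimately show ?thesis
      unfolding mi_fact_def prod.remove[OF finite_atLeastAtMost im] by simp
  next
    case False
    then have "(\<Prod>j\<in>{1..m}. fact (incr i K j) :: 'k) = (\<Prod>j\<in>{1..m}. fact (K j))"
      by (intro prod.cong) auto
    then show ?thesis
      using p False by (auto simp: mi_fact_def basis_parity_def split: if_splits)
  qed
qed

lemma mi_fact_nz: "(mi_fact m K :: 'k) \<noteq> 0"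
  by (simp add: mi_fact_def)

abbreviation s_op :: "(nat \<Rightarrow> nat) \<Rightarrow> 'g \<Rightarrow> 'g" where
  "s_op K z \<equiv> ad_act (symmetrise (word (map X (index_word K)))) z"

text \<open>Euler's formula for \<sigma>, carried to End(g) by \<open>ad_act\<close>.\<close>

lemma s_op_recursion:
  "scale (of_nat (mi_size m n K)) (s_op K z)
    = (\<Sum>i\<in>Ix. bracket (ad_act (symmetrise (der i (word (map X (index_word K))))) z) (X i))"
proof -
  have "smul (of_nat (mi_size m n K)) (symmetrise (word (map X (index_word K))))
      = (\<Sum>i\<in>Ix. word [X i] * symmetrise (der i (word (map X (index_word K)))))"
    by (rule symmetrise_recursion[symmetric]) (simp add: homog_word length_index_word)
  then show ?thesis
    by (simp add: ad_act_sum ad_act_letter_mult flip: ad_act_smul)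
qed

text \<open>Induction on \<open>k\<close> for all \<open>\<beta>\<close>, because one contraction is
  absorbed into \<open>\<beta>\<close>. Multiplication by \<open>k + 1 = mi_size m n K\<close> makes
  \<open>s_op_recursion\<close> applicable.\<close>

lemma s_op_sum:
  assumes "bilinear \<beta>"
  shows "(\<Sum>K\<in>sized_indices k. smul (1 / mi_fact m K) (\<beta> (s_op K z) (foldr der (index_word K) f)))
    = smul (1 / fact k) ((contract ^^ k) \<beta> z f)"
  using assms
proof (induction k arbitrary: \<beta>)
  case 0
  have "index_word (\<lambda>_. 0) = []"
    by (simp add: index_word_def)
  moreover have "sized_indices 0 = {\<lambda>_. 0}"
    by (auto simp: sized_indices_def multi_indices_def mi_size_def fun_eq_iff) (metis Suc_leI atLeastAtMost_iff not_less)
  ultimately show ?case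
    by (simp add: mi_fact_def symmetrise_word ad_act_word)
next
  case (Suc k)
  note b = bilinearD[OF Suc.prems]
  let ?D = "\<lambda>K. foldr der (index_word K) f"
  let ?t = "\<lambda>i K. smul (1 / mi_fact m K) (\<beta> (bracket (s_op K z) (X i)) (der i (?D K)))"
  let ?u = "\<lambda>i K. smul (1 / mi_fact m K) (\<beta> (bracket (ad_act (symmetrise (der i (word (map X (index_word K))))) z) (X i)) (?D K))"
  have br0: "bracket 0 v = 0" for v
    using bracket_scale_left[of 0 0 v] by simp
  have "smul (of_nat (Suc k)) (\<Sum>K\<in>sized_indices (Suc k). smul (1 / mi_fact m K) (\<beta> (s_op K z) (?D K)))
      = (\<Sum>K\<in>sized_indices (Suc k). smul (1 / mi_fact m K) (\<beta> (scale (of_nat (mi_size m n K)) (s_op K z)) (?D K)))"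
    by (simp add: smul.scale_sum_right b sized_indices_def mult.commute del: of_nat_Suc)
  also have "\<dots> = (\<Sum>K\<in>sized_indices (Suc k). \<Sum>i\<in>Ix. ?u i K)"
    unfolding s_op_recursion by (simp add: b smul.scale_sum_right)
  also have "\<dots> = (\<Sum>i\<in>Ix. \<Sum>K\<in>sized_indices (Suc k). ?u i K)"
    by (rule sum.swap)
  also have "\<dots> = (\<Sum>i\<in>Ix. \<Sum>K\<in>sized_indices k. ?t i K)"
  proof (rule sum.cong[OF refl])
    fix i assume i: "i \<in> Ix"
    have "(\<Sum>K\<in>sized_indices (Suc k). ?u i K) = (\<Sum>K\<in>{K \<in> sized_indices (Suc k). K i \<noteq> 0}. ?u i K)"
      using der_index_word_zero[OF i]
      by (intro sum.mono_neutral_right finite_sized_indices) (auto simp: symmetrise_zero ad_act_zero br0 b)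
    \<comment> \<open>With \<open>K = incr i K'\<close> the factor \<open>K' i + 1\<close> of the
      derivative cancels against the factorials, and the two reordering signs cancel each
      other.\<close>
    also have "\<dots> = (\<Sum>K\<in>{K \<in> sized_indices k. par i = 0 \<or> K i = 0}. ?t i K)"
    proof (rule sum.reindex_bij_witness[where j = "\<lambda>K. K(i := K i - 1)" and i = "\<lambda>K. incr i K"])
      fix K assume K: "K \<in> {K \<in> sized_indices (Suc k). K i \<noteq> 0}"
      define K' where "K' = K(i := K i - 1)"
      have inc: "incr i K' = K"
        using K by (auto simp: K'_def)
      then show "incr i (K(i := K i - 1)) = K"
        by (simp add: K'_def)
      have K': "K' \<in> sized_indices k" "par i = 0 \<or> K' i = 0"
        using K mi_incr[OF i, of K'] mi_size_incr[OF i, of K'] inc by (auto simp: sized_indices_def)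
      then show "K(i := K i - 1) \<in> {K \<in> sized_indices k. par i = 0 \<or> K i = 0}"
        by (simp add: K'_def)
      have "?u i K = ?t i K'"
        unfolding inc[symmetric] der_index_word_incr[where K = K', OF i K'(2)] der_power_incr[OF i]
        by (simp add: symmetrise_smul ad_act_smul bracket_scale_left b mi_fact_incr[where K = K', OF i K'(2)] mi_fact_nz
            of_nat_neq_0 mult_ac del: of_nat_Suc)
      then show "?t i (K(i := K i - 1)) = ?u i K"
        by (simp add: K'_def)
    next
      fix K assume "K \<in> {K \<in> sized_indices k. par i = 0 \<or> K i = 0}"
      then show "(incr i K)(i := incr i K i - 1) = K" "incr i K \<in> {K \<in> sized_indices (Suc k). K i \<noteq> 0}"
        using mi_incr[OF i, of K] mi_size_incr[OF i, of K] by (auto simp: sized_indices_def)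
    qed
    \<comment> \<open>For odd \<open>i\<close> with \<open>K i = 1\<close> the term contains, up to
      sign, the square of an odd derivative and vanishes, so the sum extends to all \<open>K\<close>
      of size \<open>k\<close>.\<close>
    also have "\<dots> = (\<Sum>K\<in>sized_indices k. ?t i K)"
    proof (intro sum.mono_neutral_left finite_sized_indices ballI)
      fix K assume K: "K \<in> sized_indices k - {K \<in> sized_indices k. par i = 0 \<or> K i = 0}"
      then have p: "par i = 1" and "K i \<noteq> 0"
        by auto
      have "i \<in> {m + 1..m + n}"
        using i p by (auto simp: Ix_def basis_parity_def split: if_splits)
      then have "K i \<in> {0, 1}"
        using K unfolding sized_indices_def multi_indices_def by blast
      with \<open>K i \<noteq> 0\<close> have "K i = 1" by simp
      then have "der i (?D K) = 0"
        using der_foldr_der[OF i lower_upper_sets(1)[OF i]] odd_square_zero[OF i p]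
        by (simp add: index_word_split[OF i] foldr_der_linear)
      then show "?t i K = 0" by (simp add: b)
    qed auto
    finally show "(\<Sum>K\<in>sized_indices (Suc k). ?u i K) = (\<Sum>K\<in>sized_indices k. ?t i K)" .
  qed
  also have "\<dots> = (\<Sum>K\<in>sized_indices k. smul (1 / mi_fact m K) (contract \<beta> (s_op K z) (?D K)))"
    by (subst sum.swap) (simp add: contract_def smul.scale_sum_right)
  also have "\<dots> = smul (1 / fact k) ((contract ^^ Suc k) \<beta> z f)"
    using Suc.IH[OF bilinear_contract[OF Suc.prems]] by (simp add: funpow_swap1)
  finally have "smul (1 / of_nat (Suc k)) (smul (of_nat (Suc k)) (\<Sum>K\<in>sized_indices (Suc k). smul (1 / mi_fact m K) (\<beta> (s_op K z) (?D K))))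
    = smul (1 / of_nat (Suc k)) (smul (1 / fact k) ((contract ^^ Suc k) \<beta> z f))"
    by simp
  then show ?case
    by (simp add: of_nat_neq_0 mult.commute del: of_nat_Suc funpow.simps)
qed

lemma pi_op_multi_indices:
  assumes "\<And>w. w \<in> Poly_Mapping.keys f \<Longrightarrow> length w \<le> N"
  shows "pi_op z f = (\<Sum>K | K \<in> multi_indices m n \<and> mi_size m n K \<le> N.
    smul ((- 1) ^ mi_size m n K * bernoulli (mi_size m n K) / mi_fact m K) (emb (s_op K z) * foldr der (index_word K) f))"
proof -
  have "pi_op z f = (\<Sum>k\<le>N. smul (ccoef k) ((contract ^^ k) left_mul z f))"
    unfolding pi_op_def by (rule contract_series_bounded[OF bilinear_left_mul assms])
  also have "\<dots> = (\<Sum>k\<le>N. smul ((- 1) ^ k * bernoulli k) (smul (1 / fact k) ((contract ^^ k) left_mul z f)))"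
    by (simp add: ccoef_def)
  also have "\<dots> = (\<Sum>k\<le>N. \<Sum>K\<in>sized_indices k. smul ((- 1) ^ mi_size m n K * bernoulli (mi_size m n K) / mi_fact m K)
      (emb (s_op K z) * foldr der (index_word K) f))"
    unfolding s_op_sum[OF bilinear_left_mul, symmetric] smul.scale_sum_right
    by (intro sum.cong refl) (simp add: sized_indices_def left_mul_def)
  also have "\<dots> = (\<Sum>K\<in>(\<Union>k\<le>N. sized_indices k). smul ((- 1) ^ mi_size m n K * bernoulli (mi_size m n K) / mi_fact m K)
      (emb (s_op K z) * foldr der (index_word K) f))"
    by (rule sum.UNION_disjoint[symmetric]) (auto simp: finite_sized_indices, auto simp: sized_indices_def)
  also have "(\<Union>k\<le>N. sized_indices k) = {K. K \<in> multi_indices m n \<and> mi_size m n K \<le> N}"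
    by (auto simp: sized_indices_def)
  finally show ?thesis .
qed

lemma homog_foldr_der: "homog s g \<Longrightarrow> length l \<le> s \<Longrightarrow> homog (s - length l) (foldr der l g)"
proof (induction l)
  case (Cons i l)
  then show ?case
    using homog_der[of "s - Suc (length l)" "foldr der l g" i] by (simp add: Suc_diff_Suc)
qed simp

lemma foldr_der_homog_zero: "homog s g \<Longrightarrow> s < length l \<Longrightarrow> foldr der l g = 0"
proof (induction l)
  case (Cons i l)
  show ?case
  proof (cases "s < length l")
    case True
    then show ?thesis using Cons by (simp add: der_zero)
  next
    case False
    then show ?thesis
      using Cons.prems homog_foldr_der[of s g l] by (simp add: der_homog_0)
  qed
qed simp

text \<open>This is why only finitely many multi-indices contribute for a given
  \<open>f\<close>.\<close>

lemma foldr_der_bounded: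
  assumes "\<And>w. w \<in> Poly_Mapping.keys f \<Longrightarrow> length w < length l"
  shows "foldr der l f = 0"
proof -
  have "foldr der l (\<Sum>w\<in>A. smul (Poly_Mapping.lookup f w) (word w)) = 0"
    if "finite A" "A \<subseteq> Poly_Mapping.keys f" for A
    using that
  proof (induction A rule: finite_induct)
    case (insert w A)
    have "foldr der l (word w) = 0"
      using insert.prems assms by (intro foldr_der_homog_zero[of "length w"]) (auto simp: homog_word)
    then show ?case
      using insert by (simp add: foldr_der_linear)
  qed (simp add: foldr_der_linear)
  from this[of "Poly_Mapping.keys f"] show ?thesis
    using free_alg_sum[of f] by simp
qed

end


subsection \<open>Presented algebras as quotients\<close>

definition free_carrier :: "'v set \<Rightarrow> ('k::ring_1, 'v) free_alg set" where
  "free_carrier C = {f. \<forall>w\<in>Poly_Mapping.keys f. set w \<subseteq> C}"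

lemma free_algebra_simps:
  "carrier (free_algebra C) = free_carrier C" "f \<otimes>\<^bsub>free_algebra C\<^esub> g = f * g"
  "f \<oplus>\<^bsub>free_algebra C\<^esub> g = f + g" "\<one>\<^bsub>free_algebra C\<^esub> = 1" "\<zero>\<^bsub>free_algebra C\<^esub> = 0"
  by (simp_all add: free_algebra_def free_carrier_def)

lemma free_carrier_zero: "0 \<in> free_carrier C"
  by (simp add: free_carrier_def)

lemma free_carrier_add: "f \<in> free_carrier C \<Longrightarrow> g \<in> free_carrier C \<Longrightarrow> f + g \<in> free_carrier C"
  using keys_add[of f g] unfolding free_carrier_def by fast

lemma free_carrier_minus: "- f \<in> free_carrier C \<longleftrightarrow> f \<in> free_carrier C"
  by (simp add: free_carrier_def)

lemma free_carrier_diff: "f \<in> free_carrier C \<Longrightarrow> g \<in> free_carrier C \<Longrightarrow> f - g \<in> free_carrier C"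
  using free_carrier_add[of f C "- g"] by (simp add: free_carrier_minus)

lemma free_carrier_mult: "f \<in> free_carrier C \<Longrightarrow> g \<in> free_carrier C \<Longrightarrow> f * g \<in> free_carrier C"
  using keys_mult[of f g] by (fastforce simp: free_carrier_def plus_list_def)

lemma free_carrier_word: "word w \<in> free_carrier C \<longleftrightarrow> set w \<subseteq> C" for w :: "'v list"
  by (simp add: free_carrier_def word_def)

lemma free_carrier_one: "1 \<in> free_carrier C"
  by (simp add: free_carrier_word flip: word_Nil)

lemma free_carrier_scalar: "scalar c \<in> free_carrier C"
  by (simp add: free_carrier_def scalar_def)

lemma free_carrier_smul: "f \<in> free_carrier C \<Longrightarrow> smul c f \<in> free_carrier C"
  unfolding smul_def by (intro free_carrier_mult free_carrier_scalar)

lemma free_carrier_sum: "(\<And>x. x \<in> A \<Longrightarrow> f x \<in> free_carrier C) \<Longrightarrow> sum f A \<in> free_carrier C"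
  by (induction A rule: infinite_finite_induct) (simp_all add: free_carrier_add free_carrier_zero)

lemma free_carrier_induct [consumes 1, case_names zero add smul word]:
  assumes "f \<in> free_carrier C" and "P 0" "\<And>f g. P f \<Longrightarrow> P g \<Longrightarrow> P (f + g)"
    "\<And>c f. P f \<Longrightarrow> P (smul c f)" "\<And>w. set w \<subseteq> C \<Longrightarrow> P (word w)"
  shows "P f"
proof -
  have "P (\<Sum>w\<in>A. smul (Poly_Mapping.lookup f w) (word w))"
    if "finite A" "A \<subseteq> Poly_Mapping.keys f" for A
    using that by (induction A) (use assms in \<open>auto simp: free_carrier_def\<close>)
  from this[of "Poly_Mapping.keys f"] show ?thesis
    using free_alg_sum[of f] by simp
qed

lemma ring_free_algebra: "ring (free_algebra C :: ('k::field, 'v) free_alg ring)"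
proof (rule ringI)
  show "abelian_group (free_algebra C :: ('k, 'v) free_alg ring)"
  proof (rule abelian_groupI)
    fix x :: "('k, 'v) free_alg"
    assume "x \<in> carrier (free_algebra C)"
    then show "\<exists>y\<in>carrier (free_algebra C). y \<oplus>\<^bsub>free_algebra C\<^esub> x = \<zero>\<^bsub>free_algebra C\<^esub>"
      by (intro bexI[of _ "- x"]) (simp_all add: free_algebra_simps free_carrier_minus)
  qed (simp_all add: free_algebra_simps free_carrier_add free_carrier_zero add_ac)
  show "monoid (free_algebra C :: ('k, 'v) free_alg ring)"
    by (rule monoidI) (simp_all add: free_algebra_simps free_carrier_mult free_carrier_one mult.assoc)
qed (simp_all add: free_algebra_simps algebra_simps)

text \<open>Common ground for S(g), U(g) and S(End(g)). The generating set \<open>C\<close> is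
  general because the linear maps do not exhaust the function type.\<close>

locale presentation =
  fixes scale :: "'k::field \<Rightarrow> 'v::ab_group_add \<Rightarrow> 'v" and C :: "'v set" and R :: "('k, 'v) free_alg set"
  assumes C_add: "u \<in> C \<Longrightarrow> v \<in> C \<Longrightarrow> u + v \<in> C" and C_scale: "v \<in> C \<Longrightarrow> scale c v \<in> C"
    and R_carrier: "R \<subseteq> free_carrier C"
begin

abbreviation FA :: "('k, 'v) free_alg ring" where "FA \<equiv> free_algebra C"
abbreviation I :: "('k, 'v) free_alg set" where "I \<equiv> presented_ideal scale C R"
abbreviation A :: "('k, ('k, 'v) free_alg set) module" where "A \<equiv> presented_algebra scale C R"
abbreviation cls :: "('k, 'v) free_alg \<Rightarrow> ('k, 'v) free_alg set" where "cls \<equiv> presented_class scale C R"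

lemma relations_carrier: "linearity_relations scale C \<union> R \<subseteq> carrier FA"
proof -
  have "word [u + v] - word [u] - word [v] \<in> free_carrier C" if "u \<in> C" "v \<in> C" for u v
    using that by (intro free_carrier_diff) (simp_all add: free_carrier_word C_add)
  moreover have "word [scale c v] - scalar c * word [v] \<in> free_carrier C" if "v \<in> C" for c v
    using that by (intro free_carrier_diff free_carrier_mult free_carrier_scalar)
       (simp_all add: free_carrier_word C_scale)
  ultimately show ?thesis
    unfolding free_algebra_simps linearity_relations_def using R_carrier by blast
qed

lemma ideal_I: "ideal I FA"
  unfolding presented_ideal_def by (rule ring.genideal_ideal[OF ring_free_algebra relations_carrier])

sublocale I: ideal I FA
  by (rule ideal_I)

lemma relations_I: "r \<in> linearity_relations scale C \<union> R \<Longrightarrow> r \<in> I"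
  unfolding presented_ideal_def using ring.genideal_self[OF ring_free_algebra relations_carrier] by blast

lemma I_zero: "0 \<in> I" and I_add: "f \<in> I \<Longrightarrow> g \<in> I \<Longrightarrow> f + g \<in> I"
  using additive_subgroup.zero_closed[OF I.is_additive_subgroup] additive_subgroup.a_closed[OF I.is_additive_subgroup]
  by (simp_all add: free_algebra_simps)

lemma I_mult: "f \<in> I \<Longrightarrow> g \<in> free_carrier C \<Longrightarrow> f * g \<in> I" "f \<in> I \<Longrightarrow> g \<in> free_carrier C \<Longrightarrow> g * f \<in> I"
  using I.I_r_closed I.I_l_closed by (simp_all add: free_algebra_simps)

lemma I_minus: "f \<in> I \<Longrightarrow> - f \<in> I"
  using I_mult(2)[OF _ free_carrier_scalar[of "- 1"], of f]
  by (simp add: smul_minus_one flip: smul_def)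

lemma I_diff: "f \<in> I \<Longrightarrow> g \<in> I \<Longrightarrow> f - g \<in> I"
  using I_add[of f "- g"] I_minus[of g] by simp

lemma cls_altdef: "cls f = {h + f | h. h \<in> I}"
  by (auto simp: presented_class_def a_r_coset_def' free_algebra_simps)

lemma cls_eq_iff: "cls f = cls g \<longleftrightarrow> f - g \<in> I"
proof
  assume "cls f = cls g"
  moreover have "0 + f \<in> cls f"
    using I_zero unfolding cls_altdef by blast
  ultimately have "f \<in> cls g" by simp
  then show "f - g \<in> I" by (auto simp: cls_altdef)
next
  assume fg: "f - g \<in> I"
  have "h + f = (h + (f - g)) + g" "h + g = (h - (f - g)) + f" for h
    by simp_all
  then show "cls f = cls g"
    unfolding cls_altdef using I_add[OF _ fg] I_diff[OF _ fg] by blast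
qed

lemma A_carrier: "carrier A = cls ` free_carrier C"
  by (auto simp: presented_algebra_def Let_def FactRing_def A_RCOSETS_def' presented_class_def free_algebra_simps)

lemma cls_carrier: "f \<in> free_carrier C \<Longrightarrow> cls f \<in> carrier A"
  unfolding A_carrier by (rule imageI)

lemma A_add: "f \<in> free_carrier C \<Longrightarrow> g \<in> free_carrier C \<Longrightarrow> cls f \<oplus>\<^bsub>A\<^esub> cls g = cls (f + g)"
  using I.a_rcos_sum[of f g]
  by (simp add: presented_algebra_def Let_def FactRing_def presented_class_def free_algebra_simps)

lemma A_mult: "f \<in> free_carrier C \<Longrightarrow> g \<in> free_carrier C \<Longrightarrow> cls f \<otimes>\<^bsub>A\<^esub> cls g = cls (f * g)"
  using I.rcoset_mult_add[of f g]
  by (simp add: presented_algebra_def Let_def FactRing_def presented_class_def free_algebra_simps)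

lemma A_one: "\<one>\<^bsub>A\<^esub> = cls 1"
  by (simp add: presented_algebra_def Let_def FactRing_def presented_class_def free_algebra_simps)

lemma A_zero: "\<zero>\<^bsub>A\<^esub> = cls 0"
  by (auto simp: presented_algebra_def Let_def FactRing_def cls_altdef)

lemma A_smult: "f \<in> free_carrier C \<Longrightarrow> c \<odot>\<^bsub>A\<^esub> cls f = cls (smul c f)"
  using A_mult[OF free_carrier_scalar] by (simp add: smul_def presented_algebra_def Let_def)

lemma abelian_group_A: "abelian_group A"
proof -
  have "\<exists>y\<in>carrier A. y \<oplus>\<^bsub>A\<^esub> x = \<zero>\<^bsub>A\<^esub>" if "x \<in> carrier A" for x
  proof -
    from that obtain f where "x = cls f" "f \<in> free_carrier C"
      by (auto simp: A_carrier)
    then show ?thesis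
      by (intro bexI[of _ "cls (- f)"]) (simp_all add: A_add A_zero cls_carrier free_carrier_minus)
  qed
  then show ?thesis
    by (intro abelian_groupI)
       (auto simp: A_carrier A_add A_zero free_carrier_add free_carrier_zero add_ac)
qed

sublocale A: abelian_group A
  by (rule abelian_group_A)

lemma A_sum:
  assumes "finite S" "\<And>x. x \<in> S \<Longrightarrow> F x \<in> free_carrier C"
  shows "(\<Oplus>\<^bsub>A\<^esub>x\<in>S. cls (F x)) = cls (\<Sum>x\<in>S. F x)"
  using assms
proof (induction S rule: finite_induct)
  case empty
  then show ?case by (simp add: A_zero)
next
  case (insert x S)
  then have "(\<lambda>x. cls (F x)) \<in> S \<rightarrow> carrier A" "cls (F x) \<in> carrier A"
    using cls_carrier by blast+
  with insert show ?case
    by (simp add: A_add free_carrier_sum)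
qed

lemma list_prod_cls: "set w \<subseteq> C \<Longrightarrow> list_prod A (map (\<lambda>v. cls (word [v])) w) = cls (word w)"
proof (induction w)
  case Nil
  then show ?case by (simp add: list_prod_def A_one word_Nil)
next
  case (Cons v w)
  then have "word [v] \<in> free_carrier C" "word w \<in> free_carrier C"
    by (simp_all add: free_carrier_word)
  from A_mult[OF this] Cons show ?case
    by (simp add: list_prod_def word_mult)
qed

text \<open>The trace of the large ideal on the carrier is an ideal of the free algebra on
  \<open>C\<close> containing the relations, so minimality applies. Maps killing the large ideal
  therefore descend to the presented algebra.\<close>

lemma I_subset: "I \<subseteq> gen_ideal (linearity_relations scale UNIV \<union> R)"
proof -
  \<comment> \<open>Here the name denotes the trace of the large ideal on the carrier, unrelated to
    the contraction \<open>contract_sym\<close>.\<close>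
  let ?contract_sym = "gen_ideal (linearity_relations scale UNIV \<union> R) \<inter> free_carrier C"
  interpret contract_sym: two_sided_ideal "gen_ideal (linearity_relations scale UNIV \<union> R)"
    by (rule two_sided_ideal_gen_ideal)
  have "ideal ?contract_sym FA"
  proof (rule idealI[OF ring_free_algebra])
    show "subgroup ?contract_sym (add_monoid FA)"
    proof (rule group.subgroupI[OF comm_group.axioms(2)[OF abelian_group.a_comm_group[OF ring.is_abelian_group[OF ring_free_algebra]]]])
      fix a assume a: "a \<in> ?contract_sym"
      then have m: "- a \<in> ?contract_sym"
        by (auto intro: contract_sym.neg_mem simp: free_carrier_minus)
      have "\<ominus>\<^bsub>FA\<^esub> a = - a"
        by (rule I.minus_equality) (use a m in \<open>auto simp: free_algebra_simps free_carrier_minus\<close>)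
      with m show "inv\<^bsub>add_monoid FA\<^esub> a \<in> ?contract_sym"
        by (simp add: a_inv_def)
    next
      have "0 \<in> ?contract_sym" by (simp add: contract_sym.zero_mem free_carrier_zero)
      then show "?contract_sym \<noteq> {}" by blast
    next
      fix a b assume "a \<in> ?contract_sym" "b \<in> ?contract_sym"
      then have "a + b \<in> ?contract_sym"
        by (simp only: Int_iff contract_sym.add_mem free_carrier_add simp_thms)
      then show "a \<otimes>\<^bsub>add_monoid FA\<^esub> b \<in> ?contract_sym"
        by (simp add: free_algebra_simps)
    qed (auto simp: free_algebra_simps free_carrier_minus)
  next
    fix a x assume "a \<in> ?contract_sym" "x \<in> carrier FA"
    then have "a * x \<in> ?contract_sym" "x * a \<in> ?contract_sym"
      unfolding free_algebra_simps by (simp_all only: Int_iff contract_sym.mult_left_mem contract_sym.mult_right_mem free_carrier_mult simp_thms)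
    then show "x \<otimes>\<^bsub>FA\<^esub> a \<in> ?contract_sym" "a \<otimes>\<^bsub>FA\<^esub> x \<in> ?contract_sym"
      by (simp_all add: free_algebra_simps)
  qed
  moreover have "linearity_relations scale C \<union> R \<subseteq> ?contract_sym"
  proof -
    have "linearity_relations scale C \<subseteq> linearity_relations scale UNIV"
      unfolding linearity_relations_def by blast
    then show ?thesis
      using relations_carrier unfolding free_algebra_simps by (blast intro: gen_ideal.gen)
  qed
  ultimately have "I \<subseteq> ?contract_sym"
    unfolding presented_ideal_def by (rule ring.genideal_minimal[OF ring_free_algebra])
  then show ?thesis by blast
qed

lemma I_UNIV:
  assumes "C = UNIV"
  shows "I = gen_ideal (linearity_relations scale UNIV \<union> R)"
proof
  show "gen_ideal (linearity_relations scale UNIV \<union> R) \<subseteq> I"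
  proof
    have fc: "f \<in> free_carrier C" for f
      using assms by (simp add: free_carrier_def)
    have gens: "r \<in> I" if "r \<in> linearity_relations scale UNIV \<union> R" for r
      using that relations_I assms by simp
    fix f assume "f \<in> gen_ideal (linearity_relations scale UNIV \<union> R)"
    then show "f \<in> I"
      by induction (blast intro: I_zero I_add I_mult fc gens)+
  qed
qed (rule I_subset)

end


subsection \<open>The symmetrisation map\<close>

context super_projection
begin

abbreviation C :: "'v set" where "C \<equiv> super_carrier V"

lemma part_C: "v \<in> V p \<Longrightarrow> v \<in> C"
proof (cases "p = 0")
  case True
  assume "v \<in> V p"
  then have "v = v + 0 \<and> v \<in> V 0 \<and> 0 \<in> V 1" using True zero_mem by simp
  then show ?thesis unfolding super_carrier_def by blast
next
  case False
  assume "v \<in> V p"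
  then have "v = 0 + v \<and> 0 \<in> V 0 \<and> v \<in> V 1" using False zero_mem by simp
  then show ?thesis unfolding super_carrier_def by blast
qed

lemma C_cases:
  assumes "v \<in> C" obtains u w where "v = u + w" "u \<in> V 0" "w \<in> V 1"
  using assms by (auto simp: super_carrier_def)

sublocale S: presentation scale C "sym_relations V"
proof
  fix u v assume "u \<in> C" "v \<in> C"
  then obtain a b c d where "u = a + b" "v = c + d" "a \<in> V 0" "b \<in> V 1" "c \<in> V 0" "d \<in> V 1"
    by (metis C_cases)
  then have "u + v = (a + c) + (b + d)" "a + c \<in> V 0" "b + d \<in> V 1"
    by (simp_all add: add_mem add_ac)
  then show "u + v \<in> C"
    unfolding super_carrier_def by blast
next
  fix v c assume "v \<in> C"
  then obtain a b where "v = a + b" "a \<in> V 0" "b \<in> V 1"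
    by (metis C_cases)
  then have "scale c v = scale c a + scale c b" "scale c a \<in> V 0" "scale c b \<in> V 1"
    by (simp_all add: scale_mem scale_right_distrib)
  then show "scale c v \<in> C"
    unfolding super_carrier_def by blast
next
  show "(sym_relations V :: ('k, 'v) free_alg set) \<subseteq> free_carrier C"
  proof
    fix f :: "('k, 'v) free_alg"
    assume "f \<in> sym_relations V"
    then obtain u v p q where "f = word [u] * word [v] - scalar (koszul p q) * (word [v] * word [u])"
      and uv: "u \<in> V p" "v \<in> V q"
      unfolding sym_relations_def by blast
    moreover have "(word [u] :: ('k, 'v) free_alg) \<in> free_carrier C" "(word [v] :: ('k, 'v) free_alg) \<in> free_carrier C"
      using uv by (simp_all add: free_carrier_word part_C)
    ultimately show "f \<in> free_carrier C"
      by (simp only: free_carrier_diff free_carrier_mult free_carrier_scalar)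
  qed
qed

lemma free_sym_I: "f \<in> S.I \<Longrightarrow> free_sym f \<in> T"
  using S.I_subset free_sym_mem by blast

text \<open>\<open>symmetrisation\<close> prescribes values only on products with the even factors
  first, so its uniqueness requires these to span. The set consists of representatives of the span;
  \<open>shift\<close> closes it under the defining ideal.\<close>

inductive_set even_first :: "('k, 'v) free_alg set" where
  word: "set as \<subseteq> V 0 \<Longrightarrow> set bs \<subseteq> V 1 \<Longrightarrow> word (as @ bs) \<in> even_first"
| add: "f \<in> even_first \<Longrightarrow> g \<in> even_first \<Longrightarrow> f + g \<in> even_first"
| smul: "f \<in> even_first \<Longrightarrow> smul c f \<in> even_first"
| shift: "f \<in> even_first \<Longrightarrow> g \<in> free_carrier C \<Longrightarrow> g - f \<in> S.I \<Longrightarrow> g \<in> even_first"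

lemma even_first_carrier: "f \<in> even_first \<Longrightarrow> f \<in> free_carrier C"
proof (induction rule: even_first.induct)
  case (word as bs)
  then show ?case
    using part_C by (auto simp: free_carrier_word)
qed (simp_all add: free_carrier_add free_carrier_smul)

lemma letter_free_carrier: "v \<in> V p \<Longrightarrow> word [v] \<in> free_carrier C"
  by (simp add: free_carrier_word part_C)

lemma even_first_left_cong:
  assumes "v \<in> V p" "f \<in> even_first" "word [v] * f \<in> even_first" "g \<in> free_carrier C" "g - f \<in> S.I"
  shows "word [v] * g \<in> even_first"
proof (rule even_first.shift[OF assms(3)])
  show "word [v] * g \<in> free_carrier C"
    by (intro free_carrier_mult letter_free_carrier[OF assms(1)] assms)
  show "word [v] * g - word [v] * f \<in> S.I"
    using S.I_mult(2)[OF assms(5) letter_free_carrier[OF assms(1)]] by (simp add: right_diff_distrib)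
qed

lemma even_first_even: "f \<in> even_first \<Longrightarrow> v \<in> V 0 \<Longrightarrow> word [v] * f \<in> even_first"
proof (induction rule: even_first.induct)
  case (word as bs)
  then show ?case
    using even_first.word[of "v # as" bs] by (simp add: word_mult)
qed (auto simp: distrib_left smul_mult_right intro: even_first.intros even_first_left_cong)

text \<open>The odd letter is carried to the right past the even ones, one at a time, with the sign
  \<open>koszul 1 0 = 1\<close>.\<close>

lemma even_first_odd: "f \<in> even_first \<Longrightarrow> v \<in> V 1 \<Longrightarrow> word [v] * f \<in> even_first"
proof (induction rule: even_first.induct)
  case (word as bs)
  have "word (v # as @ bs) \<in> even_first"
    using word(1)
  proof (induction as)
    case Nil
    then show ?case
      using even_first.word[of "[]" "v # bs"] word by simp
  next
    case (Cons a as)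
    then have a: "a \<in> V 0" by simp
    have "word (a # v # as @ bs) \<in> even_first"
      using even_first_even[OF Cons.IH a] Cons.prems by (simp add: word_mult)
    then show ?case
    proof (rule even_first.shift)
      show c: "word (v # (a # as) @ bs) \<in> free_carrier C"
        using word Cons.prems part_C by (auto simp: free_carrier_word)
      have "word [v] * word [a] - scalar (koszul 1 0) * (word [a] * word [v]) \<in> S.I"
        using word a by (intro S.relations_I) (auto simp: sym_relations_def)
      then have "(word [v] * word [a] - scalar (koszul 1 0) * (word [a] * word [v])) * word (as @ bs) \<in> S.I"
        using Cons.prems word part_C by (intro S.I_mult(1)) (auto simp: free_carrier_word)
      then show "word (v # (a # as) @ bs) - word (a # v # as @ bs) \<in> S.I"
        by (simp add: scalar_one left_diff_distrib word_mult)
    qed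
  qed
  then show ?case by (simp add: word_mult)
qed (auto simp: distrib_left smul_mult_right intro: even_first.intros even_first_left_cong)

lemma even_first_word: "set w \<subseteq> C \<Longrightarrow> word w \<in> even_first"
proof (induction w)
  case Nil
  show ?case using even_first.word[of "[]" "[]"] by simp
next
  case (Cons v w)
  then obtain u u' where v: "v = u + u'" "u \<in> V 0" "u' \<in> V 1"
    using C_cases[of v] by auto
  have w: "word w \<in> even_first" using Cons by simp
  have "word [u] * word w + word [u'] * word w \<in> even_first"
    using v w by (intro even_first.add even_first_even even_first_odd)
  then show ?case
  proof (rule even_first.shift)
    show "word (v # w) \<in> free_carrier C"
      using Cons.prems by (simp add: free_carrier_word)
    have "word [u + u'] - word [u] - word [u'] \<in> linearity_relations scale C"
      using v(2,3) part_C unfolding linearity_relations_def by blast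
    then have "(word [u + u'] - word [u] - word [u']) * word w \<in> S.I"
      using S.relations_I even_first_carrier[OF w] by (intro S.I_mult(1)) blast+
    then show "word (v # w) - (word [u] * word w + word [u'] * word w) \<in> S.I"
      by (simp add: v(1) left_diff_distrib distrib_right word_mult diff_diff_add)
  qed
qed

lemma even_first_all: "f \<in> free_carrier C \<Longrightarrow> f \<in> even_first"
proof (induction rule: free_carrier_induct)
  case zero
  show ?case using even_first.smul[OF even_first_word[of "[]"], of 0] by simp
qed (auto intro: even_first.intros even_first_word)

text \<open>Evaluates the definite description. The map \<open>ev\<close> evaluates words in
  \<open>A\<close> along \<open>\<iota>\<close>; it is assumed on the whole free algebra and to kill
  \<open>T\<close>, so that congruences modulo \<open>T\<close> become equations in
  \<open>A\<close>.\<close>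

lemma symmetrisation_eq:
  fixes A :: "('k, 'a) module" and ev :: "('k, 'v) free_alg \<Rightarrow> 'a"
  assumes A: "abelian_monoid A"
    and ev_carrier: "\<And>f. ev f \<in> carrier A"
    and ev_add: "\<And>f g. ev (f + g) = ev f \<oplus>\<^bsub>A\<^esub> ev g"
    and ev_smul: "\<And>c f. ev (smul c f) = c \<odot>\<^bsub>A\<^esub> ev f"
    and ev_T: "\<And>f. f \<in> T \<Longrightarrow> ev f = \<zero>\<^bsub>A\<^esub>"
    and ev_word: "\<And>w. set w \<subseteq> C \<Longrightarrow> ev (word w) = list_prod A (map \<iota> w)"
    and f: "f \<in> free_carrier C"
  shows "symmetrisation scale V A \<iota> (S.cls f) = ev (free_sym f)"
proof -
  interpret A: abelian_monoid A by (rule A)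
  have ev_cong: "ev f = ev g" if "f - g \<in> T" for f g
    using ev_add[of "f - g" g] ev_T[OF that] ev_carrier by simp
  have ev_sum: "ev (sum F S) = (\<Oplus>\<^bsub>A\<^esub>x\<in>S. ev (F x))" if "finite S" for F :: "(nat \<Rightarrow> nat) \<Rightarrow> ('k, 'v) free_alg" and S
    using that by (induction S rule: finite_induct) (simp_all add: ev_T[OF T.zero_mem] ev_add ev_carrier)
  define val :: "'v list \<Rightarrow> 'v list \<Rightarrow> 'a" where "val as bs =
      (let p = length as; r = length as + length bs in (1 / fact r) \<odot>\<^bsub>A\<^esub>
         (\<Oplus>\<^bsub>A\<^esub>\<tau>\<in>{\<tau>. \<tau> permutes {..<r}}. (- 1) ^ odd_inversions p r \<tau> \<odot>\<^bsub>A\<^esub>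
            list_prod A (map (\<lambda>i. \<iota> ((as @ bs) ! \<tau> i)) [0..<r])))" for as bs
  have val: "ev (free_sym (word (as @ bs))) = val as bs" if ab: "set as \<subseteq> V 0" "set bs \<subseteq> V 1" for as bs
  proof -
    let ?r = "length as + length bs"
    let ?w = "\<lambda>\<tau>. map (\<lambda>i. (as @ bs) ! \<tau> i) [0..<?r]"
    have "ev (free_sym (word (as @ bs))) = (1 / fact ?r) \<odot>\<^bsub>A\<^esub> (\<Oplus>\<^bsub>A\<^esub>\<tau>\<in>{\<tau>. \<tau> permutes {..<?r}}.
        (- 1) ^ odd_inversions (length as) ?r \<tau> \<odot>\<^bsub>A\<^esub> ev (word (?w \<tau>)))"
      by (subst ev_cong[OF free_sym_permutations[OF ab]]) (simp add: ev_smul ev_sum finite_permutations)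
    also have "(\<Oplus>\<^bsub>A\<^esub>\<tau>\<in>{\<tau>. \<tau> permutes {..<?r}}.
        (- 1) ^ odd_inversions (length as) ?r \<tau> \<odot>\<^bsub>A\<^esub> ev (word (?w \<tau>)))
      = (\<Oplus>\<^bsub>A\<^esub>\<tau>\<in>{\<tau>. \<tau> permutes {..<?r}}. (- 1) ^ odd_inversions (length as) ?r \<tau> \<odot>\<^bsub>A\<^esub>
            list_prod A (map (\<lambda>i. \<iota> ((as @ bs) ! \<tau> i)) [0..<?r]))"
    proof (rule A.finsum_cong'[OF refl])
      have ev_val: "c \<odot>\<^bsub>A\<^esub> ev (word (?w \<tau>))
          = c \<odot>\<^bsub>A\<^esub> list_prod A (map (\<lambda>i. \<iota> ((as @ bs) ! \<tau> i)) [0..<?r])"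
        if "\<tau> permutes {..<?r}" for \<tau> c
      proof -
        have "(as @ bs) ! \<tau> i \<in> C" if "i < ?r" for i
        proof -
          have "\<tau> i < length (as @ bs)"
            using permutes_in_image[OF \<open>\<tau> permutes {..<?r}\<close>, of i] that by simp
          then have "(as @ bs) ! \<tau> i \<in> set (as @ bs)" by (rule nth_mem)
          then show ?thesis using ab part_C by auto
        qed
        then have "set (?w \<tau>) \<subseteq> C" by auto
        from ev_word[OF this] show ?thesis by (simp add: o_def)
      qed
      then show "(- 1) ^ odd_inversions (length as) ?r \<tau> \<odot>\<^bsub>A\<^esub> ev (word (?w \<tau>))
          = (- 1) ^ odd_inversions (length as) ?r \<tau> \<odot>\<^bsub>A\<^esub>
            list_prod A (map (\<lambda>i. \<iota> ((as @ bs) ! \<tau> i)) [0..<?r])" if "\<tau> \<in> {\<tau>. \<tau> permutes {..<?r}}" for \<tau>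
        using that by simp
      show "(\<lambda>\<tau>. (- 1) ^ odd_inversions (length as) ?r \<tau> \<odot>\<^bsub>A\<^esub>
          list_prod A (map (\<lambda>i. \<iota> ((as @ bs) ! \<tau> i)) [0..<?r])) \<in> {\<tau>. \<tau> permutes {..<?r}} \<rightarrow> carrier A"
      proof (rule Pi_I)
        fix \<tau> assume "\<tau> \<in> {\<tau>. \<tau> permutes {..<?r}}"
        then show "(- 1) ^ odd_inversions (length as) ?r \<tau> \<odot>\<^bsub>A\<^esub>
            list_prod A (map (\<lambda>i. \<iota> ((as @ bs) ! \<tau> i)) [0..<?r]) \<in> carrier A"
          using ev_carrier[of "smul ((- 1) ^ odd_inversions (length as) ?r \<tau>) (word (?w \<tau>))"] ev_val[of \<tau>]
          by (simp only: ev_smul mem_Collect_eq)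
      qed
    qed
    finally show ?thesis by (simp add: val_def Let_def)
  qed
  have prod: "list_prod S.A (map (sym_gen scale V) (as @ bs)) = S.cls (word (as @ bs))"
    if "set as \<subseteq> V 0" "set bs \<subseteq> V 1" for as bs
    unfolding sym_gen_def using that part_C by (intro S.list_prod_cls) auto
  define P where "P \<sigma> \<longleftrightarrow> \<sigma> \<in> extensional (carrier S.A) \<and> alg_linear S.A A \<sigma> \<and>
       (\<forall>as bs. set as \<subseteq> V 0 \<and> set bs \<subseteq> V 1 \<longrightarrow>
         \<sigma> (list_prod S.A (map (sym_gen scale V) (as @ bs))) = val as bs)" for \<sigma>
  have sym: "symmetrisation scale V A \<iota> = (THE \<sigma>. P \<sigma>)"
    by (simp add: symmetrisation_def P_def val_def Let_def)
  \<comment> \<open>Two linear maps with the prescribed values agree on everything generated from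
    even-first words.\<close>
  have unique: "\<sigma> (S.cls f) = ev (free_sym f)" if P: "P \<sigma>" and f: "f \<in> free_carrier C" for \<sigma> f
    using even_first_all[OF f]
  proof (induction rule: even_first.induct)
    case (word as bs)
    then show ?case
      using P val prod by (simp add: P_def)
  next
    case (add f g)
    then have "\<sigma> (S.cls f \<oplus>\<^bsub>S.A\<^esub> S.cls g) = \<sigma> (S.cls f) \<oplus>\<^bsub>A\<^esub> \<sigma> (S.cls g)"
      using P by (simp add: P_def alg_linear_def S.cls_carrier even_first_carrier)
    then show ?case
      using add by (simp add: S.A_add even_first_carrier free_sym_add ev_add)
  next
    case (smul f c)
    then have "\<sigma> (c \<odot>\<^bsub>S.A\<^esub> S.cls f) = c \<odot>\<^bsub>A\<^esub> \<sigma> (S.cls f)"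
      using P by (simp add: P_def alg_linear_def S.cls_carrier even_first_carrier)
    then show ?case
      using smul by (simp add: S.A_smult even_first_carrier free_sym_smul ev_smul)
  next
    case (shift f g)
    then have "S.cls g = S.cls f" by (simp add: S.cls_eq_iff)
    moreover have "ev (free_sym g) = ev (free_sym f)"
      using free_sym_I[OF shift(3)] by (intro ev_cong) (simp add: free_sym_diff)
    ultimately show ?case using shift by simp
  qed
  \<comment> \<open>Existence: the map induced by \<open>free_sym\<close> through a chosen
    representative; \<open>free_sym_I\<close> makes the choice irrelevant.\<close>
  define \<sigma>0 where "\<sigma>0 = restrict (\<lambda>x. ev (free_sym (SOME f. f \<in> free_carrier C \<and> x = S.cls f))) (carrier S.A)"
  have \<sigma>0: "\<sigma>0 (S.cls f) = ev (free_sym f)" if f: "f \<in> free_carrier C" for f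
  proof -
    define g where "g = (SOME g. g \<in> free_carrier C \<and> S.cls f = S.cls g)"
    have "g \<in> free_carrier C \<and> S.cls f = S.cls g"
      unfolding g_def by (rule someI[of _ f]) (simp add: f)
    then have "free_sym (g - f) \<in> T"
      using S.cls_eq_iff by (intro free_sym_I) metis
    then have "ev (free_sym g) = ev (free_sym f)"
      by (intro ev_cong) (simp add: free_sym_diff)
    then show ?thesis
      using S.cls_carrier[OF f] by (simp add: \<sigma>0_def g_def)
  qed
  have "P \<sigma>0"
    unfolding P_def alg_linear_def
  proof (intro conjI allI impI ballI)
    show "\<sigma>0 \<in> extensional (carrier S.A)"
      by (simp add: \<sigma>0_def)
    show "\<sigma>0 \<in> carrier S.A \<rightarrow> carrier A"
      by (auto simp: S.A_carrier \<sigma>0 ev_carrier)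
  next
    fix x y assume "x \<in> carrier S.A" "y \<in> carrier S.A"
    then show "\<sigma>0 (x \<oplus>\<^bsub>S.A\<^esub> y) = \<sigma>0 x \<oplus>\<^bsub>A\<^esub> \<sigma>0 y"
      by (auto simp: S.A_carrier \<sigma>0 S.A_add free_carrier_add free_sym_add ev_add)
  next
    fix c x assume "x \<in> carrier S.A"
    then show "\<sigma>0 (c \<odot>\<^bsub>S.A\<^esub> x) = c \<odot>\<^bsub>A\<^esub> \<sigma>0 x"
      by (auto simp: S.A_carrier \<sigma>0 S.A_smult free_carrier_smul free_sym_smul ev_smul)
  next
    fix as bs assume "set as \<subseteq> V 0 \<and> set bs \<subseteq> V 1"
    then show "\<sigma>0 (list_prod S.A (map (sym_gen scale V) (as @ bs))) = val as bs"
      using prod[of as bs] val[of as bs] \<sigma>0 even_first_carrier[OF even_first.word[of as bs]] by simp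
  qed
  moreover have "\<sigma> = \<sigma>0" if "P \<sigma>" for \<sigma>
  proof (rule extensionalityI[of _ "carrier S.A"])
    fix x assume "x \<in> carrier S.A"
    then show "\<sigma> x = \<sigma>0 x"
      using unique[OF that] by (auto simp: S.A_carrier \<sigma>0)
  qed (use that in \<open>auto simp: P_def \<sigma>0_def\<close>)
  ultimately have "(THE \<sigma>. P \<sigma>) = \<sigma>0"
    by (rule the_equality)
  then show ?thesis
    by (simp add: sym \<sigma>0 f)
qed

end

context based_lie_superalgebra
begin


lemma free_carrier_all: "(f :: ('k, 'g) free_alg) \<in> free_carrier (super_carrier V)"
  unfolding part_total by (simp add: free_carrier_def)

lemma S_I: "free.S.I = sym_ideal"
  unfolding sym_ideal_def by (rule free.S.I_UNIV[OF part_total])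

sublocale U: presentation scale "super_carrier V" "env_relations V bracket"
  by standard (auto simp: part_total free_carrier_all[unfolded part_total])

lemma U_I: "U.I = env_ideal"
  unfolding env_ideal_def by (rule U.I_UNIV[OF part_total])

abbreviation scls :: "('k, 'g) free_alg \<Rightarrow> ('k, 'g) free_alg set" where "scls \<equiv> free.S.cls"
abbreviation ecls :: "('k, 'g) free_alg \<Rightarrow> ('k, 'g) free_alg set" where "ecls \<equiv> U.cls"

lemma scls_eq_iff: "scls f = scls g \<longleftrightarrow> f - g \<in> sym_ideal"
  by (simp add: free.S.cls_eq_iff S_I)

lemma ecls_eq_iff: "ecls f = ecls g \<longleftrightarrow> f - g \<in> env_ideal"
  by (simp add: U.cls_eq_iff U_I)

lemmas S_simps = free.S.A_add[OF free_carrier_all free_carrier_all] free.S.A_mult[OF free_carrier_all free_carrier_all]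
  free.S.A_smult[OF free_carrier_all] free.S.A_one free.S.A_zero

lemma S_carrier: "carrier (Sym scale V) = range scls"
  unfolding free.S.A_carrier using free_carrier_all by auto

lemma lie_symmetrisation_cls: "lie_symmetrisation scale V bracket (scls f) = ecls (symmetrise f)"
proof -
  have "lie_symmetrisation scale V bracket (scls f) = ecls (free.free_sym f)"
    unfolding lie_symmetrisation_def
  proof (rule free.symmetrisation_eq)
    show "abelian_monoid (Env scale V bracket)" by unfold_locales
    show "ecls f = \<zero>\<^bsub>Env scale V bracket\<^esub>" if "f \<in> free.T" for f
      using that lin_subset_env by (auto simp: U.A_zero ecls_eq_iff T_eq_lin_ideal)
    show "ecls (word w) = list_prod (Env scale V bracket) (map (env_gen scale V bracket) w)" for w
      unfolding env_gen_def by (rule U.list_prod_cls[symmetric]) (simp add: part_total)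
  qed (simp_all add: U.cls_carrier U.A_add U.A_smult free_carrier_all)
  also have "\<dots> = ecls (symmetrise f)"
    unfolding ecls_eq_iff using free_sym_symmetrise lin_subset_env by blast
  finally show ?thesis .
qed

text \<open>The class of \<open>pi_op Z f\<close> is an explicit preimage by
  \<open>symmetrise_pi_op\<close>, and injectivity forces \<open>inv_into\<close> to return
  it.\<close>

lemma sym_action_cls: "sym_action scale V bracket Z (scls f) = scls (pi_op Z f)"
proof -
  let ?\<sigma> = "lie_symmetrisation scale V bracket"
  have "inj_on ?\<sigma> (carrier (Sym scale V))"
  proof (rule inj_onI)
    fix x y assume "x \<in> carrier (Sym scale V)" "y \<in> carrier (Sym scale V)" "?\<sigma> x = ?\<sigma> y"
    then obtain f g where "x = scls f" "y = scls g" "ecls (symmetrise f) = ecls (symmetrise g)"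
      by (auto simp: S_carrier lie_symmetrisation_cls)
    then show "x = y"
      using symmetrise_inj[of "f - g"] by (simp add: scls_eq_iff ecls_eq_iff symmetrise_diff)
  qed
  moreover have "?\<sigma> (scls (pi_op Z f)) = env_gen scale V bracket Z \<otimes>\<^bsub>Env scale V bracket\<^esub> ?\<sigma> (scls f)"
  proof -
    have "symmetrise (pi_op Z f) - left_mul Z (symmetrise f) \<in> env_ideal"
      by (rule symmetrise_pi_op)
    also have "left_mul Z (symmetrise f) - word [Z] * symmetrise f \<in> env_ideal"
      unfolding left_mul_def using lin_subset_env letter_emb[of Z] by (intro env.cong_mult_right env.cong_sym[of "word [Z]"]) auto
    finally have "ecls (symmetrise (pi_op Z f)) = ecls (word [Z] * symmetrise f)"
      by (simp add: ecls_eq_iff)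
    then show ?thesis
      by (simp add: lie_symmetrisation_cls env_gen_def U.A_mult free_carrier_all)
  qed
  ultimately show ?thesis
    unfolding sym_action_def by (intro inv_into_f_eq) (auto simp: S_carrier)
qed


subsection \<open>Partial derivatives on the symmetric algebra\<close>

text \<open>Homogeneity in the parity, on representatives of \<open>sym_part\<close>; in contrast,
  \<open>homog\<close> refers to the degree.\<close>

definition homogeneous :: "bit \<Rightarrow> ('k, 'g) free_alg set" where
  "homogeneous p = {f. \<forall>w\<in>Poly_Mapping.keys f. \<exists>ps. list_all2 (\<lambda>v q. v \<in> V q) w ps \<and> sum_list ps = p}"

lemma sym_part_eq: "sym_part scale V p = scls ` homogeneous p"
  by (simp add: sym_part_def homogeneous_def)

lemma homogeneous_zero: "0 \<in> homogeneous p"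
  by (simp add: homogeneous_def)

lemma homogeneous_add: "f \<in> homogeneous p \<Longrightarrow> g \<in> homogeneous p \<Longrightarrow> f + g \<in> homogeneous p"
  using keys_add[of f g] unfolding homogeneous_def by fast

lemma homogeneous_mult:
  assumes f: "f \<in> homogeneous p" and g: "g \<in> homogeneous q"
  shows "f * g \<in> homogeneous (p + q)"
  unfolding homogeneous_def
proof (intro CollectI ballI)
  fix w assume "w \<in> Poly_Mapping.keys (f * g)"
  then obtain u v where w: "w = u @ v" and uv: "u \<in> Poly_Mapping.keys f" "v \<in> Poly_Mapping.keys g"
    using keys_mult[of f g] by (auto simp: plus_list_def)
  obtain ps where "list_all2 (\<lambda>v q. v \<in> V q) u ps" "sum_list ps = p"
    using f uv(1) unfolding homogeneous_def by blast
  moreover obtain qs where "list_all2 (\<lambda>v q. v \<in> V q) v qs" "sum_list qs = q"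
    using g uv(2) unfolding homogeneous_def by blast
  ultimately show "\<exists>ps. list_all2 (\<lambda>v q. v \<in> V q) w ps \<and> sum_list ps = p + q"
    by (intro exI[of _ "ps @ qs"]) (simp add: w list_all2_appendI)
qed

lemma homogeneous_smul: "f \<in> homogeneous p \<Longrightarrow> smul c f \<in> homogeneous p"
proof -
  assume "f \<in> homogeneous p"
  moreover have "scalar c \<in> homogeneous 0"
    by (auto simp: homogeneous_def scalar_def intro!: exI[of _ "[]"] split: if_splits)
  ultimately show "smul c f \<in> homogeneous p"
    using homogeneous_mult[of "scalar c" 0 f p] by (simp add: smul_def)
qed

lemma homogeneous_word: "list_all2 (\<lambda>v q. v \<in> V q) w ps \<Longrightarrow> word w \<in> homogeneous (sum_list ps)"
  by (auto simp: homogeneous_def word_def)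

lemma homogeneous_letter: "v \<in> V p \<Longrightarrow> word [v] \<in> homogeneous p"
  using homogeneous_word[of "[v]" "[p]"] by simp

lemma homogeneous_sum: "(\<And>x. x \<in> A \<Longrightarrow> f x \<in> homogeneous p) \<Longrightarrow> sum f A \<in> homogeneous p"
  by (induction A rule: infinite_finite_induct) (simp_all only: sum.infinite sum.empty sum.insert
      homogeneous_zero homogeneous_add insert_iff simp_thms)

lemma homogeneous_emb: "v \<in> V p \<Longrightarrow> emb v \<in> homogeneous p"
  unfolding emb_def
proof (rule homogeneous_sum)
  fix i assume v: "v \<in> V p" and i: "i \<in> Ix"
  show "smul (xi i v) (word [X i]) \<in> homogeneous p"
  proof (cases "par i = p")
    case True
    then show ?thesis
      using homogeneous_smul[OF homogeneous_letter[OF basis_mem[OF i]]] by blast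
  next
    case False
    then show ?thesis using xi_part[OF v i] homogeneous_zero by simp
  qed
qed

lemma homogeneous_der_word:
  assumes "i \<in> Ix"
  shows "list_all2 (\<lambda>v q. v \<in> V q) w ps \<Longrightarrow> der_word i w \<in> homogeneous (par i + sum_list ps)"
proof (induction w ps rule: list_all2_induct)
  case (Cons v w q ps)
  have "smul (xi i v) (word w) \<in> homogeneous (par i + sum_list (q # ps))"
  proof (cases "par i = q")
    case True
    then show ?thesis
      using homogeneous_smul[OF homogeneous_word[OF Cons.hyps(2)]] by simp
  next
    case False
    then show ?thesis using xi_part[OF Cons.hyps(1) assms] homogeneous_zero by simp
  qed
  moreover have "emb (tw (par i) v) * der_word i w \<in> homogeneous (par i + sum_list (q # ps))"
    using homogeneous_mult[OF homogeneous_emb[OF tw_mem[OF Cons.hyps(1)]] Cons.IH] by (simp add: add_ac)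
  ultimately show ?case
    unfolding der_word.simps by (rule homogeneous_add)
qed (simp add: homogeneous_zero)

lemma homogeneous_expansion:
  assumes "f \<in> homogeneous p" and "P 0" "\<And>f g. P f \<Longrightarrow> P g \<Longrightarrow> P (f + g)" "\<And>c f. P f \<Longrightarrow> P (smul c f)"
    "\<And>w ps. list_all2 (\<lambda>v q. v \<in> V q) w ps \<Longrightarrow> sum_list ps = p \<Longrightarrow> P (word w)"
  shows "P f"
proof -
  have "P (\<Sum>w\<in>A. smul (Poly_Mapping.lookup f w) (word w))"
    if "finite A" "A \<subseteq> Poly_Mapping.keys f" for A
    using that
  proof (induction A rule: finite_induct)
    case (insert w A)
    then have "w \<in> Poly_Mapping.keys f" by simp
    then obtain ps where "list_all2 (\<lambda>v q. v \<in> V q) w ps" "sum_list ps = p"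
      using assms(1) unfolding homogeneous_def by blast
    then have "P (word w)" by (rule assms(5))
    moreover have "P (\<Sum>w\<in>A. smul (Poly_Mapping.lookup f w) (word w))"
      using insert by simp
    ultimately show ?case
      unfolding sum.insert[OF insert.hyps(1,2)] by (intro assms(3,4))
  qed (simp only: sum.empty assms(2))
  from this[of "Poly_Mapping.keys f"] show ?thesis
    by (simp flip: free_alg_sum)
qed

lemma homogeneous_der:
  assumes "i \<in> Ix" "f \<in> homogeneous p"
  shows "der i f \<in> homogeneous (par i + p)"
  using assms(2)
proof (rule homogeneous_expansion)
  show "der i (word w) \<in> homogeneous (par i + p)"
    if "list_all2 (\<lambda>v q. v \<in> V q) w ps" "sum_list ps = p" for w ps
    using homogeneous_der_word[OF assms(1) that(1)] that(2) by (simp only: der_word)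
qed (simp_all only: der_zero der_add der_smul homogeneous_zero homogeneous_add homogeneous_smul)

text \<open>Turns the twisted Leibniz rule \<open>der_mult\<close> into the signed rule that
  \<open>superderivation\<close> demands.\<close>

lemma twist_map_homogeneous:
  assumes "f \<in> homogeneous p"
  shows "twist_map q f - smul (koszul q p) f \<in> sym_ideal"
  using assms
proof (rule homogeneous_expansion)
  fix w ps assume w: "list_all2 (\<lambda>v q. v \<in> V q) w ps" and "sum_list ps = p"
  have "twist_map q (word w) = smul (koszul q (sum_list ps)) (prod_list (map emb w))"
    unfolding twist_map_word using w
    by (induction w ps rule: list_all2_induct)
       (simp_all add: tw_part emb_scale koszul_add_right smul_mult_left smul_mult_right)
  also have "\<dots> - smul (koszul q (sum_list ps)) (word w) \<in> sym_ideal"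
    by (intro sym_smul_cong sym.cong_sym[OF word_letters_cong[OF sym.two_sided_ideal_axioms lin_subset_sym]])
  finally show "twist_map q (word w) - smul (koszul q p) (word w) \<in> sym_ideal"
    using \<open>sum_list ps = p\<close> by simp
next
  fix f g assume "twist_map q f - smul (koszul q p) f \<in> sym_ideal" "twist_map q g - smul (koszul q p) g \<in> sym_ideal"
  from sym.cong_add[OF this] show "twist_map q (f + g) - smul (koszul q p) (f + g) \<in> sym_ideal"
    by (simp add: twist_map_add smul.scale_right_distrib)
next
  fix c f assume "twist_map q f - smul (koszul q p) f \<in> sym_ideal"
  from sym_smul_cong[OF this, of c] show "twist_map q (smul c f) - smul (koszul q p) (smul c f) \<in> sym_ideal"
    by (simp add: twist_map_smul mult.commute)
qed (simp add: twist_map_zero sym.zero_mem)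

lemma scls_der_cong: "i \<in> Ix \<Longrightarrow> scls f = scls g \<Longrightarrow> scls (der i f) = scls (der i g)"
  using der_mem[of i "f - g"] by (simp add: scls_eq_iff der_diff)

text \<open>Induction on words by the Leibniz rule. As \<open>D\<close> is known on the basis
  generators only, the first letter is expanded in the basis.\<close>

lemma superderivation_unique:
  assumes i: "i \<in> Ix" and D: "superderivation scale V (par i) D"
    and gen: "\<And>j. j \<in> Ix \<Longrightarrow> D (sym_gen scale V (X j)) = (if i = j then \<one>\<^bsub>Sym scale V\<^esub> else \<zero>\<^bsub>Sym scale V\<^esub>)"
  shows "D (scls f) = scls (der i f)"
proof -
  have Dadd: "D (scls (f + g)) = D (scls f) \<oplus>\<^bsub>Sym scale V\<^esub> D (scls g)" for f g
    using D unfolding superderivation_def alg_linear_def by (simp add: S_carrier flip: S_simps)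
  have Dsmul: "D (scls (smul c f)) = c \<odot>\<^bsub>Sym scale V\<^esub> D (scls f)" for c f
    using D unfolding superderivation_def alg_linear_def by (simp add: S_carrier flip: S_simps)
  have Dmult: "D (scls (f * g)) = (D (scls f) \<otimes>\<^bsub>Sym scale V\<^esub> scls g) \<oplus>\<^bsub>Sym scale V\<^esub>
      (koszul (par i) p \<odot>\<^bsub>Sym scale V\<^esub> (scls f \<otimes>\<^bsub>Sym scale V\<^esub> D (scls g)))" if "f \<in> homogeneous p" for f g p
    using D that unfolding superderivation_def sym_part_eq by (simp add: S_carrier flip: S_simps(2))
  have Dcarrier: "\<exists>h. D (scls f) = scls h" for f
  proof -
    have "D \<in> range scls \<rightarrow> range scls"
      using D by (simp add: superderivation_def alg_linear_def S_carrier)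
    then have "D (scls f) \<in> range scls"
      by (rule funcset_mem) (rule rangeI)
    then show ?thesis by (auto simp only: image_iff)
  qed
  \<comment> \<open>The Leibniz rule for the product of 1 with itself says that \<open>D\<close> at
    1 is twice itself.\<close>
  have D1: "D (scls 1) = scls 0"
  proof -
    obtain h where h: "D (scls 1) = scls h" using Dcarrier by blast
    have "1 \<in> homogeneous 0"
      using homogeneous_word[of "[]" "[]"] by (simp add: word_Nil)
    from Dmult[OF this, of 1] h have "scls h = scls (h + h)"
      by (simp add: S_simps)
    then show ?thesis
      using sym.neg_mem[of "h - (h + h)"] by (simp add: h scls_eq_iff)
  qed
  have step: "D (scls (word [X j] * g)) = scls (der i (word [X j] * g))"
    if j: "j \<in> Ix" and g: "D (scls g) = scls (der i g)" for j g
  proof -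
    have "D (scls (word [X j])) = (if i = j then scls 1 else scls 0)"
      using gen[OF j] by (simp add: sym_gen_def S_simps)
    then have "D (scls (word [X j] * g)) = scls ((if i = j then 1 else 0) * g
        + smul (koszul (par i) (par j)) (word [X j] * der i g))"
      unfolding Dmult[OF homogeneous_letter[OF basis_mem[OF j]]] by (auto simp: g S_simps)
    then show ?thesis
      using i j by (auto simp: der_letter_mult xi_basis tw_part[OF basis_mem] emb_scale emb_basis smul_mult_left)
  qed
  have sum: "D (scls (sum F A)) = scls (der i (sum F A))"
    if "finite A" "\<And>x. x \<in> A \<Longrightarrow> D (scls (F x)) = scls (der i (F x))" for F :: "nat \<Rightarrow> ('k, 'g) free_alg" and A
    using that
  proof (induction A rule: finite_induct)
    case empty
    then show ?case
      using Dsmul[of 0 1] by (simp add: der_zero D1 S_simps)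
  qed (simp add: Dadd der_add S_simps)
  show ?thesis
  proof (induction f rule: free_alg_induct)
    case zero
    then show ?case using sum[of "{}"] by simp
  next
    case (word w)
    show ?case
    proof (induction w)
      case Nil
      then show ?case by (simp add: word_Nil D1 der_one)
    next
      case (Cons v w)
      let ?e = "\<Sum>j\<in>Ix. smul (xi j v) (word [X j] * word w)"
      have e: "D (scls ?e) = scls (der i ?e)"
        using Cons step by (intro sum) (simp_all add: Dsmul der_smul S_simps)
      have "word (v # w) - ?e \<in> sym_ideal"
      proof -
        have "word [v] * word w - emb v * word w \<in> sym_ideal"
          using lin_subset_sym letter_emb by (intro sym.cong_mult_right) blast
        then show ?thesis
          by (simp add: word_mult emb_def sum_distrib_right smul_mult_left)
      qed
      then have c: "scls (word (v # w)) = scls ?e"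
        by (simp only: scls_eq_iff)
      then show ?case
        unfolding scls_der_cong[OF i c] by (simp only: c e)
    qed
  qed (simp_all add: Dadd Dsmul der_add der_smul S_simps)
qed

text \<open>\<open>der_mem\<close> makes the induced map independent of representatives, which gives
  existence for the definite description; uniqueness is
  \<open>superderivation_unique\<close>.\<close>

lemma partial_cls:
  assumes i: "i \<in> Ix"
  shows "partial scale V m n X i (scls f) = scls (der i f)"
proof -
  let ?S = "Sym scale V"
  define P where "P D \<longleftrightarrow> D \<in> extensional (carrier ?S) \<and> superderivation scale V (par i) D \<and>
        (\<forall>j\<in>{1..m + n}. D (sym_gen scale V (X j)) = (if i = j then \<one>\<^bsub>?S\<^esub> else \<zero>\<^bsub>?S\<^esub>))" for D
  define D0 where "D0 = restrict (\<lambda>x. scls (der i (SOME f. x = scls f))) (carrier ?S)"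
  have D0: "D0 (scls f) = scls (der i f)" for f
  proof -
    define g where "g = (SOME g. scls f = scls g)"
    have "scls f = scls g"
      unfolding g_def by (rule someI) (rule refl)
    then have "scls (der i g) = scls (der i f)"
      by (intro scls_der_cong[OF i]) (rule sym)
    moreover have "D0 (scls f) = scls (der i g)"
      by (simp only: D0_def restrict_apply S_carrier rangeI if_True g_def)
    ultimately show ?thesis by (simp only:)
  qed
  have "P D0"
    unfolding P_def superderivation_def alg_linear_def
  proof (intro conjI allI ballI)
    fix p
    show "D0 ` sym_part scale V p \<subseteq> sym_part scale V (par i + p)"
    proof
      fix x assume "x \<in> D0 ` sym_part scale V p"
      then obtain f where "x = D0 (scls f)" "f \<in> homogeneous p"
        unfolding sym_part_eq by blast
      then show "x \<in> sym_part scale V (par i + p)"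
        unfolding sym_part_eq D0 using homogeneous_der[OF i] by blast
    qed
    fix a b assume a: "a \<in> sym_part scale V p" and b: "b \<in> carrier ?S"
    from a obtain f where f: "a = scls f" "f \<in> homogeneous p"
      unfolding sym_part_eq by blast
    from b obtain g where g: "b = scls g"
      by (auto simp: S_carrier)
    have "der i f * g + twist_map (par i) f * der i g - (der i f * g + smul (koszul (par i) p) f * der i g) \<in> sym_ideal"
      by (intro sym.cong_add sym.cong_refl sym.cong_mult_right twist_map_homogeneous f)
    then show "D0 (a \<otimes>\<^bsub>?S\<^esub> b) = (D0 a \<otimes>\<^bsub>?S\<^esub> b) \<oplus>\<^bsub>?S\<^esub> (koszul (par i) p \<odot>\<^bsub>?S\<^esub> (a \<otimes>\<^bsub>?S\<^esub> D0 b))"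
      by (simp add: f(1) g S_simps D0 scls_eq_iff der_mult smul_mult_left)
  next
    fix j assume "j \<in> {1..m + n}"
    then have "j \<in> Ix" by (simp add: Ix_def)
    then show "D0 (sym_gen scale V (X j)) = (if i = j then \<one>\<^bsub>?S\<^esub> else \<zero>\<^bsub>?S\<^esub>)"
      using i by (simp add: sym_gen_def D0 der_word xi_basis word_Nil S_simps)
  qed (auto simp: S_carrier D0 S_simps der_add der_smul, simp add: D0_def S_carrier)
  moreover have "D = D0" if "P D" for D
  proof (rule extensionalityI[of _ "carrier ?S"])
    fix x assume "x \<in> carrier ?S"
    then obtain f where "x = scls f" by (auto simp: S_carrier)
    then show "D x = D0 x"
      using superderivation_unique[OF i, of D f] that D0 unfolding P_def by (simp add: Ix_def)
  qed (use that in \<open>auto simp: P_def D0_def\<close>)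
  ultimately have "(THE D. P D) = D0"
    by (rule the_equality)
  then show ?thesis
    unfolding partial_def P_def[symmetric] by (simp only: D0)
qed

lemma partial_power_cls: "partial_power scale V m n X K (scls f) = scls (foldr der (index_word K) f)"
proof -
  have p: "(partial scale V m n X i ^^ k) (scls f) = scls ((der i ^^ k) f)" if "i \<in> Ix" for i k f
    using that by (induction k) (simp_all add: partial_cls)
  have "foldr (\<lambda>i. partial scale V m n X i ^^ K i) l (scls f) = scls (foldr der (concat (map (\<lambda>i. replicate (K i) i) l)) f)"
    if "set l \<subseteq> Ix" for l
    using that by (induction l) (simp_all add: p)
  moreover have "set [1..<m + n + 1] \<subseteq> Ix"
    by (auto simp: Ix_def)
  ultimately show ?thesis
    unfolding partial_power_def index_word_def .
qed


subsection \<open>The operators \<open>s\<^sup>K\<close>\<close>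

lemma vector_space_end_scale: "vector_space (end_scale scale)"
  by standard (simp_all add: end_scale_def fun_eq_iff scale_right_distrib scale_left_distrib)

lemma end_scale_app: "end_scale scale c f x = scale c (f x)"
  by (simp add: end_scale_def)

text \<open>
  Letters are linearised, so that \<open>ev_end\<close> kills the linearity relations between arbitrary functions
  and not only those between linear maps.
\<close>

definition linearise :: "('g \<Rightarrow> 'g) \<Rightarrow> 'g \<Rightarrow> 'g" where
  "linearise f x = (\<Sum>i\<in>Ix. scale (xi i x) (f (X i)))"

lemma linearise_linear: "Vector_Spaces.linear scale scale (linearise f)"
  by (rule linear_scaleI) (simp_all add: linearise_def scale_left_distrib sum.distrib scale_sum_right)

lemma linearise_add_right: "linearise f (x + y) = linearise f x + linearise f y" and lz_scale_right: "linearise f (scale c x) = scale c (linearise f x)"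
  using linearise_linear by (simp_all add: Vector_Spaces.linear_iff)

lemma linearise_comb: "linearise (f + end_scale scale c g) x = linearise f x + scale c (linearise g x)"
  by (simp add: linearise_def end_scale_app scale_right_distrib sum.distrib scale_sum_right mult.commute)

lemma linearise_eq: "Vector_Spaces.linear scale scale f \<Longrightarrow> linearise f = f"
proof
  fix x assume "Vector_Spaces.linear scale scale f"
  then interpret f: Vector_Spaces.linear scale scale f .
  show "linearise f x = f x"
    by (subst (2) basis_expansion) (simp add: linearise_def f.sum f.scale)
qed

text \<open>The component of parity \<open>q\<close> of an endomorphism: it sends \<open>V 0\<close>
  to \<open>V q\<close> and \<open>V 1\<close> to \<open>V (q + 1)\<close>.\<close>

definition pr_end :: "bit \<Rightarrow> ('g \<Rightarrow> 'g) \<Rightarrow> 'g \<Rightarrow> 'g" where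
  "pr_end q f x = pr q (linearise f (pr 0 x)) + pr (q + 1) (linearise f (pr 1 x))"

definition tw_end :: "bit \<Rightarrow> ('g \<Rightarrow> 'g) \<Rightarrow> 'g \<Rightarrow> 'g" where
  "tw_end q f x = pr_end 0 f x + scale (koszul q 1) (pr_end 1 f x)"

lemma end_partD:
  assumes "f \<in> end_part scale V p"
  shows "Vector_Spaces.linear scale scale f" "x \<in> V q \<Longrightarrow> f x \<in> V (p + q)"
  using assms by (auto simp: end_part_def)

lemma pr_end_part: "f \<in> end_part scale V p \<Longrightarrow> pr_end q f = (if p = q then f else 0)"
proof
  fix x assume f: "f \<in> end_part scale V p"
  interpret f: Vector_Spaces.linear scale scale f by (rule end_partD(1)[OF f])
  have "f (pr 0 x) \<in> V (p + 0)" "f (pr 1 x) \<in> V (p + 1)"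
    by (intro end_partD(2)[OF f] pr_mem)+
  note v = pr_part[OF this(1)] pr_part[OF this(2)]
  have "f (pr 0 x) + f (pr 1 x) = f x"
    by (metis f.add pr_total)
  then show "pr_end q f x = (if p = q then f else 0) x"
    using v by (cases p; cases q) (simp_all add: pr_end_def linearise_eq[OF end_partD(1)[OF f]])
qed

text \<open>Makes the basis-free symmetrisation available for End(g) without choosing a basis
  there.\<close>

sublocale Endo: super_projection "end_scale scale" "end_part scale V" pr_end tw_end
proof (intro super_projection.intro vector_space_end_scale super_projection_axioms.intro)
  fix q p c and u v :: "'g \<Rightarrow> 'g"
  show pc: "pr_end q (u + end_scale scale c v) = pr_end q u + end_scale scale c (pr_end q v)" for q
    by (simp add: fun_eq_iff pr_end_def linearise_comb pr_add pr_scale end_scale_app scale_right_distrib add_ac)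
  show "tw_end q (u + end_scale scale c v) = tw_end q u + end_scale scale c (tw_end q v)"
    unfolding fun_eq_iff tw_end_def pc by (simp add: tw_end_def end_scale_app scale_right_distrib mult.commute add_ac)
  show "0 \<in> end_part scale V p"
    by (auto simp: end_part_def subspace_0[OF subspace_part] intro!: linear_scaleI)
  assume v: "v \<in> end_part scale V p"
  then show "pr_end q v = (if p = q then v else 0)"
    by (rule pr_end_part)
  show "tw_end q v = end_scale scale (koszul q p) v"
    using v by (cases p) (simp_all add: fun_eq_iff tw_end_def pr_end_part end_scale_def)
  interpret v: Vector_Spaces.linear scale scale v by (rule end_partD(1)[OF v])
  show "end_scale scale c v \<in> end_part scale V p"
    using end_partD(2)[OF v]
    by (auto simp: end_part_def end_scale_def v.add v.scale scale_right_distrib mult.commute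
        intro!: linear_scaleI subspace_scale[OF subspace_part])
  assume u: "u \<in> end_part scale V p"
  interpret u: Vector_Spaces.linear scale scale u by (rule end_partD(1)[OF u])
  show "u + v \<in> end_part scale V p"
    using end_partD(2)[OF v] end_partD(2)[OF u]
    by (auto simp: end_part_def v.add v.scale u.add u.scale scale_right_distrib add_ac
        intro!: linear_scaleI subspace_add[OF subspace_part])
qed

text \<open>The evaluation of words as composites, serving as \<open>ev\<close> in
  \<open>symmetrisation_eq\<close>.\<close>

definition ev_end :: "('k, 'g \<Rightarrow> 'g) free_alg \<Rightarrow> 'g \<Rightarrow> 'g" where
  "ev_end = lin_ext (end_scale scale) (\<lambda>w. foldr (\<lambda>f g. linearise f \<circ> g) w id)"

lemmas ev_end_linear = linear_lin_ext[OF vector_space_end_scale, of "\<lambda>w. foldr (\<lambda>f g. linearise f \<circ> g) w id", folded ev_end_def]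

lemmas ev_end_add = module_hom.add[OF module_hom_linearI[OF ev_end_linear]]
  and ev_end_smul = module_hom.scale[OF module_hom_linearI[OF ev_end_linear]]
  and ev_end_diff = module_hom.diff[OF module_hom_linearI[OF ev_end_linear]]
  and ev_end_zero = module_hom.zero[OF module_hom_linearI[OF ev_end_linear]]

lemma ev_end_word: "ev_end (word w) = foldr (\<lambda>f g. linearise f \<circ> g) w id"
  by (simp add: ev_end_def lin_ext_word vector_space_end_scale)

lemma ev_end_app: "ev_end a (x + y) = ev_end a x + ev_end a y \<and> ev_end a (scale c x) = scale c (ev_end a x)"
proof (induction a rule: free_alg_induct)
  case (word w)
  show ?case
    by (induction w) (simp_all add: ev_end_word linearise_add_right lz_scale_right)
qed (simp_all add: ev_end_zero ev_end_add ev_end_smul end_scale_def scale_right_distrib add_ac mult.commute)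

lemma ev_end_map: "Vector_Spaces.linear scale scale (ev_end a)"
  using ev_end_app by (intro linear_scaleI) auto

lemma ev_end_mult: "ev_end (a * b) = ev_end a \<circ> ev_end b"
proof (induction a rule: free_alg_induct)
  case (word w)
  show ?case
  proof (induction b rule: free_alg_induct)
    case zero
    then show ?case using ev_end_app[of _ 0 0 0] by (simp add: ev_end_zero fun_eq_iff)
  next
    case (word w')
    show ?case
      by (induction w) (simp_all add: word_mult ev_end_word comp_assoc)
  qed (simp_all add: distrib_left smul_mult_right ev_end_add ev_end_smul fun_eq_iff ev_end_app end_scale_def)
qed (simp_all add: distrib_right smul_mult_left ev_end_zero ev_end_add ev_end_smul fun_eq_iff end_scale_def)

lemma ev_end_T: "a \<in> Endo.T \<Longrightarrow> ev_end a = 0"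
  unfolding Endo.T_def
proof (induction rule: gen_ideal.induct)
  case (gen r)
  then consider (add) u v where "r = word [u + v] - word [u] - word [v]"
    | (scale) c v where "r = word [end_scale scale c v] - smul c (word [v])"
    unfolding linearity_relations_def smul_def by blast
  then show ?case
  proof cases
    case add
    then show ?thesis
      using linearise_comb[of u 1 v] by (simp add: ev_end_diff ev_end_word fun_eq_iff end_scale_def)
  next
    case scale
    then show ?thesis
      using linearise_comb[of 0 c v]
      by (simp add: ev_end_diff ev_end_smul ev_end_word fun_eq_iff end_scale_def linearise_def scale_sum_right scale_left_commute)
  qed
next
  case (mult_left f g)
  then show ?case using ev_end_app[of g 0 0 0] by (simp add: ev_end_mult fun_eq_iff)
qed (simp_all add: ev_end_zero ev_end_add ev_end_mult fun_eq_iff)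

lemma abelian_monoid_end: "abelian_monoid (end_algebra scale)"
proof -
  have "Vector_Spaces.linear scale scale (f + g)"
    if "Vector_Spaces.linear scale scale f" "Vector_Spaces.linear scale scale g" for f g
    using that by (simp add: Vector_Spaces.linear_iff scale_right_distrib)
  moreover have "Vector_Spaces.linear scale scale 0"
    by (rule linear_scaleI) simp_all
  ultimately show ?thesis
    by (intro abelian_monoidI) (simp_all add: end_algebra_def add_ac)
qed

lemma end_symmetrisation_cls:
  assumes "a \<in> free_carrier (super_carrier (end_part scale V))"
  shows "end_symmetrisation scale V (Endo.S.cls a) = ev_end (Endo.free_sym a)"
  unfolding end_symmetrisation_def
proof (rule Endo.symmetrisation_eq[OF abelian_monoid_end _ _ _ _ _ assms])
  fix w assume w: "set w \<subseteq> super_carrier (end_part scale V)"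
  have "linearise f = f" if "f \<in> super_carrier (end_part scale V)" for f
  proof (rule linearise_eq)
    from that obtain u v where "f = u + v" "u \<in> end_part scale V 0" "v \<in> end_part scale V 1"
      by (rule Endo.C_cases)
    then show "Vector_Spaces.linear scale scale f"
      using end_partD(1)[of u 0] end_partD(1)[of v 1] by (simp add: Vector_Spaces.linear_iff scale_right_distrib)
  qed
  then show "ev_end (word w) = list_prod (end_algebra scale) (map id w)"
    unfolding ev_end_word using w by (induction w) (auto simp: list_prod_def end_algebra_def)
qed (simp_all add: end_algebra_def ev_end_map ev_end_add ev_end_smul ev_end_T fun_eq_iff)

section \<open>Symmetrised products of adjoint maps\<close>

abbreviation ad :: "'g \<Rightarrow> 'g \<Rightarrow> 'g" where "ad \<equiv> ad_tilde bracket"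

lemma ad_app: "ad v x = bracket x v"
  by (simp add: ad_tilde_def)

lemma linearise_ad: "linearise (ad v) = ad v"
  unfolding ad_tilde_def by (intro linearise_eq bracket_linear_left)

lemma ad_part: "v \<in> V p \<Longrightarrow> ad v \<in> end_part scale V p"
  using bracket_graded bracket_linear_left by (fastforce simp: end_part_def ad_tilde_def add.commute)

text \<open>The map \<open>ad v\<close> has the parity of \<open>v\<close>, so decomposing
  \<open>v\<close> decomposes \<open>ad v\<close>.\<close>

lemma ad_pr: "pr_end q (ad v) = ad (pr q v)" and ad_tw: "tw_end q (ad v) = ad (tw q v)"
proof -
  have s: "ad v = ad (pr 0 v) + end_scale scale 1 (ad (pr 1 v))"
    by (simp add: fun_eq_iff ad_tilde_def end_scale_def pr_total flip: bracket_add_right)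
  have p: "pr_end q (ad v) = ad (pr q v)" for q
    unfolding s Endo.pr_comb Endo.pr_part[OF ad_part[OF pr_mem]]
    by (cases q) (simp_all add: fun_eq_iff end_scale_def)
  then show "pr_end q (ad v) = ad (pr q v)" .
  have "tw q v = pr 0 v + scale (koszul q 1) (pr 1 v)"
    by (metis free.tw_comb free.tw_part koszul_zero(2) pr_mem pr_total scale_one)
  then show "tw_end q (ad v) = ad (tw q v)"
    by (simp add: fun_eq_iff tw_end_def p ad_app bracket_add_right bracket_scale_right)
qed

text \<open>Pulling out a letter uses only the projections and twists, and \<open>ad_pr\<close> and
  \<open>ad_tw\<close> say that passing to adjoint maps respects both.\<close>

lemma ext_ad:
  assumes "\<And>q u w. ev_end (\<beta>' q (ad u) (map ad w)) z = ad_act (\<beta> q u w) z"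
  shows "ev_end (Endo.ext \<beta>' (map ad w)) z = ad_act (free.ext \<beta> w) z"
  using assms
proof (induction w arbitrary: \<beta> \<beta>')
  case (Cons v w)
  have "ev_end (Endo.ext (\<lambda>q u w'. \<beta>' q u (tw_end q (ad v) # w')) (map ad w)) z
      = ad_act (free.ext (\<lambda>q u w'. \<beta> q u (tw q v # w')) w) z"
    using Cons.prems[of _ _ "_ # _"] by (intro Cons.IH) (simp add: ad_tw)
  then show ?case
    by (simp add: ev_end_add ad_act_add ad_pr Cons.prems)
qed (simp add: ev_end_zero ad_act_zero)

lemma word_sym_ad: "ev_end (Endo.word_sym k (map ad w)) z = ad_act (free.word_sym k w) z"
proof (induction k arbitrary: w)
  case 0
  then show ?case
    using ev_end_word[of "[]"] ad_act_word[of "[]" z] by (simp add: word_Nil)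
next
  case (Suc k)
  have "ev_end (Endo.ext (\<lambda>q u w'. word [u] * Endo.word_sym k w') (map ad w)) z
      = ad_act (free.ext (\<lambda>q u w'. word [u] * free.word_sym k w') w) z"
    by (rule ext_ad) (simp add: ev_end_mult ev_end_word linearise_ad ad_act_letter_mult Suc ad_app)
  then show ?case
    by (simp add: ev_end_smul ad_act_smul end_scale_def)
qed

lemma ad_act_app: "ad_act f (x + y) = ad_act f x + ad_act f y \<and> ad_act f (scale c x) = scale c (ad_act f x)"
proof (induction f rule: free_alg_induct)
  case (word w)
  show ?case
    by (induction w) (simp_all add: ad_act_word ad_tilde_def bracket_add_left bracket_scale_left)
qed (simp_all add: ad_act_zero ad_act_add ad_act_smul scale_right_distrib add_ac mult.commute)

lemma ad_act_zero_right: "ad_act f 0 = 0"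
  using ad_act_app[of f 0 0 0] by simp

lemma ad_act_mult: "ad_act (f * g) z = ad_act f (ad_act g z)"
proof (induction f rule: free_alg_induct)
  case (word w)
  show ?case
  proof (induction g rule: free_alg_induct)
    case (word w')
    then show ?case by (simp add: word_mult ad_act_word)
  qed (simp_all add: distrib_left smul_mult_right ad_act_zero ad_act_add ad_act_smul ad_act_app ad_act_zero_right)
qed (simp_all add: distrib_right smul_mult_left ad_act_zero ad_act_add ad_act_smul)

lemma ad_act_lin_ideal: "f \<in> lin_ideal \<Longrightarrow> ad_act f z = 0"
  unfolding lin_ideal_def
proof (induction arbitrary: z rule: gen_ideal.induct)
  case (gen r)
  then show ?case
    by (auto simp: linearity_relations_def scalar_smul ad_act_word ad_tilde_def bracket_add_right
        bracket_scale_right ad_act_smul module_hom.diff[OF module_hom_linearI[OF ad_act_linear]])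
qed (simp_all add: ad_act_zero ad_act_add ad_act_mult ad_act_zero_right)

text \<open>Naturality of symmetrisation along the even linear map \<open>ad_tilde\<close>
  (\<open>word_sym_ad\<close>). Passing from \<open>free_sym\<close> to \<open>symmetrise\<close>
  costs only linearity relations, which \<open>ad_act\<close> kills.\<close>

lemma s_operator_eq: "s_operator scale V bracket m n X K z = s_op K z"
proof -
  let ?SE = "Sym (end_scale scale) (end_part scale V)"
  let ?C = "super_carrier (end_part scale V)"
  let ?gen = "\<lambda>i. sym_gen (end_scale scale) (end_part scale V) (ad (X i))"
  have adC: "ad v \<in> ?C" for v
  proof -
    have "ad v = ad (pr 0 v) + ad (pr 1 v)"
      by (simp add: fun_eq_iff ad_tilde_def pr_total flip: bracket_add_right)
    then show ?thesis
      unfolding super_carrier_def using ad_part[OF pr_mem] by blast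
  qed
  then have c: "(word (map ad w) :: ('k, 'g \<Rightarrow> 'g) free_alg) \<in> free_carrier ?C" for w
    by (auto simp: free_carrier_word)
  have pow: "?gen i [^]\<^bsub>?SE\<^esub> k = Endo.S.cls (word (map ad (map X (replicate k i))))" for i k
  proof (induction k)
    case 0
    then show ?case by (simp add: nat_pow_def Endo.S.A_one word_Nil)
  next
    case (Suc k)
    have "?gen i [^]\<^bsub>?SE\<^esub> Suc k = (?gen i [^]\<^bsub>?SE\<^esub> k) \<otimes>\<^bsub>?SE\<^esub> ?gen i"
      by (simp add: nat_pow_def)
    also have "\<dots> = Endo.S.cls (word (map ad (map X (replicate k i)))) \<otimes>\<^bsub>?SE\<^esub> Endo.S.cls (word (map ad [X i]))"
      unfolding Suc by (simp add: sym_gen_def)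
    also have "\<dots> = Endo.S.cls (word (map ad (map X (replicate k i))) * word (map ad [X i]))"
      by (rule Endo.S.A_mult[OF c c])
    also have "\<dots> = Endo.S.cls (word (map ad (map X (replicate (Suc k) i))))"
      by (simp add: word_mult replicate_append_same)
    finally show ?case .
  qed
  have "list_prod ?SE (map (\<lambda>i. ?gen i [^]\<^bsub>?SE\<^esub> K i) l)
      = Endo.S.cls (word (map ad (map X (concat (map (\<lambda>i. replicate (K i) i) l)))))" for l
  proof (induction l)
    case Nil
    then show ?case by (simp add: list_prod_def Endo.S.A_one word_Nil)
  next
    case (Cons i l)
    have "list_prod ?SE (map (\<lambda>i. ?gen i [^]\<^bsub>?SE\<^esub> K i) (i # l))
        = (?gen i [^]\<^bsub>?SE\<^esub> K i) \<otimes>\<^bsub>?SE\<^esub> list_prod ?SE (map (\<lambda>i. ?gen i [^]\<^bsub>?SE\<^esub> K i) l)"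
      by (simp add: list_prod_def)
    then show ?case
      unfolding pow
      by (simp only: Cons[unfolded pow] Endo.S.A_mult[OF c c] word_mult map_append concat.simps list.map)
  qed
  then have "s_operator scale V bracket m n X K = end_symmetrisation scale V (Endo.S.cls (word (map ad (map X (index_word K)))))"
    by (simp add: s_operator_def Let_def index_word_def)
  also have "\<dots> = ev_end (Endo.free_sym (word (map ad (map X (index_word K)))))"
    by (rule end_symmetrisation_cls[OF c])
  finally have "s_operator scale V bracket m n X K z = ad_act (free.free_sym (word (map X (index_word K)))) z"
    using word_sym_ad[of "length (index_word K)" "map X (index_word K)" z] by (simp add: Endo.free_sym_word free.free_sym_word)
  also have "\<dots> = s_op K z"
    using ad_act_lin_ideal[OF free_sym_symmetrise, of "word (map X (index_word K))" z]
    by (simp add: module_hom.diff[OF module_hom_linearI[OF ad_act_linear]])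
  finally show ?thesis .
qed

lemma pi_summand_cls:
  "pi_summand scale V bracket m n X Z (scls f) K = scls (smul
     ((- 1) ^ mi_size m n K * bernoulli (mi_size m n K) / mi_fact m K) (emb (s_op K Z) * foldr der (index_word K) f))"
proof -
  have "word [s_op K Z] * foldr der (index_word K) f - emb (s_op K Z) * foldr der (index_word K) f \<in> sym_ideal"
    using letter_emb lin_subset_sym by (intro sym.cong_mult_right) blast
  from sym_smul_cong[OF this] show ?thesis
    by (simp add: pi_summand_def s_operator_eq sym_gen_def partial_power_cls S_simps scls_eq_iff)
qed

lemma sym_action_formula:
  fixes Z :: 'g
  assumes "Y \<in> carrier (Sym scale V)"
  defines "supp \<equiv> {K \<in> multi_indices m n. pi_summand scale V bracket m n X Z Y K \<noteq> \<zero>\<^bsub>Sym scale V\<^esub>}"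
  shows "finite supp \<and> sym_action scale V bracket Z Y = (\<Oplus>\<^bsub>Sym scale V\<^esub>K\<in>supp. pi_summand scale V bracket m n X Z Y K)"
proof -
  let ?S = "Sym scale V"
  let ?p = "pi_summand scale V bracket m n X Z Y"
  obtain f where Y: "Y = scls f"
    using assms(1) by (auto simp: S_carrier)
  obtain N where N: "\<forall>w\<in>Poly_Mapping.keys f. length w \<le> N"
    using ex_bound by blast
  \<comment> \<open>A finite set containing the support: once the size of \<open>K\<close> exceeds
    the word lengths in the representative \<open>f\<close>, its derivative vanishes. Summands of
    \<open>?M\<close> outside the support are zero.\<close>
  let ?M = "{K. K \<in> multi_indices m n \<and> mi_size m n K \<le> N}"
  have "?M = (\<Union>k\<le>N. sized_indices k)"
    by (auto simp: sized_indices_def)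
  then have fin: "finite ?M"
    by (simp add: finite_sized_indices)
  have sub: "supp \<subseteq> ?M"
  proof
    fix K assume K: "K \<in> supp"
    have "mi_size m n K \<le> N"
    proof (rule ccontr)
      assume "\<not> mi_size m n K \<le> N"
      then have "foldr der (index_word K) f = 0"
        using N by (intro foldr_der_bounded) (auto simp: length_index_word)
      with K show False
        by (simp add: supp_def Y pi_summand_cls S_simps)
    qed
    with K show "K \<in> ?M" by (simp add: supp_def)
  qed
  have "sym_action scale V bracket Z Y = scls (pi_op Z f)"
    by (simp add: Y sym_action_cls)
  also have "\<dots> = (\<Oplus>\<^bsub>?S\<^esub>K\<in>?M. ?p K)"
    unfolding Y pi_summand_cls free.S.A_sum[OF fin free_carrier_all]
    using N by (intro arg_cong[where f = scls] pi_op_multi_indices) auto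
  also have "\<dots> = (\<Oplus>\<^bsub>?S\<^esub>K\<in>supp. ?p K)"
  proof (rule free.S.A.add.finprod_mono_neutral_cong_right[OF fin sub])
    show "?p K = \<zero>\<^bsub>?S\<^esub>" if "K \<in> ?M - supp" for K
      using that by (simp add: supp_def)
    show "?p \<in> ?M \<rightarrow> carrier ?S"
      by (simp add: Y pi_summand_cls S_carrier)
  qed simp
  finally show ?thesis
    using finite_subset[OF sub fin] by simp
qed

end

theorem theorem3p2:
  fixes scale :: "'k::real_normed_field \<Rightarrow> 'g::ab_group_add \<Rightarrow> 'g"
    and V :: "bit \<Rightarrow> 'g set"
    and bracket :: "'g \<Rightarrow> 'g \<Rightarrow> 'g"
    and m n :: nat
    and X :: "nat \<Rightarrow> 'g"
    and Z :: 'g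
    and Y :: "('k, 'g) free_alg set"
  assumes "lie_superalgebra scale V bracket"
    and "super_basis scale V m n X"
    and "Y \<in> carrier (Sym scale V)"
  shows "let supp = {K \<in> multi_indices m n.
                       pi_summand scale V bracket m n X Z Y K \<noteq> \<zero>\<^bsub>Sym scale V\<^esub>}
         in finite supp \<and>
            sym_action scale V bracket Z Y =
              (\<Oplus>\<^bsub>Sym scale V\<^esub>K\<in>supp. pi_summand scale V bracket m n X Z Y K)"
proof -
  interpret based_lie_superalgebra scale V bracket m n X
    using assms(1,2) by (simp add: based_lie_superalgebra_def based_lie_superalgebra_axioms_def)
  show ?thesis
    unfolding Let_def by (rule sym_action_formula[OF assms(3)])
qed

end
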